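(* Let $\varepsilon>0$ be fixed, $C<\infty$, and let $\{w_n\}\subset\mathcal{A}$ satisfy $\mathcal{E}_{\varepsilon}(w_n)\le C$ for all $n$. Then $\{w_n\}$ is precompact in $L^p(\mathbb{T}^2)$ for any $p\in[1,6)$.
   Context: $\mathbb{T}^2=[0,1)^2$ is the flat torus with Lebesgue measure; functions are real valued and 1-periodic in each variable. Fourier coefficients $\widehat f(k)$ are indexed by $k=(k_1,k_2)\in(2\pi\mathbb{Z})^2$. A periodic distribution $f$ on $\mathbb{T}^2$ has vanishing mean in $x_1$ if $\widehat f(k)=0$ for all $k\in(2\pi\mathbb{Z})^2$ with $k_1=0$ (for integrable functions: $\int_0^1 f(x_1,x_2)\,dx_1=0$ for a.e. $x_2$). For such $f$, $|\partial_1|^{-1}f$ is defined by $\widehat{|\partial_1|^{-1}f}(k)=|k_1|^{-1}\widehat f(k)$ for $k_1\ne0$ (and $0$ for $k_1=0$). For $w\in L^2(\mathbb{T}^2)$ with vanishing mean in $x_1$, put $\eta_w=\partial_2 w-\partial_1\tfrac12w^2$ (a distribution with vanishing mean in $x_1$), and for $\varepsilon>0$ $$\mathcal{E}(w)=\left(\int_{\mathbb{T}^2}(|\partial_1|^{-1}\eta_w)^2dx\right)^{1/2}\left(\int_{\mathbb{T}^2}(\partial_1 w)^2dx\right)^{1/2},\qquad \mathcal{E}_\varepsilon(w)=\frac12\int_{\mathbb{T}^2}\frac1\varepsilon(|\partial_1|^{-1}\eta_w)^2+\varepsilon(\partial_1w)^2\,dx,$$ where an integral is $+\infty$ if the corresponding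 distribution is not in $L^2(\mathbb{T}^2)$, and $\mathcal{E}(w)=+\infty$ if one of the two integrals is $+\infty$. The set $\mathcal{A}$ consists of all $w\in L^2(\mathbb{T}^2)$ with vanishing mean in $x_1$ and $\mathcal{E}(w)<\infty$. Precompact means that every subsequence has a further subsequence converging strongly in the indicated norm. *)

theory Defs
  imports "HOL-Analysis.Analysis"
begin

definition torus :: "(real \<times> real) measure" where
  "torus = lebesgue_on ({0..<1} \<times> {0..<1})"

definition periodic :: "(real \<times> real \<Rightarrow> 'a) \<Rightarrow> bool" where
  "periodic f \<longleftrightarrow> (\<forall>x y. f (x + 1, y) = f (x, y) \<and> f (x, y + 1) = f (x, y))"

text \<open>Elements of \<open>Lp p\<close> are representatives; almost everywhere equal functions are not identified.\<close>

definition Lp :: "real \<Rightarrow> (real \<times> real \<Rightarrow> real) set" where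
  "Lp p = {f. periodic f \<and> f \<in> borel_measurable torus \<and> integrable torus (\<lambda>x. \<bar>f x\<bar> powr p)}"

definition Lp_norm :: "real \<Rightarrow> (real \<times> real \<Rightarrow> real) \<Rightarrow> real" where
  "Lp_norm p f = (LINT x|torus. \<bar>f x\<bar> powr p) powr (1 / p)"

definition Lp_precompact :: "real \<Rightarrow> (nat \<Rightarrow> real \<times> real \<Rightarrow> real) \<Rightarrow> bool" where
  "Lp_precompact p w \<longleftrightarrow>
     (\<forall>n. w n \<in> Lp p) \<and>
     (\<forall>r :: nat \<Rightarrow> nat. strict_mono r \<longrightarrow>
        (\<exists>(s :: nat \<Rightarrow> nat) v. strict_mono s \<and> v \<in> Lp p \<and>
           (\<lambda>j. Lp_norm p (\<lambda>x. w (r (s j)) x - v x)) \<longlonglongrightarrow> 0))"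

definition partial_deriv ::
  "real \<times> real \<Rightarrow> (real \<times> real \<Rightarrow> complex) \<Rightarrow> real \<times> real \<Rightarrow> complex" where
  "partial_deriv e \<phi> x = frechet_derivative \<phi> (at x) e"

text \<open>The largest class of differentiable functions closed under both partial derivatives,
  i.e. the functions of class \<open>C\<^sup>\<infinity>\<close>.\<close>

coinductive smooth :: "(real \<times> real \<Rightarrow> complex) \<Rightarrow> bool" where
  "\<lbrakk>\<forall>x. \<phi> differentiable (at x); smooth (partial_deriv (1, 0) \<phi>); smooth (partial_deriv (0, 1) \<phi>)\<rbrakk>
   \<Longrightarrow> smooth \<phi>"

definition test_fun :: "(real \<times> real \<Rightarrow> complex) \<Rightarrow> bool" where
  "test_fun \<phi> \<longleftrightarrow> smooth \<phi> \<and> periodic \<phi>"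

text \<open>Periodic distributions act on complex test functions by a bilinear pairing (no conjugation).
  Only their values on \<^const>\<open>test_fun\<close> are meaningful.\<close>

type_synonym distr = "(real \<times> real \<Rightarrow> complex) \<Rightarrow> complex"

definition regular :: "(real \<times> real \<Rightarrow> real) \<Rightarrow> distr" where
  "regular f \<phi> = (LINT x|torus. complex_of_real (f x) * \<phi> x)"

definition d1 :: "distr \<Rightarrow> distr" where
  "d1 T \<phi> = - T (partial_deriv (1, 0) \<phi>)"

definition d2 :: "distr \<Rightarrow> distr" where
  "d2 T \<phi> = - T (partial_deriv (0, 1) \<phi>)"

definition freqs :: "(real \<times> real) set" where
  "freqs = {(2 * pi * of_int m, 2 * pi * of_int n) | m n :: int. True}"

definition expo :: "real \<times> real \<Rightarrow> real \<times> real \<Rightarrow> complex" where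
  "expo k x = cis (k \<bullet> x)"

definition fourier :: "distr \<Rightarrow> real \<times> real \<Rightarrow> complex" where
  "fourier T k = T (expo (- k))"

definition vanishing_mean_x1 :: "distr \<Rightarrow> bool" where
  "vanishing_mean_x1 T \<longleftrightarrow> (\<forall>k\<in>freqs. fst k = 0 \<longrightarrow> fourier T k = 0)"

text \<open>The distribution with Fourier coefficients \<open>c\<close>, that is \<open>\<Sum>\<^sub>k c\<^sub>k e\<^sup>i\<^sup>k\<^sup>x\<close> applied termwise.
  The sum converges absolutely on test functions when \<open>c\<close> has polynomial growth.\<close>

definition distr_of_coeffs :: "(real \<times> real \<Rightarrow> complex) \<Rightarrow> distr" where
  "distr_of_coeffs c \<phi> = (\<Sum>\<^sub>\<infinity>k\<in>freqs. c k * (LINT x|torus. expo k x * \<phi> x))"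

definition inv_abs_d1 :: "distr \<Rightarrow> distr" where
  "inv_abs_d1 T =
     distr_of_coeffs (\<lambda>k. if fst k = 0 then 0 else fourier T k / complex_of_real \<bar>fst k\<bar>)"

text \<open>The integral of \<open>T\<^sup>2\<close>. The square integrable \<open>g\<close> representing \<open>T\<close> is unique up to null sets,
  so the infimum is the value at any such \<open>g\<close>; it is \<open>\<infinity>\<close> if there is none.\<close>

definition sq_integral :: "distr \<Rightarrow> ennreal" where
  "sq_integral T =
     (INF g\<in>{g \<in> Lp 2. \<forall>\<phi>. test_fun \<phi> \<longrightarrow> T \<phi> = regular g \<phi>}.
        \<integral>\<^sup>+x. ennreal ((g x)\<^sup>2) \<partial>torus)"

definition eta :: "(real \<times> real \<Rightarrow> real) \<Rightarrow> distr" where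
  "eta w \<phi> = d2 (regular w) \<phi> - d1 (regular (\<lambda>x. (w x)\<^sup>2 / 2)) \<phi>"

text \<open>The case distinction is needed because \<open>0 * \<infinity> = 0\<close> in \<^typ>\<open>ennreal\<close>.\<close>

definition energy :: "(real \<times> real \<Rightarrow> real) \<Rightarrow> ennreal" where
  "energy w =
     (let a = sq_integral (inv_abs_d1 (eta w)); b = sq_integral (d1 (regular w))
      in if a = \<infinity> \<or> b = \<infinity> then \<infinity> else ennreal (sqrt (enn2real a) * sqrt (enn2real b)))"

definition energy_eps :: "real \<Rightarrow> (real \<times> real \<Rightarrow> real) \<Rightarrow> ennreal" where
  "energy_eps \<epsilon> w =
     ennreal (1 / 2) * (ennreal (1 / \<epsilon>) * sq_integral (inv_abs_d1 (eta w))
                        + ennreal \<epsilon> * sq_integral (d1 (regular w)))"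

definition admissible :: "(real \<times> real \<Rightarrow> real) set" where
  "admissible = {w \<in> Lp 2. vanishing_mean_x1 (regular w) \<and> energy w < \<infinity>}"

end

theory Submission
  imports Defs "HOL-Complex_Analysis.Great_Picard"
begin

text \<open>
  Write \<open>h = \<partial>\<^sub>1 w\<close> and \<open>g = |\<partial>\<^sub>1|\<^sup>-\<^sup>1 \<eta>\<^sub>w\<close>, so that \<open>\<partial>\<^sub>2 w = \<partial>\<^sub>1 (w\<^sup>2/2) + |\<partial>\<^sub>1| g\<close> with \<open>h\<close> and \<open>g\<close> bounded
  in \<open>L\<^sup>2\<close>. Formally \<open>d/dx\<^sub>2 \<integral> w\<^sup>2 dx\<^sub>1 = 2 \<integral> w |\<partial>\<^sub>1| g dx\<^sub>1\<close>, because \<open>\<integral> w \<partial>\<^sub>1 (w\<^sup>2) dx\<^sub>1 = 0\<close>, so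
  \<open>\<integral> w\<^sup>2 dx\<^sub>1\<close> is bounded uniformly in \<open>x\<^sub>2\<close>. The regularity needed for this identity is missing; it is
  therefore applied to the truncations of \<open>w\<close> to the frequencies \<open>|k\<^sub>1| \<le> N\<close>, where the cubic term
  no longer vanishes but is at most \<open>2 \<parallel>h\<parallel>\<^sup>2 \<parallel>w\<^sub>N\<parallel>\<close> on each slice, uniformly in \<open>N\<close>, which still closes
  the estimate. Together with \<open>w\<^sup>2 \<le> 3 \<parallel>w\<parallel> \<parallel>h\<parallel>\<close> on slices this bounds \<open>w\<close> in \<open>L\<^sup>6\<close>. Each partial Fourier
  coefficient in \<open>x\<^sub>1\<close> is equicontinuous in \<open>x\<^sub>2\<close>, and the high frequencies are controlled by \<open>h\<close>;
  this gives compactness in \<open>L\<^sup>2\<close>, and the \<open>L\<^sup>6\<close> bound improves it to \<open>L\<^sup>p\<close> with \<open>p < 6\<close>.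
\<close>

subsection \<open>Lebesgue measure on the unit interval and Fourier coefficients\<close>

text \<open>The distributional identities are tested on exponentials only, so \<open>w\<close>,
  \<open>h\<close> and \<open>g\<close> enter through their double Fourier coefficients. One fact
  then takes the place of a theory of weak derivatives: if the coefficients of \<open>u\<close> are
  2 pi i k times those of \<open>f\<close>, then \<open>f\<close> is a constant plus a primitive of
  \<open>u\<close>. It is used in the first variable on slices, and in the second variable, where it
  turns the equation into one scalar equation per frequency. Truncation has a second benefit: the
  energy of finitely many modes is continuous in the second variable, so its maximum M is finite
  before any bound is known. The cubic error is linear in the norm of the truncation, hence grows
  only like sqrt M, and the resulting inequality M <= 3 B + 1 + 2 B sqrt M bounds M in terms of B. A
  further obstacle is that \<open>g\<close> is only square integrable in the second variable, so the
  coefficients of \<open>w\<close> have no Lipschitz bound there; Young's inequality with a free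
  parameter still yields a common modulus of continuity.\<close>

lemma Cauchy_Schwarz_integral:
  fixes f g :: "'a \<Rightarrow> real"
  assumes [measurable]: "f \<in> borel_measurable M" "g \<in> borel_measurable M"
    and "integrable M (\<lambda>x. (f x)\<^sup>2)" "integrable M (\<lambda>x. (g x)\<^sup>2)"
  shows "integrable M (\<lambda>x. f x * g x)"
    and "(LINT x|M. \<bar>f x * g x\<bar>) \<le> sqrt (LINT x|M. (f x)\<^sup>2) * sqrt (LINT x|M. (g x)\<^sup>2)"
proof -
  have int: "integrable M (\<lambda>x. f x * g x)"
  proof (rule Bochner_Integration.integrable_bound)
    show "integrable M (\<lambda>x. (f x)\<^sup>2 + (g x)\<^sup>2)" using assms by simp
    have "\<bar>a * b\<bar> \<le> a\<^sup>2 + b\<^sup>2" for a b :: real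
      using sum_squares_bound[of "\<bar>a\<bar>" "\<bar>b\<bar>"] zero_le_power2[of a] zero_le_power2[of b]
      unfolding abs_mult power2_abs by linarith
    then show "AE x in M. norm (f x * g x) \<le> norm ((f x)\<^sup>2 + (g x)\<^sup>2)" by auto
  qed simp
  then show "integrable M (\<lambda>x. f x * g x)" .
  have "(\<integral>\<^sup>+x. ennreal \<bar>f x\<bar> * ennreal \<bar>g x\<bar> \<partial>M)\<^sup>2 \<le>
      (\<integral>\<^sup>+x. (ennreal \<bar>f x\<bar>)\<^sup>2 \<partial>M) * (\<integral>\<^sup>+x. (ennreal \<bar>g x\<bar>)\<^sup>2 \<partial>M)"
    by (rule Cauchy_Schwarz_nn_integral) auto
  also have "(\<lambda>x. ennreal \<bar>f x\<bar> * ennreal \<bar>g x\<bar>) = (\<lambda>x. ennreal \<bar>f x * g x\<bar>)"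
    by (simp add: ennreal_mult abs_mult)
  also have "(\<integral>\<^sup>+x. (ennreal \<bar>f x\<bar>)\<^sup>2 \<partial>M) = ennreal (LINT x|M. (f x)\<^sup>2)"
    using assms by (subst nn_integral_eq_integral[symmetric]) (auto simp: ennreal_power)
  also have "(\<integral>\<^sup>+x. (ennreal \<bar>g x\<bar>)\<^sup>2 \<partial>M) = ennreal (LINT x|M. (g x)\<^sup>2)"
    using assms by (subst nn_integral_eq_integral[symmetric]) (auto simp: ennreal_power)
  also have "(\<integral>\<^sup>+x. ennreal \<bar>f x * g x\<bar> \<partial>M) = ennreal (LINT x|M. \<bar>f x * g x\<bar>)"
    using int by (intro nn_integral_eq_integral) auto
  finally have "(LINT x|M. \<bar>f x * g x\<bar>)\<^sup>2 \<le> (LINT x|M. (f x)\<^sup>2) * (LINT x|M. (g x)\<^sup>2)"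
    by (simp add: ennreal_power ennreal_mult[symmetric] integral_nonneg)
  then show "(LINT x|M. \<bar>f x * g x\<bar>) \<le> sqrt (LINT x|M. (f x)\<^sup>2) * sqrt (LINT x|M. (g x)\<^sup>2)"
    by (metis real_le_rsqrt real_sqrt_mult)
qed

text \<open>Half-open like the torus, so that the product of two copies has the same underlying set;
  Borel rather than Lebesgue sets, so that Fubini for product measures applies as it stands.\<close>

definition uint :: "real measure" where
  "uint = restrict_space lborel {0..<1}"

lemma space_uint [simp]: "space uint = {0..<1}"
  by (simp add: uint_def space_restrict_space)

lemma sets_uint [measurable_cong]: "sets uint = sets (restrict_space borel {0..<1})"
  by (simp add: uint_def sets_restrict_space)

lemma emeasure_space_uint: "emeasure uint {0..<1} = 1"
  by (simp add: uint_def emeasure_restrict_space)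

interpretation uint: finite_measure uint
  by standard (simp add: emeasure_space_uint)

lemma measure_uint [simp]: "measure uint {0..<1} = 1"
  by (simp add: measure_def emeasure_space_uint)

lemma integral_uint_conv:
  fixes f :: "real \<Rightarrow> 'a :: {banach, second_countable_topology}"
  assumes "f \<in> borel_measurable borel"
  shows "(LINT x|uint. f x) = (LINT x|lborel. indicator {0..1} x *\<^sub>R f x)"
proof -
  have "(LINT x|uint. f x) = (LINT x|lborel. indicator {0..<1} x *\<^sub>R f x)"
    unfolding uint_def by (subst integral_restrict_space) auto
  also have "\<dots> = (LINT x|lborel. indicator {0..1} x *\<^sub>R f x)"
  proof (rule integral_cong_AE)
    show "AE x in lborel. indicator {0..<1} x *\<^sub>R f x = indicator {0..1} x *\<^sub>R f x"
      using AE_lborel_singleton[of 1] by eventually_elim (auto simp: indicator_def)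
  qed (use assms in simp_all)
  finally show ?thesis .
qed

lemma integral_uint_FTC:
  fixes F f :: "real \<Rightarrow> 'a :: euclidean_space"
  assumes "\<And>x. (F has_vector_derivative f x) (at x)" and cont: "continuous_on UNIV f"
  shows "(LINT x|uint. f x) = F 1 - F 0"
proof -
  have m: "f \<in> borel_measurable borel" using cont by (rule borel_measurable_continuous_onI)
  have "(LINT x|lborel. indicator {0..1} x *\<^sub>R f x) = F 1 - F 0"
    by (rule integral_FTC_Icc) (auto intro: has_vector_derivative_at_within assms continuous_on_subset[OF cont])
  then show ?thesis by (simp add: integral_uint_conv[OF m])
qed

lemma measurable_ident_uint [measurable]: "(\<lambda>x. x) \<in> measurable uint borel"
  unfolding uint_def by (rule measurable_restrict_space1) simp

lemma AE_uint_neq: "AE x in uint. x \<noteq> c"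
  unfolding uint_def by (subst AE_restrict_space_iff) (use AE_lborel_singleton[of c] in auto)

lemma integrable_uint_bounded:
  fixes f :: "real \<Rightarrow> 'a :: {banach, second_countable_topology}"
  assumes "f \<in> borel_measurable uint" "\<And>x. 0 \<le> x \<Longrightarrow> x < 1 \<Longrightarrow> norm (f x) \<le> B"
  shows "integrable uint f"
  using assms by (intro uint.integrable_const_bound[of _ B]) (auto intro!: AE_I2)

lemma integrable_uint_mult_bounded:
  fixes f g :: "real \<Rightarrow> 'a :: {real_normed_algebra, banach, second_countable_topology}"
  assumes "integrable uint f" and [measurable]: "g \<in> borel_measurable uint"
    and B: "\<And>x. 0 \<le> x \<Longrightarrow> x < 1 \<Longrightarrow> norm (g x) \<le> B"
  shows "integrable uint (\<lambda>x. f x * g x)"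
proof (rule Bochner_Integration.integrable_bound)
  show "integrable uint (\<lambda>x. B * norm (f x))" using assms by auto
  show "(\<lambda>x. f x * g x) \<in> borel_measurable uint" using assms by measurable
  show "AE x in uint. norm (f x * g x) \<le> norm (B * norm (f x))"
  proof (rule AE_I2)
    fix x assume "x \<in> space uint"
    then have "norm (g x) \<le> B" by (auto intro: B)
    moreover have "0 \<le> B" using \<open>norm (g x) \<le> B\<close> norm_ge_zero order_trans by blast
    ultimately show "norm (f x * g x) \<le> norm (B * norm (f x))"
      by (smt (verit, best) norm_mult_ineq mult.commute mult_right_mono norm_ge_zero real_norm_def zero_le_mult_iff)
  qed
qed

section \<open>Exponentials and Fourier coefficients of period one\<close>

definition expi :: "int \<Rightarrow> real \<Rightarrow> complex" where
  "expi k x = cis (2 * pi * of_int k * x)"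

lemma expi_0 [simp]: "expi 0 x = 1" by (simp add: expi_def)
lemma norm_expi [simp]: "norm (expi k x) = 1" by (simp add: expi_def)
lemma cnj_expi: "cnj (expi k x) = expi (- k) x" by (simp add: expi_def cis_cnj)
lemma expi_add: "expi (j + k) x = expi j x * expi k x"
  by (simp add: expi_def cis_mult algebra_simps)
lemma expi_int [simp]: "expi k 1 = 1" "expi k 0 = 1"
  by (simp_all add: expi_def cis_multiple_2pi)

lemma expi_deriv:
  "(expi k has_vector_derivative (2 * pi * of_int k * \<i>) * expi k x) (at x within S)"
  unfolding expi_def cis_conv_exp
proof -
  have "((\<lambda>t. exp (t *\<^sub>R (2 * pi * of_int k * \<i>))) has_vector_derivative
      exp (x *\<^sub>R (2 * pi * of_int k * \<i>)) * (2 * pi * of_int k * \<i>)) (at x within S)"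
    by (rule exp_scaleR_has_vector_derivative_right)
  then show "((\<lambda>x. exp (\<i> * complex_of_real (2 * pi * real_of_int k * x))) has_vector_derivative
      2 * pi * of_int k * \<i> * exp (\<i> * complex_of_real (2 * pi * real_of_int k * x))) (at x within S)"
    by (simp add: scaleR_conv_of_real mult_ac)
qed

lemma continuous_on_expi [continuous_intros]: "continuous_on S (expi k)"
  unfolding expi_def by (intro continuous_intros)

lemma measurable_expi [measurable]: "expi k \<in> borel_measurable borel"
  by (intro borel_measurable_continuous_onI continuous_intros)

lemma integral_expi: "(LINT x|uint. expi k x) = (if k = 0 then 1 else 0)"
proof (cases "k = 0")
  case False
  define F where "F x = expi k x / (2 * pi * of_int k * \<i>)" for x
  have "(F has_vector_derivative expi k x) (at x)" for x
  proof -
    have "(F has_vector_derivative ((2 * pi * of_int k * \<i>) * expi k x) / (2 * pi * of_int k * \<i>)) (at x)"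
      unfolding F_def by (intro has_vector_derivative_divide expi_deriv)
    then show ?thesis using False by simp
  qed
  then have "(LINT x|uint. expi k x) = F 1 - F 0"
    by (rule integral_uint_FTC) (intro continuous_intros)
  then show ?thesis using False by (simp add: F_def)
qed simp

definition fc :: "(real \<Rightarrow> complex) \<Rightarrow> int \<Rightarrow> complex" where
  "fc f k = (LINT x|uint. f x * expi (- k) x)"

lemma integrable_mult_expi:
  assumes "integrable uint f" shows "integrable uint (\<lambda>x. f x * expi k x)"
  by (rule integrable_uint_mult_bounded[where B = 1, OF assms]) auto

lemma fc_add: "integrable uint f \<Longrightarrow> integrable uint g \<Longrightarrow> fc (\<lambda>x. f x + g x) k = fc f k + fc g k"
  and fc_diff: "integrable uint f \<Longrightarrow> integrable uint g \<Longrightarrow> fc (\<lambda>x. f x - g x) k = fc f k - fc g k"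
  by (simp_all add: fc_def ring_distribs integrable_mult_expi)

lemma fc_cmult: "fc (\<lambda>x. c * f x) k = c * fc f k"
  by (simp add: fc_def mult.assoc)

lemma fc_mult_expi: "fc (\<lambda>x. f x * expi j x) k = fc f (k - j)"
  unfolding fc_def by (simp add: mult.assoc flip: expi_add)

lemma fc_expi: "fc (expi j) k = (if j = k then 1 else 0)"
  unfolding fc_def by (simp add: integral_expi flip: expi_add)

lemma fc_const: "fc (\<lambda>x. c) k = (if k = 0 then c else 0)"
  using fc_cmult[of c "expi 0" k] by (auto simp: fc_expi)

lemma norm_fc_le:
  assumes "integrable uint f" shows "norm (fc f k) \<le> (LINT x|uint. norm (f x))"
proof -
  have "norm (fc f k) \<le> (LINT x|uint. norm (f x * expi (-k) x))"
    unfolding fc_def by (rule integral_norm_bound)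
  then show ?thesis by (simp add: norm_mult)
qed

lemma cnj_fc: "cnj (fc (\<lambda>x. complex_of_real (f x)) k) = fc (\<lambda>x. complex_of_real (f x)) (- k)"
  unfolding fc_def by (simp add: cnj_expi flip: Bochner_Integration.integral_cnj)

subsection \<open>Uniqueness of Fourier coefficients\<close>

definition prim :: "(real \<Rightarrow> 'a::{banach, second_countable_topology}) \<Rightarrow> real \<Rightarrow> 'a" where
  "prim u x = (LINT t|uint. indicator {..<x} t *\<^sub>R u t)"

lemma integrable_uint_indicator:
  fixes u :: "real \<Rightarrow> 'a::{banach, second_countable_topology}"
  assumes "integrable uint u" "A \<in> sets borel"
  shows "integrable uint (\<lambda>t. indicator A t *\<^sub>R u t)"
proof -
  have "{0..<1} \<inter> A \<in> sets uint"
    using assms(2) by (auto simp: sets_uint sets_restrict_space)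
  then have "integrable uint (\<lambda>t. indicator ({0..<1} \<inter> A) t *\<^sub>R u t)"
    by (intro integrable_mult_indicator assms)
  then show ?thesis
    by (rule Bochner_Integration.integrable_cong[THEN iffD1, rotated -1]) (auto simp: indicator_def)
qed

lemma prim_neg: "x \<le> 0 \<Longrightarrow> prim u x = 0"
  unfolding prim_def by (subst Bochner_Integration.integral_cong[OF refl, of _ _ "\<lambda>t. 0"]) auto

lemma prim_0 [simp]: "prim u 0 = 0"
  by (simp add: prim_neg)

lemma prim_ge_1: "1 \<le> x \<Longrightarrow> prim u x = (LINT t|uint. u t)"
  unfolding prim_def by (rule Bochner_Integration.integral_cong) auto

lemma prim_add: "integrable uint u \<Longrightarrow> integrable uint v \<Longrightarrow> prim (\<lambda>t. u t + v t) x = prim u x + prim v x"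
  by (simp add: prim_def scaleR_add_right integrable_uint_indicator)

lemma prim_norm_le:
  assumes "integrable uint u"
  shows "norm (prim u x) \<le> (LINT t|uint. norm (u t))"
proof -
  have "norm (prim u x) \<le> (LINT t|uint. norm (indicator {..<x} t *\<^sub>R u t))"
    unfolding prim_def by (rule integral_norm_bound)
  also have "\<dots> \<le> (LINT t|uint. norm (u t))"
    using assms by (intro integral_mono integrable_norm integrable_uint_indicator) (auto simp: indicator_def)
  finally show ?thesis .
qed

lemma prim_diff_eq:
  fixes u :: "real \<Rightarrow> 'a::{banach, second_countable_topology}"
  assumes "integrable uint u" "x \<le> y"
  shows "prim u y - prim u x = (LINT t|uint. indicator {x..<y} t *\<^sub>R u t)"
proof -
  have "prim u y - prim u x = (LINT t|uint. indicator {..<y} t *\<^sub>R u t - indicator {..<x} t *\<^sub>R u t)"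
    unfolding prim_def
    by (rule Bochner_Integration.integral_diff[symmetric]) (auto intro!: integrable_uint_indicator assms)
  also have "\<dots> = (LINT t|uint. indicator {x..<y} t *\<^sub>R u t)"
    using assms(2) by (intro Bochner_Integration.integral_cong) (auto simp: indicator_def)
  finally show ?thesis .
qed

text \<open>An integrable majorant of the density yields a modulus of continuity of the primitive.
  The majorant may be unbounded, as those of the energy rate and of the flux are.\<close>

lemma prim_diff_le:
  fixes u :: "real \<Rightarrow> 'a::{banach, second_countable_topology}" and g :: "real \<Rightarrow> real"
  assumes "integrable uint u" "integrable uint g" "AE t in uint. norm (u t) \<le> g t" "x \<le> y"
  shows "norm (prim u y - prim u x) \<le> prim g y - prim g x"
proof -
  have "prim u y - prim u x = (LINT t|uint. indicator {x..<y} t *\<^sub>R u t)"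
    by (rule prim_diff_eq) fact+
  also have "norm \<dots> \<le> (LINT t|uint. norm (indicator {x..<y} t *\<^sub>R u t))"
    by (rule integral_norm_bound)
  also have "\<dots> \<le> (LINT t|uint. indicator {x..<y} t *\<^sub>R g t)"
    using assms(3) by (intro integral_mono_AE integrable_norm integrable_uint_indicator assms(1,2))
      (auto elim!: eventually_mono simp: indicator_def)
  also have "\<dots> = prim g y - prim g x"
    by (rule prim_diff_eq[symmetric]) fact+
  finally show ?thesis .
qed

lemma continuous_prim:
  fixes u :: "real \<Rightarrow> 'a::{banach, second_countable_topology}"
  assumes "integrable uint u"
  shows "continuous_on S (prim u)"
proof -
  have "isCont (prim u) x" for x
    unfolding continuous_at_sequentially comp_def
  proof safe
    fix X :: "nat \<Rightarrow> real" assume X: "X \<longlonglongrightarrow> x"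
    show "(\<lambda>n. prim u (X n)) \<longlonglongrightarrow> prim u x"
      unfolding prim_def
    proof (rule integral_dominated_convergence[where w = "\<lambda>t. norm (u t)"])
      show "AE t in uint. (\<lambda>n. indicator {..<X n} t *\<^sub>R u t) \<longlonglongrightarrow> indicator {..<x} t *\<^sub>R u t"
        using AE_uint_neq[of x]
      proof eventually_elim
        fix t assume "t \<noteq> x"
        then have "eventually (\<lambda>n. indicator {..<X n} t = (indicator {..<x} t :: real)) sequentially"
        proof (cases "t < x")
          case True
          then show ?thesis using order_tendstoD(1)[OF X True] by (auto elim!: eventually_mono)
        next
          case False
          then have "x < t" using \<open>t \<noteq> x\<close> by auto
          then show ?thesis using order_tendstoD(2)[OF X \<open>x < t\<close>] by (auto elim!: eventually_mono)
        qed
        then show "(\<lambda>n. indicator {..<X n} t *\<^sub>R u t) \<longlonglongrightarrow> indicator {..<x} t *\<^sub>R u t"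
          by (intro tendsto_eventually) (auto elim: eventually_mono)
      qed
    qed (use assms in \<open>auto intro!: integrable_norm integrable_uint_indicator
      borel_measurable_integrable simp: indicator_def\<close>)
  qed
  then show ?thesis by (auto intro: continuous_at_imp_continuous_on)
qed

lemma measurable_prim:
  assumes "integrable uint u" shows "prim u \<in> borel_measurable borel"
  by (intro borel_measurable_continuous_onI continuous_prim assms)

text \<open>The intervals \<open>{..<a}\<close> generate the Borel sets and are stable under
  intersection, so vanishing integrals over them spread to all Borel sets by a Dynkin argument; real
  and imaginary part then agree with the zero density.\<close>

lemma prim_eq_0_imp:
  fixes u :: "real \<Rightarrow> complex"
  assumes int: "integrable uint u" and z: "\<And>x. 0 < x \<Longrightarrow> x \<le> 1 \<Longrightarrow> prim u x = 0"
  shows "AE x in uint. u x = 0"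
proof -
  have prim0: "prim u x = 0" for x
    using z[of x] z[of 1] prim_neg[of x u] prim_ge_1[of x u] prim_ge_1[of 1 u] by (cases "x \<le> 0"; cases "x \<le> 1") auto
  have eq0: "(LINT t|uint. indicator A t *\<^sub>R u t) = 0" if "A \<in> sets borel" for A
  proof -
    have "A \<in> sigma_sets UNIV (range (\<lambda>a::real. {..<a}))"
      using that by (simp add: borel_Iio)
    have "Int_stable (range (\<lambda>a::real. {..<a}))" "range (\<lambda>a::real. {..<a}) \<subseteq> Pow UNIV"
      by (auto simp: Int_stable_def greaterThan_Int_greaterThan)
    from this \<open>A \<in> sigma_sets UNIV _\<close> show ?thesis
    proof (induction rule: sigma_sets_induct_disjoint)
      case (basic A)
      then show ?case using prim0 by (auto simp: prim_def)
    next
      case (compl A)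
      then have A: "A \<in> sets borel" by (simp add: borel_Iio)
      have "(LINT t|uint. indicator (UNIV - A) t *\<^sub>R u t) = (LINT t|uint. u t - indicator A t *\<^sub>R u t)"
        by (rule Bochner_Integration.integral_cong) (auto simp: indicator_def)
      also have "\<dots> = (LINT t|uint. u t) - 0"
        using compl by (subst Bochner_Integration.integral_diff) (auto intro!: integrable_uint_indicator int A)
      also have "\<dots> = 0" using prim0[of 1] by (simp add: prim_ge_1)
      finally show ?case .
    next
      case (union A)
      have A: "A i \<in> sets borel" for i using union(2) by (auto simp: borel_Iio)
      have "(LINT t|uint. indicator (\<Union>i. A i) t *\<^sub>R u t) = (\<Sum>i. LINT t|uint. indicator (A i) t *\<^sub>R u t)"
      proof -
        have *: "(LINT t:(\<Union>i. A' i)|uint. u t) = (\<Sum>i. LINT t:A' i|uint. u t)"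
          if A': "A' = (\<lambda>i. {0..<1} \<inter> A i)" for A'
        proof (rule lebesgue_integral_countable_add)
          show "A' i \<in> sets uint" for i unfolding A' using A by (auto simp: sets_uint sets_restrict_space)
          have "(\<Union>i. A' i) \<in> sets uint" using \<open>\<And>i. A' i \<in> sets uint\<close> by auto
          then show "set_integrable uint (\<Union> (range A')) u"
            unfolding set_integrable_def by (intro integrable_mult_indicator int)
          show "i \<noteq> j \<Longrightarrow> A' i \<inter> A' j = {}" for i j using union(1) by (auto simp: A' disjoint_family_on_def)
        qed
        have "(LINT t:({0..<1} \<inter> B)|uint. u t) = (LINT t|uint. indicator B t *\<^sub>R u t)" for B
          unfolding set_lebesgue_integral_def
          by (rule Bochner_Integration.integral_cong) (auto simp: indicator_def)
        note this[of "\<Union>i. A i"] this[of "A _"]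
        moreover have "(\<Union>i. {0..<1} \<inter> A i) = {0..<1} \<inter> (\<Union>i. A i)" by auto
        ultimately show ?thesis using *[OF refl] by (simp only:)
      qed
      then show ?case using union by simp
    qed auto
  qed
  have eq0': "(LINT t:A|uint. u t) = 0" "set_integrable uint A u" if A: "A \<in> sets uint" for A
  proof -
    obtain B where "A = {0..<1} \<inter> B" "B \<in> sets borel"
      using A by (auto simp: sets_uint sets_restrict_space)
    then show "(LINT t:A|uint. u t) = 0" using eq0[of B] unfolding set_lebesgue_integral_def
      by (subst Bochner_Integration.integral_cong[OF refl, of _ _ "\<lambda>t. indicator B t *\<^sub>R u t"])
        (auto simp: indicator_def)
    show "set_integrable uint A u"
      unfolding set_integrable_def by (intro integrable_mult_indicator int A)
  qed
  have "AE x in uint. Re (u x) = (\<lambda>x. 0) x"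
  proof (rule density_unique_real)
    fix A assume "A \<in> sets uint"
    then have "(LINT x:A|uint. Re (u x)) = Re (LINT x:A|uint. u x)"
      using eq0'(2)[of A] unfolding set_lebesgue_integral_def set_integrable_def
      by (subst integral_Re[symmetric]) auto
    then show "(LINT x:A|uint. Re (u x)) = (LINT x:A|uint. 0)" using eq0' \<open>A \<in> sets uint\<close> by simp
  qed (use int in auto)
  moreover have "AE x in uint. Im (u x) = (\<lambda>x. 0) x"
  proof (rule density_unique_real)
    fix A assume "A \<in> sets uint"
    then have "(LINT x:A|uint. Im (u x)) = Im (LINT x:A|uint. u x)"
      using eq0'(2)[of A] unfolding set_lebesgue_integral_def set_integrable_def
      by (subst integral_Im[symmetric]) auto
    then show "(LINT x:A|uint. Im (u x)) = (LINT x:A|uint. 0)" using eq0' \<open>A \<in> sets uint\<close> by simp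
  qed (use int in auto)
  ultimately show ?thesis by eventually_elim (simp add: complex_eq_iff)
qed

text \<open>
  Vanishing of all coefficients is preserved by multiplication with polynomials in the real and
  imaginary part of \<open>e\<^sup>2\<^sup>\<pi>\<^sup>i\<^sup>x\<close>. By Stone-Weierstrass on the circle, such a \<open>G\<close> is
  then orthogonal to every continuous periodic function.
\<close>

lemma fourier_zero_mult_poly:
  assumes r: "real_polynomial_function r"
  shows "integrable uint G \<Longrightarrow> (\<And>k. fc G k = 0) \<Longrightarrow>
    integrable uint (\<lambda>x. G x * complex_of_real (r (expi 1 x))) \<and>
    (\<forall>k. fc (\<lambda>x. G x * complex_of_real (r (expi 1 x))) k = 0)"
  using r
proof (induction arbitrary: G rule: real_polynomial_function.induct)
  case (linear r)
  \<comment> \<open>A real linear functional on the plane has the form A z + B cnj z with complex A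
    and B. On the circle, multiplication by it thus combines two shifts of the Fourier
    coefficients.\<close>
  define A B where "A = (complex_of_real (r 1) - \<i> * complex_of_real (r \<i>)) / 2"
    and "B = (complex_of_real (r 1) + \<i> * complex_of_real (r \<i>)) / 2"
  have r: "complex_of_real (r (expi 1 x)) = A * expi 1 x + B * expi (-1) x" for x
  proof -
    have "r z = Re z * r 1 + Im z * r \<i>" for z
    proof -
      have "r z = r (Re z *\<^sub>R 1 + Im z *\<^sub>R \<i>)"
        by (rule arg_cong[of _ _ r]) (simp add: complex_eq_iff)
      then show ?thesis
        using linear by (simp add: linear_add linear_scale bounded_linear.linear)
    qed
    from this[of "expi 1 x"] have "r (expi 1 x) = cos (2 * pi * x) * r 1 + sin (2 * pi * x) * r \<i>"
      by (simp add: expi_def)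
    then show ?thesis
      by (simp add: A_def B_def expi_def complex_eq_iff distrib_right left_diff_distrib diff_divide_distrib add_divide_distrib)
  qed
  have eq: "(\<lambda>x. G x * complex_of_real (r (expi 1 x))) = (\<lambda>x. A * (G x * expi 1 x) + B * (G x * expi (-1) x))"
    by (simp add: r algebra_simps)
  show ?case unfolding eq
    using linear by (auto simp: fc_add fc_cmult fc_mult_expi integrable_mult_expi)
next
  case (const c)
  then show ?case using fc_cmult[of "of_real c" G] by (simp add: mult.commute)
next
  case (add f g)
  from add.IH[OF add.prems] show ?case by (simp add: ring_distribs fc_add)
next
  case (mult f g)
  from mult.IH(1)[OF mult.prems] mult.IH(2)[of "\<lambda>x. G x * complex_of_real (f (expi 1 x))"]
  show ?case by (simp add: mult.assoc)
qed

lemma fourier_zero_orthogonal: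
  fixes \<phi> :: "real \<Rightarrow> real"
  assumes int: "integrable uint G" and z: "\<And>k. fc G k = 0"
    and cont: "continuous_on {0..1} \<phi>" and per: "\<phi> 0 = \<phi> 1"
  shows "(LINT x|uint. G x * complex_of_real (\<phi> x)) = 0"
proof -
  define f where "f = \<phi> \<circ> (\<lambda>z. Arg2pi z / (2 * pi))"
  \<comment> \<open>Only used to see that a loop factors continuously through the circle.\<close>
  have "homotopic_loops UNIV \<phi> \<phi>"
    using cont per by (simp add: homotopic_loops_refl path_def pathfinish_def pathstart_def)
  then have cf: "continuous_on (sphere 0 1) f"
    unfolding f_def using homotopic_loops_imp_homotopic_circlemaps homotopic_with_imp_continuous by blast
  have f: "f (expi 1 x) = \<phi> x" if "0 \<le> x" "x < 1" for x
  proof -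
    have "Arg2pi (expi 1 x) = 2 * pi * x"
      unfolding expi_def by (rule Arg2pi_unique[of 1]) (use that in \<open>auto simp: cis_conv_exp\<close>)
    then show ?thesis by (simp add: f_def)
  qed
  have bnd: "norm (LINT x|uint. G x * complex_of_real (\<phi> x)) \<le> e * (LINT x|uint. norm (G x))" if "e > 0" for e
  proof -
    obtain g where g: "polynomial_function g" "\<And>z. z \<in> sphere 0 1 \<Longrightarrow> norm (f z - g z) < e"
      using Stone_Weierstrass_polynomial_function[OF compact_sphere cf \<open>e > 0\<close>] by blast
    have "real_polynomial_function g" using g(1) by (simp add: real_polynomial_function_eq)
    from fourier_zero_mult_poly[OF this int z]
    have I: "integrable uint (\<lambda>x. G x * complex_of_real (g (expi 1 x)))"
      and Z: "(LINT x|uint. G x * complex_of_real (g (expi 1 x))) = 0"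
      by (auto simp: fc_def dest: spec[of _ 0])
    have m: "\<phi> \<in> borel_measurable uint"
      using borel_measurable_continuous_on_restrict[OF continuous_on_subset[OF cont, of "{0..<1}"]]
      by (simp add: measurable_cong_sets[OF sets_uint refl] atLeastLessThan_subseteq_atLeastAtMost_iff)
    obtain C where C: "\<And>x. x \<in> {0..1} \<Longrightarrow> norm (\<phi> x) \<le> C"
      using compact_continuous_image[OF cont] by (metis compact_Icc compact_imp_bounded bounded_iff image_eqI)
    have I2: "integrable uint (\<lambda>x. G x * complex_of_real (\<phi> x))"
      by (rule integrable_uint_mult_bounded[where B = C, OF int]) (use m C in auto)
    have "(LINT x|uint. G x * complex_of_real (\<phi> x)) =
        (LINT x|uint. G x * complex_of_real (\<phi> x) - G x * complex_of_real (g (expi 1 x)))"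
      using I I2 Z by simp
    also have "norm \<dots> \<le> (LINT x|uint. norm (G x * complex_of_real (\<phi> x) - G x * complex_of_real (g (expi 1 x))))"
      by (rule integral_norm_bound)
    also have "\<dots> \<le> (LINT x|uint. e * norm (G x))"
    proof (intro integral_mono)
      fix x assume x: "x \<in> space uint"
      have "norm (G x * complex_of_real (\<phi> x) - G x * complex_of_real (g (expi 1 x))) =
          norm (G x) * \<bar>f (expi 1 x) - g (expi 1 x)\<bar>"
        using x by (simp add: f flip: right_diff_distrib of_real_diff norm_mult)
          (simp add: norm_mult flip: of_real_diff)
      also have "\<dots> \<le> norm (G x) * e"
        using g(2)[of "expi 1 x"] by (intro mult_left_mono) auto
      finally show "norm (G x * complex_of_real (\<phi> x) - G x * complex_of_real (g (expi 1 x))) \<le> e * norm (G x)"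
        by (simp add: mult.commute)
    qed (use I I2 int in auto)
    finally show ?thesis by simp
  qed
  have "norm (LINT x|uint. G x * complex_of_real (\<phi> x)) \<le> 0"
  proof (rule field_le_epsilon)
    fix e :: real assume "e > 0"
    define L where "L = (LINT x|uint. norm (G x))"
    have "L \<ge> 0" by (simp add: L_def)
    have "norm (LINT x|uint. G x * complex_of_real (\<phi> x)) \<le> e / (L + 1) * L"
      using bnd[of "e / (L + 1)"] \<open>e > 0\<close> \<open>L \<ge> 0\<close> unfolding L_def by (meson add_nonneg_pos divide_pos_pos zero_less_one)
    also have "\<dots> \<le> e" using \<open>e > 0\<close> \<open>L \<ge> 0\<close> by (simp add: field_simps)
    finally show "norm (LINT x|uint. G x * complex_of_real (\<phi> x)) \<le> 0 + e" by simp
  qed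
  then show ?thesis by simp
qed

lemma fourier_unique_0:
  assumes int: "integrable uint G" and z: "\<And>k. fc G k = 0"
  shows "AE x in uint. G x = 0"
proof (rule prim_eq_0_imp[OF int])
  fix x :: real assume x: "0 < x" "x \<le> 1"
  \<comment> \<open>Piecewise linear plateaus that vanish outside (0, x), hence take equal values at
    0 and 1 even for x = 1, and that tend to the indicator of (0, x). At t = 0 the limit differs
    from the indicator of \<open>{..<x}\<close>, so this point is excluded below.\<close>
  define \<phi> where "\<phi> n t = min 1 (real n * max 0 (min t (x - t)))" for n t
  have "(\<lambda>n. LINT t|uint. G t * complex_of_real (\<phi> n t)) \<longlonglongrightarrow> (LINT t|uint. indicator {..<x} t *\<^sub>R G t)"
  proof (rule integral_dominated_convergence[where w = "\<lambda>t. norm (G t)"])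
    have [measurable]: "\<phi> n \<in> borel_measurable borel" for n unfolding \<phi>_def by measurable
    show "(\<lambda>t. G t * complex_of_real (\<phi> n t)) \<in> borel_measurable uint" for n
      using int by measurable
    show "AE t in uint. (\<lambda>n. G t * complex_of_real (\<phi> n t)) \<longlonglongrightarrow> indicator {..<x} t *\<^sub>R G t"
      using AE_uint_neq[of x] AE_uint_neq[of 0] AE_space[of uint]
    proof eventually_elim
      fix t assume t: "t \<noteq> x" "t \<noteq> 0" "t \<in> space uint"
      have "(\<lambda>n. \<phi> n t) \<longlonglongrightarrow> indicator {..<x} t"
      proof (cases "t < x")
        case True
        then have "0 < min t (x - t)" using t by auto
        then have "eventually (\<lambda>n. real n * min t (x - t) \<ge> 1) sequentially"
        proof -
          obtain N :: nat where N: "1 / min t (x - t) \<le> real N" using real_arch_simple by blast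
          show ?thesis
          proof (rule eventually_sequentiallyI)
            fix n assume "N \<le> n"
            then have "1 / min t (x - t) \<le> real n" using N by linarith
            then show "real n * min t (x - t) \<ge> 1"
              using \<open>0 < min t (x - t)\<close> by (simp only: pos_divide_le_eq)
          qed
        qed
        then have "eventually (\<lambda>n. \<phi> n t = indicator {..<x} t) sequentially"
          by eventually_elim (use True \<open>0 < min t (x - t)\<close> in \<open>auto simp: \<phi>_def\<close>)
        then show ?thesis by (rule tendsto_eventually)
      next
        case False
        then show ?thesis using t by (simp add: \<phi>_def)
      qed
      from tendsto_mult[OF tendsto_const[of "G t"] tendsto_of_real[OF this]]
      show "(\<lambda>n. G t * complex_of_real (\<phi> n t)) \<longlonglongrightarrow> indicator {..<x} t *\<^sub>R G t"
        by (simp add: scaleR_conv_of_real mult.commute)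
    qed
    show "AE t in uint. norm (G t * complex_of_real (\<phi> n t)) \<le> norm (G t)" for n
      by (rule AE_I2) (auto simp: norm_mult \<phi>_def intro!: mult_left_le)
  qed (use int in \<open>auto intro: borel_measurable_integrable integrable_uint_indicator\<close>)
  moreover have "(LINT t|uint. G t * complex_of_real (\<phi> n t)) = 0" for n
  proof (rule fourier_zero_orthogonal[OF int z])
    show "continuous_on {0..1} (\<phi> n)" unfolding \<phi>_def by (intro continuous_intros)
    show "\<phi> n 0 = \<phi> n 1" using x by (simp add: \<phi>_def)
  qed
  ultimately show "prim G x = 0" by (simp add: prim_def LIMSEQ_const_iff)
qed

lemma fourier_unique:
  assumes "integrable uint f" "integrable uint g" "\<And>k. fc f k = fc g k"
  shows "AE x in uint. f x = g x"
  using fourier_unique_0[of "\<lambda>x. f x - g x"] assms by (simp add: fc_diff)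

subsection \<open>Integration by parts and Bessel's identity\<close>

text \<open>Integration by parts for densities that are merely integrable: the product is a double
  integral over a square, which Fubini evaluates after a cut along the diagonal, a null set.\<close>

lemma prim_mult_prim:
  fixes u v :: "real \<Rightarrow> complex"
  assumes u: "integrable uint u" and v: "integrable uint v"
  shows "prim u x * prim v x = prim (\<lambda>t. u t * prim v t + prim u t * v t) x"
proof -
  interpret P: pair_sigma_finite uint uint ..
  define a where "a t = indicator {..<x} t *\<^sub>R u t" for t
  define b where "b t = indicator {..<x} t *\<^sub>R v t" for t
  have ia: "integrable uint a" and ib: "integrable uint b"
    unfolding a_def b_def by (auto intro!: integrable_uint_indicator u v)
  note [measurable] = borel_measurable_integrable[OF ia] borel_measurable_integrable[OF ib]
  have I: "integrable (uint \<Otimes>\<^sub>M uint) (\<lambda>(s, t). a s * b t)"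
  proof (rule P.Fubini_integrable)
    show "integrable uint (\<lambda>s. LINT t|uint. norm (case (s, t) of (s, t) \<Rightarrow> a s * b t))"
      using ia by (simp add: norm_mult)
  qed (use ib in auto)
  have m1 [measurable]: "Measurable.pred (uint \<Otimes>\<^sub>M uint) (\<lambda>z. snd z < fst z)"
    and m2 [measurable]: "Measurable.pred (uint \<Otimes>\<^sub>M uint) (\<lambda>z. fst z < snd z)"
    by measurable
  have I1: "integrable (uint \<Otimes>\<^sub>M uint) (\<lambda>(s, t). of_bool (t < s) * (a s * b t))"
    by (rule Bochner_Integration.integrable_bound[OF I]) (auto simp: case_prod_beta)
  have I2: "integrable (uint \<Otimes>\<^sub>M uint) (\<lambda>(s, t). of_bool (s < t) * (a s * b t))"
    by (rule Bochner_Integration.integrable_bound[OF I]) (auto simp: case_prod_beta)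
  have "prim u x * prim v x = (LINT s|uint. LINT t|uint. a s * b t)"
  proof -
    have "(LINT s|uint. LINT t|uint. a s * b t) = (LINT s|uint. a s) * (LINT t|uint. b t)" by simp
    then show ?thesis by (simp add: prim_def a_def[abs_def] b_def[abs_def] del: Bochner_Integration.integral_mult_right_zero Bochner_Integration.integral_mult_left_zero)
  qed
  also have "\<dots> = (LINT s|uint. LINT t|uint. of_bool (t < s) * (a s * b t) + of_bool (s < t) * (a s * b t))"
  proof (rule Bochner_Integration.integral_cong[OF refl])
    fix s assume "s \<in> space uint"
    show "(LINT t|uint. a s * b t) = (LINT t|uint. of_bool (t < s) * (a s * b t) + of_bool (s < t) * (a s * b t))"
      by (rule integral_cong_AE) (use AE_uint_neq[of s] in \<open>auto elim!: eventually_mono\<close>)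
  qed
  also have "\<dots> = (LINT z|(uint \<Otimes>\<^sub>M uint). (case z of (s, t) \<Rightarrow> of_bool (t < s) * (a s * b t)) + (case z of (s, t) \<Rightarrow> of_bool (s < t) * (a s * b t)))"
    using P.integral_fst'[OF Bochner_Integration.integrable_add[OF I1 I2]] by simp
  also have "\<dots> = (LINT z|(uint \<Otimes>\<^sub>M uint). (case z of (s, t) \<Rightarrow> of_bool (t < s) * (a s * b t)))
      + (LINT z|(uint \<Otimes>\<^sub>M uint). (case z of (s, t) \<Rightarrow> of_bool (s < t) * (a s * b t)))"
    by (rule Bochner_Integration.integral_add[OF I1 I2])
  also have "(LINT z|(uint \<Otimes>\<^sub>M uint). (case z of (s, t) \<Rightarrow> of_bool (t < s) * (a s * b t)))
      = (LINT s|uint. LINT t|uint. of_bool (t < s) * (a s * b t))"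
    using P.integral_fst'[OF I1] by simp
  also have "\<dots> = (LINT s|uint. indicator {..<x} s *\<^sub>R (u s * prim v s))"
  proof (rule Bochner_Integration.integral_cong[OF refl])
    fix s assume "s \<in> space uint"
    have "(LINT t|uint. of_bool (t < s) * (a s * b t)) = (LINT t|uint. a s * (indicator {..<s} t *\<^sub>R v t))"
      by (rule Bochner_Integration.integral_cong) (auto simp: a_def b_def indicator_def)
    also have "\<dots> = a s * prim v s" unfolding prim_def by (rule integral_mult_right_zero)
    finally show "(LINT t|uint. of_bool (t < s) * (a s * b t)) = indicator {..<x} s *\<^sub>R (u s * prim v s)"
      by (simp add: a_def)
  qed
  also have "(LINT z|(uint \<Otimes>\<^sub>M uint). (case z of (s, t) \<Rightarrow> of_bool (s < t) * (a s * b t)))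
      = (LINT t|uint. LINT s|uint. of_bool (s < t) * (a s * b t))"
    using P.integral_snd[OF I2] by simp
  also have "\<dots> = (LINT t|uint. indicator {..<x} t *\<^sub>R (prim u t * v t))"
  proof (rule Bochner_Integration.integral_cong[OF refl])
    fix t assume "t \<in> space uint"
    have "(LINT s|uint. of_bool (s < t) * (a s * b t)) = (LINT s|uint. (indicator {..<t} s *\<^sub>R u s) * b t)"
      by (rule Bochner_Integration.integral_cong) (auto simp: a_def b_def indicator_def)
    also have "\<dots> = prim u t * b t" unfolding prim_def by (rule integral_mult_left_zero)
    finally show "(LINT s|uint. of_bool (s < t) * (a s * b t)) = indicator {..<x} t *\<^sub>R (prim u t * v t)"
      by (simp add: b_def)
  qed
  also have "(LINT s|uint. indicator {..<x} s *\<^sub>R (u s * prim v s)) + (LINT t|uint. indicator {..<x} t *\<^sub>R (prim u t * v t))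
      = prim (\<lambda>t. u t * prim v t) x + prim (\<lambda>t. prim u t * v t) x"
    by (simp add: prim_def)
  also have "\<dots> = prim (\<lambda>t. u t * prim v t + prim u t * v t) x"
  proof (rule prim_add[symmetric])
    show "integrable uint (\<lambda>t. u t * prim v t)"
      by (rule integrable_uint_mult_bounded[OF u _ prim_norm_le[OF v]]) (use measurable_prim[OF v] in measurable)
    have "integrable uint (\<lambda>t. v t * prim u t)"
      by (rule integrable_uint_mult_bounded[OF v _ prim_norm_le[OF u]]) (use measurable_prim[OF u] in measurable)
    then show "integrable uint (\<lambda>t. prim u t * v t)" by (simp add: mult.commute)
  qed
  finally show ?thesis .
qed

lemma integrable_prim:
  fixes u :: "real \<Rightarrow> complex"
  assumes "integrable uint u" shows "integrable uint (prim u)"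
  by (rule integrable_uint_bounded[OF _ prim_norm_le[OF assms]]) (use measurable_prim[OF assms] in measurable)

lemma prim_expi: "prim (\<lambda>t. 2 * pi * of_int k * \<i> * expi k t) x = expi k x - 1" if "0 \<le> x" "x \<le> 1"
proof -
  have m: "(\<lambda>t. indicator {..<x} t *\<^sub>R (2 * pi * of_int k * \<i> * expi k t)) \<in> borel_measurable borel" by measurable
  have "prim (\<lambda>t. 2 * pi * of_int k * \<i> * expi k t) x =
      (LINT t|lborel. indicator {0..x} t *\<^sub>R (2 * pi * of_int k * \<i> * expi k t))"
    unfolding prim_def integral_uint_conv[OF m]
  proof (rule integral_cong_AE)
    show "AE t in lborel. indicator {0..1} t *\<^sub>R indicator {..<x} t *\<^sub>R (2 * pi * of_int k * \<i> * expi k t)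
        = indicator {0..x} t *\<^sub>R (2 * pi * of_int k * \<i> * expi k t)"
      using AE_lborel_singleton[of x] by eventually_elim (use that in \<open>auto simp: indicator_def\<close>)
  qed simp_all
  also have "\<dots> = expi k x - expi k 0"
    by (rule integral_FTC_Icc[OF that(1)]) (auto intro!: expi_deriv[simplified] continuous_intros)
  finally show ?thesis by simp
qed

text \<open>Integration by parts against \<open>expi (- k)\<close>. Mean zero makes
  \<open>prim u\<close> vanish at 1, so there is no boundary term, and it also removes the constant
  -1 in the primitive of the derivative of the exponential.\<close>

lemma fc_prim:
  fixes u :: "real \<Rightarrow> complex"
  assumes u: "integrable uint u" and z: "fc u 0 = 0" and "k \<noteq> 0"
  shows "2 * pi * of_int k * \<i> * fc (prim u) k = fc u k"
proof -
  define v where "v t = 2 * pi * of_int (- k) * \<i> * expi (- k) t" for t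
  have v: "integrable uint v"
    unfolding v_def by (rule integrable_uint_bounded[where B = "norm (2 * pi * of_int (- k) * \<i>)"])
      (auto simp: norm_mult)
  have pv: "prim v t = expi (- k) t - 1" if "0 \<le> t" "t < 1" for t
    using prim_expi[of t "- k"] that unfolding v_def by simp
  have p1: "prim u 1 = 0" using z by (simp add: prim_ge_1 fc_def)
  have "0 = prim (\<lambda>t. u t * prim v t + prim u t * v t) 1"
    using prim_mult_prim[OF u v, of 1] p1 by simp
  also have "\<dots> = (LINT t|uint. u t * prim v t + prim u t * v t)" by (simp add: prim_ge_1)
  also have "\<dots> = (LINT t|uint. (u t * expi (- k) t - u t) + 2 * pi * of_int (- k) * \<i> * (prim u t * expi (- k) t))"
    by (rule Bochner_Integration.integral_cong) (auto simp: pv v_def algebra_simps)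
  also have "\<dots> = fc u k - 2 * pi * of_int k * \<i> * fc (prim u) k"
    using z by (subst Bochner_Integration.integral_add)
      (simp_all add: fc_def integrable_mult_expi u integrable_prim)
  finally show ?thesis by simp
qed

text \<open>With \<open>c\<close> chosen to match the means, both sides have the same Fourier
  coefficients and uniqueness applies. A relation between coefficients alone thus produces an
  absolutely continuous representative.\<close>

lemma weak_derivative_imp_prim:
  fixes f u :: "real \<Rightarrow> complex"
  assumes f: "integrable uint f" and u: "integrable uint u"
    and eq: "\<And>k. fc u k = 2 * pi * of_int k * \<i> * fc f k"
  obtains c where "AE x in uint. f x = c + prim u x"
proof -
  have z: "fc u 0 = 0" using eq[of 0] by simp
  have "AE x in uint. f x = fc f 0 - fc (prim u) 0 + prim u x"
  proof (rule fourier_unique[OF f])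
    show "integrable uint (\<lambda>x. fc f 0 - fc (prim u) 0 + prim u x)"
      by (intro Bochner_Integration.integrable_add integrable_prim u uint.integrable_const)
    fix k show "fc f k = fc (\<lambda>x. fc f 0 - fc (prim u) 0 + prim u x) k"
    proof (cases "k = 0")
      case False
      have "2 * pi * of_int k * \<i> * fc (prim u) k = 2 * pi * of_int k * \<i> * fc f k"
        using fc_prim[OF u z False] eq[of k] by simp
      then show ?thesis using False by (simp add: fc_add integrable_prim u fc_const)
    qed (simp add: fc_add integrable_prim u fc_const)
  qed
  then show ?thesis by (rule that)
qed

section \<open>Partial sums and Bessel's identity\<close>

definition fsum :: "(real \<Rightarrow> complex) \<Rightarrow> int set \<Rightarrow> real \<Rightarrow> complex" where
  "fsum f K x = (\<Sum>k\<in>K. fc f k * expi k x)"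

lemma measurable_fsum [measurable]: "fsum f K \<in> borel_measurable borel"
  unfolding fsum_def by measurable

lemma norm_fsum_le: "norm (fsum f K x) \<le> (\<Sum>k\<in>K. norm (fc f k))"
  unfolding fsum_def by (rule order_trans[OF norm_sum]) (simp add: norm_mult)

lemma integrable_fsum: "integrable uint (fsum f K)"
  by (rule integrable_uint_bounded[OF _ norm_fsum_le]) measurable

lemma fc_sum: "(\<And>i. i \<in> I \<Longrightarrow> integrable uint (f i)) \<Longrightarrow> fc (\<lambda>x. \<Sum>i\<in>I. f i x) k = (\<Sum>i\<in>I. fc (f i) k)"
  unfolding fc_def sum_distrib_right
  by (subst Bochner_Integration.integral_sum) (auto intro: integrable_mult_expi)

lemma fc_fsum:
  assumes "finite K" shows "fc (fsum f K) k = (if k \<in> K then fc f k else 0)"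
proof -
  have "fc (fsum f K) k = (\<Sum>j\<in>K. fc (\<lambda>x. fc f j * expi j x) k)"
    unfolding fsum_def[abs_def]
    by (rule fc_sum) (auto intro!: integrable_uint_bounded[where B = "norm (fc f j)" for j] simp: norm_mult)
  also have "\<dots> = (\<Sum>j\<in>K. if k = j then fc f j else 0)"
    by (rule sum.cong) (auto simp: fc_cmult fc_expi)
  finally show ?thesis using assms by simp
qed

lemma square_integrable_imp_integrable_uint:
  fixes f :: "real \<Rightarrow> complex"
  assumes [measurable]: "f \<in> borel_measurable uint" and "integrable uint (\<lambda>x. (norm (f x))\<^sup>2)"
  shows "integrable uint f"
proof -
  have "integrable uint (\<lambda>x. norm (f x))"
    by (rule uint.square_integrable_imp_integrable) (use assms in auto)
  then show ?thesis by (rule integrable_norm_cancel) simp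
qed

lemma measurable_cnj [measurable (raw)]:
  "f \<in> borel_measurable M \<Longrightarrow> (\<lambda>x. cnj (f x)) \<in> borel_measurable M"
  by (rule borel_measurable_continuous_on[of cnj]) (intro continuous_intros)

lemma fsum_inner:
  assumes "integrable uint g" and "finite K"
  shows "(LINT x|uint. g x * cnj (fsum f K x)) = (\<Sum>k\<in>K. cnj (fc f k) * fc g k)"
proof -
  have "(LINT x|uint. g x * cnj (fsum f K x)) = (LINT x|uint. (\<Sum>k\<in>K. cnj (fc f k) * (g x * expi (- k) x)))"
    unfolding fsum_def by (simp add: cnj_expi sum_distrib_left mult_ac)
  also have "\<dots> = (\<Sum>k\<in>K. cnj (fc f k) * fc g k)"
    by (subst Bochner_Integration.integral_sum)
      (auto simp: fc_def intro!: integrable_mult_expi assms)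
  finally show ?thesis .
qed

text \<open>Stated with the remainder, because the tail estimate compares the remainders of two
  truncations and the cubic bound needs the remainder to be square integrable.\<close>

lemma bessel_eq:
  fixes f :: "real \<Rightarrow> complex"
  assumes [measurable]: "f \<in> borel_measurable uint" and sq: "integrable uint (\<lambda>x. (norm (f x))\<^sup>2)"
    and K: "finite K"
  shows "integrable uint (\<lambda>x. (norm (f x - fsum f K x))\<^sup>2)" (is ?A)
    and "(LINT x|uint. (norm (f x))\<^sup>2) =
      (\<Sum>k\<in>K. (norm (fc f k))\<^sup>2) + (LINT x|uint. (norm (f x - fsum f K x))\<^sup>2)" (is ?B)
proof -
  have f: "integrable uint f" by (rule square_integrable_imp_integrable_uint) fact+
  have i1: "integrable uint (\<lambda>x. f x * cnj (fsum f K x))"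
    by (rule integrable_uint_mult_bounded[OF f, where B = "\<Sum>k\<in>K. norm (fc f k)"]) (auto simp: norm_fsum_le)
  have i2: "integrable uint (\<lambda>x. fsum f K x * cnj (fsum f K x))"
    by (rule integrable_uint_mult_bounded[OF integrable_fsum, where B = "\<Sum>k\<in>K. norm (fc f k)"]) (auto simp: norm_fsum_le)
  have e: "(norm (f x - fsum f K x))\<^sup>2 = (norm (f x))\<^sup>2 - 2 * Re (f x * cnj (fsum f K x)) + Re (fsum f K x * cnj (fsum f K x))" for x
    unfolding cmod_power2 by (simp add: power2_eq_square algebra_simps)
  show ?A unfolding e
    by (intro Bochner_Integration.integrable_add Bochner_Integration.integrable_diff
      integrable_mult_right integrable_Re sq i1 i2)
  have v1: "(LINT x|uint. f x * cnj (fsum f K x)) = of_real (\<Sum>k\<in>K. (norm (fc f k))\<^sup>2)"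
    unfolding fsum_inner[OF f K] of_real_sum complex_norm_square by (simp add: mult.commute)
  have v2: "(LINT x|uint. fsum f K x * cnj (fsum f K x)) = of_real (\<Sum>k\<in>K. (norm (fc f k))\<^sup>2)"
    unfolding fsum_inner[OF integrable_fsum K] of_real_sum complex_norm_square
    by (simp add: fc_fsum K mult.commute)
  have "(LINT x|uint. (norm (f x - fsum f K x))\<^sup>2) = (LINT x|uint. (norm (f x))\<^sup>2)
      - 2 * Re (LINT x|uint. f x * cnj (fsum f K x)) + Re (LINT x|uint. fsum f K x * cnj (fsum f K x))"
    unfolding e by (simp add: sq i1 i2 del: times_complex.sel)
  then show ?B by (simp add: v1 v2)
qed

lemma bessel_le:
  fixes f :: "real \<Rightarrow> complex"
  assumes "f \<in> borel_measurable uint" "integrable uint (\<lambda>x. (norm (f x))\<^sup>2)" "finite K"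
  shows "(\<Sum>k\<in>K. (norm (fc f k))\<^sup>2) \<le> (LINT x|uint. (norm (f x))\<^sup>2)"
  using bessel_eq(2)[OF assms] by simp

subsection \<open>Fourier series of functions with square integrable derivative\<close>

text \<open>Pairing k with -k makes the symmetric sums the partial sums of a series over the natural
  numbers; the frequency 0 is singled out because it would be its own partner.\<close>

lemma fsum_symmetric:
  "fsum f {- int N..int N} x =
    (\<Sum>n\<le>N. if n = 0 then fc f 0 else fc f (int n) * expi (int n) x + fc f (- int n) * expi (- int n) x)"
proof (induction N)
  case 0
  then show ?case by (simp add: fsum_def)
next
  case (Suc N)
  have "{- int (Suc N)..int (Suc N)} = insert (int (Suc N)) (insert (- int (Suc N)) {- int N..int N})"
    by auto
  then have "fsum f {- int (Suc N)..int (Suc N)} x =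
      fc f (int (Suc N)) * expi (int (Suc N)) x + (fc f (- int (Suc N)) * expi (- int (Suc N)) x + fsum f {- int N..int N} x)"
    unfolding fsum_def by (simp only:) (subst sum.insert, simp, simp, subst sum.insert, simp_all)
  then show ?case using Suc.IH by (simp add: algebra_simps)
qed

lemma H1_square_integrable:
  fixes f h :: "real \<Rightarrow> complex"
  assumes f: "integrable uint f" and h: "integrable uint h"
    and eq: "\<And>k. fc h k = 2 * pi * of_int k * \<i> * fc f k"
  shows "integrable uint (\<lambda>x. (norm (f x))\<^sup>2)"
proof -
  obtain c where c: "AE x in uint. f x = c + prim h x"
    using weak_derivative_imp_prim[OF f h eq] by blast
  show ?thesis
  proof (rule uint.integrable_const_bound)
    show "AE x in uint. norm ((norm (f x))\<^sup>2) \<le> (norm c + (LINT t|uint. norm (h t)))\<^sup>2"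
      using c
    proof eventually_elim
      fix x assume "f x = c + prim h x"
      then have "norm (f x) \<le> norm c + (LINT t|uint. norm (h t))"
        using norm_triangle_ineq[of c "prim h x"] prim_norm_le[OF h, of x] by simp
      then show "norm ((norm (f x))\<^sup>2) \<le> (norm c + (LINT t|uint. norm (h t)))\<^sup>2"
        by (simp add: power_mono)
    qed
  qed (use f in measurable)
qed

text \<open>For k nonzero the coefficient of \<open>f\<close> is at most that of \<open>h\<close>
  divided by |k|, hence at most the square of the latter plus 1 / k^2; Bessel and the series of
  inverse squares do the rest.\<close>

lemma H1_fourier_summable:
  fixes f h :: "real \<Rightarrow> complex"
  assumes h: "h \<in> borel_measurable uint" "integrable uint (\<lambda>x. (norm (h x))\<^sup>2)"
    and eq: "\<And>k. fc h k = 2 * pi * of_int k * \<i> * fc f k"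
  shows "summable (\<lambda>n. norm (fc f (int n)) + norm (fc f (- int n)))"
proof -
  have s1: "summable (\<lambda>n. (norm (fc h (\<sigma> n)))\<^sup>2)" if "inj \<sigma>" for \<sigma> :: "nat \<Rightarrow> int"
  proof (rule bounded_imp_summable)
    fix n
    have "(\<Sum>k\<le>n. (norm (fc h (\<sigma> k)))\<^sup>2) = (\<Sum>k\<in>\<sigma> ` {..n}. (norm (fc h k))\<^sup>2)"
      using that by (subst sum.reindex) (auto simp: inj_on_def inj_def)
    also have "\<dots> \<le> (LINT x|uint. (norm (h x))\<^sup>2)" by (rule bessel_le[OF h]) simp
    finally show "(\<Sum>k\<le>n. (norm (fc h (\<sigma> k)))\<^sup>2) \<le> (LINT x|uint. (norm (h x))\<^sup>2)" .
  qed simp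
  have b: "norm (fc f k) \<le> (norm (fc h k))\<^sup>2 + 1 / (of_int k)\<^sup>2" if "k \<noteq> 0" for k
  proof -
    define a where "a = norm (fc f k)"
    define m where "m = \<bar>real_of_int k\<bar>"
    have m: "m > 0" using that by (simp add: m_def)
    have hk: "norm (fc h k) = 2 * pi * m * a" by (simp add: eq norm_mult a_def m_def)
    have "m * a \<le> 2 * pi * m * a"
      using m pi_ge_two by (intro mult_right_mono) (auto simp: a_def)
    then have "m * a \<le> norm (fc h k)" by (simp add: hk)
    then have "a \<le> norm (fc h k) * (1 / m)" using m by (simp add: field_simps)
    also have "\<dots> \<le> (norm (fc h k))\<^sup>2 + (1 / m)\<^sup>2"
    proof -
      have "2 * (norm (fc h k) * (1 / m)) \<le> (norm (fc h k))\<^sup>2 + (1 / m)\<^sup>2"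
        using sum_squares_bound[of "norm (fc h k)" "1 / m"] by simp
      moreover have "0 \<le> norm (fc h k) * (1 / m)" using m by simp
      ultimately show ?thesis by linarith
    qed
    finally show ?thesis by (simp add: a_def m_def power_divide)
  qed
  have "summable (\<lambda>n. (norm (fc h (int n)))\<^sup>2 + (norm (fc h (- int n)))\<^sup>2 + 2 * (1 / (real n)\<^sup>2))"
    by (intro summable_add summable_mult s1 inverse_power_summable[where s = 2, unfolded inverse_eq_divide] injI) auto
  then show ?thesis
  proof (rule summable_comparison_test_ev[rotated])
    show "\<forall>\<^sub>F n in sequentially. norm (norm (fc f (int n)) + norm (fc f (- int n)))
        \<le> (norm (fc h (int n)))\<^sup>2 + (norm (fc h (- int n)))\<^sup>2 + 2 * (1 / (real n)\<^sup>2)"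
      using eventually_gt_at_top[of 0]
    proof eventually_elim
      fix n :: nat assume "0 < n"
      then show "norm (norm (fc f (int n)) + norm (fc f (- int n)))
        \<le> (norm (fc h (int n)))\<^sup>2 + (norm (fc h (- int n)))\<^sup>2 + 2 * (1 / (real n)\<^sup>2)"
        using b[of "int n"] b[of "- int n"] by simp
    qed
  qed
qed

text \<open>Convergence in the mean comes from uniform convergence: absolutely summable coefficients
  give a bounded limit \<open>s\<close>, which has the coefficients of \<open>f\<close> and so
  equals \<open>f\<close> almost everywhere.\<close>

lemma H1_fourier_tendsto:
  fixes f h :: "real \<Rightarrow> complex"
  assumes f: "integrable uint f" and h: "h \<in> borel_measurable uint" "integrable uint (\<lambda>x. (norm (h x))\<^sup>2)"
    and eq: "\<And>k. fc h k = 2 * pi * of_int k * \<i> * fc f k"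
  shows "(\<lambda>N. LINT x|uint. (norm (f x - fsum f {- int N..int N} x))\<^sup>2) \<longlonglongrightarrow> 0"
proof -
  define t where "t n x = (if n = 0 then fc f 0 else fc f (int n) * expi (int n) x + fc f (- int n) * expi (- int n) x)" for n :: nat and x
  define b where "b n = norm (fc f (int n)) + norm (fc f (- int n))" for n :: nat
  have S: "fsum f {- int N..int N} x = (\<Sum>n\<le>N. t n x)" for N x
    unfolding t_def by (rule fsum_symmetric)
  have sb: "summable b" unfolding b_def by (rule H1_fourier_summable[OF h eq])
  have tb: "norm (t n x) \<le> b n" for n x
    by (auto simp: t_def b_def norm_mult intro!: norm_triangle_le)
  have st: "summable (\<lambda>n. t n x)" for x
    by (rule summable_comparison_test'[OF sb]) (rule tb)
  define s where "s x = (\<Sum>n. t n x)" for x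
  define B where "B = (\<Sum>n. b n)"
  have [measurable]: "t n \<in> borel_measurable borel" for n
    unfolding t_def by (cases "n = 0") simp_all
  have [measurable]: "s \<in> borel_measurable borel"
    unfolding s_def by measurable
  have lim: "(\<lambda>N. fsum f {- int N..int N} x) \<longlonglongrightarrow> s x" for x
    unfolding S s_def by (rule summable_LIMSEQ'[OF st])
  have SB: "norm (fsum f {- int N..int N} x) \<le> B" for N x
  proof -
    have "norm (fsum f {- int N..int N} x) \<le> (\<Sum>n\<le>N. b n)"
      unfolding S by (rule order_trans[OF norm_sum sum_mono[OF tb]])
    also have "\<dots> \<le> B" unfolding B_def by (rule sum_le_suminf[OF sb]) (auto simp: b_def)
    finally show ?thesis .
  qed
  have sB: "norm (s x) \<le> B" for x
    by (rule tendsto_upperbound[OF tendsto_norm[OF lim]]) (auto simp: SB)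
  have int_s: "integrable uint s"
    by (rule integrable_uint_bounded[where B = B]) (auto simp: sB)
  have "fc s k = fc f k" for k
  proof -
    have "(\<lambda>N. fc (fsum f {- int N..int N}) k) \<longlonglongrightarrow> fc s k"
      unfolding fc_def
      by (rule integral_dominated_convergence[where w = "\<lambda>_. B"])
        (auto simp: norm_mult SB intro!: AE_I2 tendsto_mult lim)
    moreover have "\<forall>\<^sub>F N in sequentially. fc (fsum f {- int N..int N}) k = fc f k"
      by (rule eventually_sequentiallyI[of "nat \<bar>k\<bar>"]) (auto simp: fc_fsum)
    then have "(\<lambda>N. fc (fsum f {- int N..int N}) k) \<longlonglongrightarrow> fc f k" by (rule tendsto_eventually)
    ultimately show ?thesis by (rule LIMSEQ_unique)
  qed
  then have AE: "AE x in uint. f x = s x" using f int_s by (intro fourier_unique) auto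
  have "(\<lambda>N. LINT x|uint. (norm (f x - fsum f {- int N..int N} x))\<^sup>2) \<longlonglongrightarrow> (LINT x|uint. 0)"
  proof (rule integral_dominated_convergence[where w = "\<lambda>_. (2 * B)\<^sup>2"])
    show "AE x in uint. (\<lambda>N. (norm (f x - fsum f {- int N..int N} x))\<^sup>2) \<longlonglongrightarrow> 0"
      using AE
    proof eventually_elim
      fix x assume "f x = s x"
      then have "(\<lambda>N. (norm (f x - fsum f {- int N..int N} x))\<^sup>2) \<longlonglongrightarrow> (norm (f x - s x))\<^sup>2"
        by (intro tendsto_intros lim)
      then show "(\<lambda>N. (norm (f x - fsum f {- int N..int N} x))\<^sup>2) \<longlonglongrightarrow> 0" using \<open>f x = s x\<close> by simp
    qed
    show "AE x in uint. norm ((norm (f x - fsum f {- int N..int N} x))\<^sup>2) \<le> (2 * B)\<^sup>2" for N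
      using AE
    proof eventually_elim
      fix x assume "f x = s x"
      then have "norm (f x - fsum f {- int N..int N} x) \<le> 2 * B"
        using norm_triangle_ineq4[of "s x" "fsum f {- int N..int N} x"] sB[of x] SB[of N x] by simp
      from power_mono[OF this norm_ge_zero, of 2]
      show "norm ((norm (f x - fsum f {- int N..int N} x))\<^sup>2) \<le> (2 * B)\<^sup>2" by simp
    qed
  qed (use f in measurable)
  then show ?thesis by simp
qed

text \<open>Outside the truncation |k| >= N + 1, so each coefficient of \<open>f\<close> is that of
  \<open>h\<close> divided by at least 2 pi (N + 1). A second cut at M leaves a finite sum, to which
  Bessel applies; the remainder beyond M disappears as M grows.\<close>

lemma H1_fourier_tail:
  fixes f h :: "real \<Rightarrow> complex"
  assumes f: "integrable uint f" and h: "h \<in> borel_measurable uint" "integrable uint (\<lambda>x. (norm (h x))\<^sup>2)"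
    and eq: "\<And>k. fc h k = 2 * pi * of_int k * \<i> * fc f k"
  shows "(LINT x|uint. (norm (f x - fsum f {- int N..int N} x))\<^sup>2)
    \<le> (LINT x|uint. (norm (h x))\<^sup>2) / (2 * pi * (real N + 1))\<^sup>2"
proof -
  define H where "H = (LINT x|uint. (norm (h x))\<^sup>2)"
  define R where "R M = (LINT x|uint. (norm (f x - fsum f {- int M..int M} x))\<^sup>2)" for M :: nat
  have ih: "integrable uint h" by (rule square_integrable_imp_integrable_uint) fact+
  have f2: "integrable uint (\<lambda>x. (norm (f x))\<^sup>2)" by (rule H1_square_integrable[OF f ih eq])
  have pars: "(LINT x|uint. (norm (f x))\<^sup>2) = (\<Sum>k=- int M..int M. (norm (fc f k))\<^sup>2) + R M" for M
    unfolding R_def by (rule bessel_eq(2)[OF borel_measurable_integrable[OF f] f2]) simp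
  have "R N \<le> H / (2 * pi * (real N + 1))\<^sup>2 + R M" if "N \<le> M" for M
  proof -
    have sub: "{- int N..int N} \<subseteq> {- int M..int M}" using that by auto
    have "R N = (\<Sum>k\<in>{- int M..int M} - {- int N..int N}. (norm (fc f k))\<^sup>2) + R M"
      using pars[of N] pars[of M] by (simp add: sum_diff[OF _ sub])
    moreover have "(\<Sum>k\<in>{- int M..int M} - {- int N..int N}. (norm (fc f k))\<^sup>2)
        \<le> (\<Sum>k\<in>{- int M..int M} - {- int N..int N}. (norm (fc h k))\<^sup>2 / (2 * pi * (real N + 1))\<^sup>2)"
    proof (rule sum_mono)
      fix k assume k: "k \<in> {- int M..int M} - {- int N..int N}"
      then have "real N + 1 \<le> \<bar>real_of_int k\<bar>" by auto
      then have "(2 * pi * (real N + 1)) * norm (fc f k) \<le> norm (fc h k)"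
        by (simp add: eq norm_mult mult_right_mono)
      then have "((2 * pi * (real N + 1)) * norm (fc f k))\<^sup>2 \<le> (norm (fc h k))\<^sup>2"
        by (rule power_mono) (simp add: pi_ge_zero)
      then show "(norm (fc f k))\<^sup>2 \<le> (norm (fc h k))\<^sup>2 / (2 * pi * (real N + 1))\<^sup>2"
        by (simp only: power_mult_distrib[of _ "norm _"]) (subst pos_le_divide_eq, simp_all add: mult.commute add_nonneg_eq_0_iff add_pos_nonneg)
    qed
    moreover have "(\<Sum>k\<in>{- int M..int M} - {- int N..int N}. (norm (fc h k))\<^sup>2 / (2 * pi * (real N + 1))\<^sup>2)
        \<le> H / (2 * pi * (real N + 1))\<^sup>2"
      unfolding H_def sum_divide_distrib[symmetric] by (intro divide_right_mono bessel_le[OF h]) simp_all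
    ultimately show ?thesis by linarith
  qed
  moreover have "(\<lambda>M. H / (2 * pi * (real N + 1))\<^sup>2 + R M) \<longlonglongrightarrow> H / (2 * pi * (real N + 1))\<^sup>2 + 0"
    unfolding R_def by (intro tendsto_intros H1_fourier_tendsto[OF f h eq])
  ultimately have "R N \<le> H / (2 * pi * (real N + 1))\<^sup>2 + 0"
    by (intro tendsto_lowerbound[where a = "R N"]) (auto intro!: eventually_sequentiallyI[of N])
  then show ?thesis by (simp add: R_def H_def)
qed

text \<open>The tail estimate for N = 0, where the partial sum is the mean; the gain 1 / (2 pi)^2 is
  given away.\<close>

lemma H1_poincare:
  fixes f h :: "real \<Rightarrow> complex"
  assumes f: "integrable uint f" and h: "h \<in> borel_measurable uint" "integrable uint (\<lambda>x. (norm (h x))\<^sup>2)"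
    and eq: "\<And>k. fc h k = 2 * pi * of_int k * \<i> * fc f k" and mean: "fc f 0 = 0"
  shows "(LINT x|uint. (norm (f x))\<^sup>2) \<le> (LINT x|uint. (norm (h x))\<^sup>2)"
proof -
  define H where "H = (LINT x|uint. (norm (h x))\<^sup>2)"
  have "(LINT x|uint. (norm (f x))\<^sup>2) \<le> H / (2 * pi)\<^sup>2"
    using H1_fourier_tail[OF f h eq, of 0] mean by (simp add: fsum_def H_def)
  also have "1 \<le> (2 * pi)\<^sup>2" using pi_ge_two by (intro one_le_power) linarith
  then have "H / (2 * pi)\<^sup>2 \<le> H"
    using divide_left_mono[of 1 "(2 * pi)\<^sup>2" H] by (simp add: H_def)
  finally show ?thesis by (simp add: H_def)
qed

text \<open>The square of the continuous representative \<open>p\<close> has derivative 2 h p, so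
  |p|^2 at any two points differs by at most twice the product of the norms of \<open>f\<close> and
  \<open>h\<close>. Averaging over the second point adds the squared norm of \<open>f\<close>, which
  Poincare bounds by that product once more; hence the 3. Working with the square of
  \<open>p\<close> lets the product rule apply without conjugates.\<close>

lemma H1_sup_bound:
  fixes f h :: "real \<Rightarrow> complex"
  assumes f: "integrable uint f" and h: "h \<in> borel_measurable uint" "integrable uint (\<lambda>x. (norm (h x))\<^sup>2)"
    and eq: "\<And>k. fc h k = 2 * pi * of_int k * \<i> * fc f k" and mean: "fc f 0 = 0"
  shows "AE x in uint. (norm (f x))\<^sup>2 \<le>
    3 * (sqrt (LINT x|uint. (norm (f x))\<^sup>2) * sqrt (LINT x|uint. (norm (h x))\<^sup>2))"
proof -
  define A where "A = (LINT x|uint. (norm (f x))\<^sup>2)"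
  define B where "B = sqrt A * sqrt (LINT x|uint. (norm (h x))\<^sup>2)"
  have ih: "integrable uint h" by (rule square_integrable_imp_integrable_uint) fact+
  have f2: "integrable uint (\<lambda>x. (norm (f x))\<^sup>2)" by (rule H1_square_integrable[OF f ih eq])
  obtain c where c: "AE x in uint. f x = c + prim h x"
    using weak_derivative_imp_prim[OF f ih eq] by blast
  define p where "p x = c + prim h x" for x
  have [measurable]: "p \<in> borel_measurable borel" unfolding p_def using measurable_prim[OF ih] by measurable
  have mp: "p \<in> borel_measurable uint" by measurable
  have p2: "integrable uint (\<lambda>x. (norm (p x))\<^sup>2)" "(LINT x|uint. (norm (p x))\<^sup>2) = A"
  proof -
    have *: "AE x in uint. (norm (f x))\<^sup>2 = (norm (p x))\<^sup>2" using c by eventually_elim (simp add: p_def)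
    show "integrable uint (\<lambda>x. (norm (p x))\<^sup>2)"
      by (rule integrable_cong_AE_imp[OF f2]) (use * in auto)
    show "(LINT x|uint. (norm (p x))\<^sup>2) = A"
      unfolding A_def by (rule integral_cong_AE) (use * f in auto)
  qed
  have CS: "integrable uint (\<lambda>t. norm (h t) * norm (p t))" "(LINT t|uint. \<bar>norm (h t) * norm (p t)\<bar>) \<le> B"
    using Cauchy_Schwarz_integral[of "\<lambda>t. norm (h t)" uint "\<lambda>t. norm (p t)"] h p2
    by (auto simp: B_def mult.commute)
  have ihp: "integrable uint (\<lambda>t. h t * p t)"
    by (rule integrable_norm_cancel) (use CS(1) h in \<open>auto simp: norm_mult\<close>)
  have ihq: "integrable uint (\<lambda>t. h t * prim h t)"
    by (rule integrable_uint_mult_bounded[OF ih _ prim_norm_le[OF ih]]) (use measurable_prim[OF ih] in measurable)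
  have diff: "(p x)\<^sup>2 - c\<^sup>2 = prim (\<lambda>t. 2 * (h t * p t)) x" for x
  proof -
    have "prim (\<lambda>t. 2 * (h t * p t)) x = prim (\<lambda>t. (2 * c) * h t + (h t * prim h t + prim h t * h t)) x"
      unfolding p_def by (simp add: algebra_simps)
    also have "\<dots> = prim (\<lambda>t. (2 * c) * h t) x + prim (\<lambda>t. h t * prim h t + prim h t * h t) x"
      by (rule prim_add) (use ihq ih in \<open>auto simp: mult.commute[of "prim h _"]\<close>)
    also have "prim (\<lambda>t. (2 * c) * h t) x = 2 * c * prim h x"
      unfolding prim_def by (subst integral_mult_right_zero[symmetric]) (simp add: scaleR_conv_of_real mult_ac)
    finally show ?thesis using prim_mult_prim[OF ih ih, of x] by (simp add: p_def power2_eq_square algebra_simps)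
  qed
  have main: "(norm (p x))\<^sup>2 \<le> (norm (p z))\<^sup>2 + 2 * B" for x z
  proof -
    have *: "norm ((p y)\<^sup>2 - (p x)\<^sup>2) \<le> 2 * B" if "x \<le> y" for x y
    proof -
      have "(p y)\<^sup>2 - (p x)\<^sup>2 = prim (\<lambda>t. 2 * (h t * p t)) y - prim (\<lambda>t. 2 * (h t * p t)) x"
        using diff[of x] diff[of y] by (simp add: algebra_simps)
      also have "\<dots> = (LINT t|uint. indicator {x..<y} t *\<^sub>R (2 * (h t * p t)))"
        by (rule prim_diff_eq) (use ihp that in auto)
      also have "norm \<dots> \<le> (LINT t|uint. norm (indicator {x..<y} t *\<^sub>R (2 * (h t * p t))))"
        by (rule integral_norm_bound)
      also have "\<dots> \<le> (LINT t|uint. 2 * \<bar>norm (h t) * norm (p t)\<bar>)"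
        by (intro integral_mono integrable_norm integrable_uint_indicator)
          (use ihp CS(1) in \<open>auto simp: norm_mult indicator_def\<close>)
      also have "\<dots> \<le> 2 * B" using CS by simp
      finally show ?thesis .
    qed
    have "norm ((p x)\<^sup>2 - (p z)\<^sup>2) \<le> 2 * B"
      using *[of x z] *[of z x] by (cases "x \<le> z") (auto simp: norm_minus_commute)
    then have "norm ((p x)\<^sup>2) \<le> norm ((p z)\<^sup>2) + 2 * B"
      using norm_triangle_ineq2[of "(p x)\<^sup>2" "(p z)\<^sup>2"] by simp
    then show ?thesis by (simp add: norm_power)
  qed
  have "(norm (p x))\<^sup>2 \<le> A + 2 * B" for x
  proof -
    have "(LINT z|uint. (norm (p x))\<^sup>2) \<le> (LINT z|uint. (norm (p z))\<^sup>2 + 2 * B)"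
      by (intro integral_mono) (use p2 main in auto)
    then show ?thesis using p2 by simp
  qed
  moreover have "A \<le> B"
  proof -
    have "sqrt A \<le> sqrt (LINT x|uint. (norm (h x))\<^sup>2)"
      using H1_poincare[OF f h eq mean] by (simp add: A_def)
    then have "sqrt A * sqrt A \<le> B" unfolding B_def by (intro mult_left_mono) (auto simp: A_def)
    then show ?thesis by (simp add: A_def)
  qed
  ultimately have "(norm (p x))\<^sup>2 \<le> 3 * B" for x by (smt (verit))
  then show ?thesis using c by (auto elim!: eventually_mono simp: p_def B_def A_def)
qed

lemma integral_norm_fsum:
  assumes "finite K"
  shows "(LINT x|uint. (norm (fsum f K x))\<^sup>2) = (\<Sum>k\<in>K. (norm (fc f k))\<^sup>2)"
proof -
  have i: "integrable uint (\<lambda>x. fsum f K x * cnj (fsum f K x))"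
    by (rule integrable_uint_mult_bounded[OF integrable_fsum, where B = "\<Sum>k\<in>K. norm (fc f k)"]) (auto simp: norm_fsum_le)
  have "complex_of_real (LINT x|uint. (norm (fsum f K x))\<^sup>2) = (LINT x|uint. fsum f K x * cnj (fsum f K x))"
    unfolding integral_complex_of_real[symmetric] complex_norm_square by (rule refl)
  also have "\<dots> = of_real (\<Sum>k\<in>K. (norm (fc f k))\<^sup>2)"
    unfolding fsum_inner[OF integrable_fsum assms] of_real_sum complex_norm_square
    by (simp add: fc_fsum assms mult.commute)
  finally show ?thesis by (simp only: of_real_eq_iff)
qed

text \<open>For a real function the terms of k and -k are conjugate, so a symmetric truncation is
  real. This lets the cubic estimate work with a real \<open>s\<close>, of which s^3 / 3 is
  differentiated.\<close>

lemma fsum_real: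
  fixes f :: "real \<Rightarrow> real"
  shows "fsum (\<lambda>x. complex_of_real (f x)) {- int N..int N} x =
    of_real (Re (fsum (\<lambda>x. complex_of_real (f x)) {- int N..int N} x))"
proof -
  let ?F = "\<lambda>x. complex_of_real (f x)"
  have "cnj (fsum ?F {- int N..int N} x) = (\<Sum>k\<in>{- int N..int N}. fc ?F (- k) * expi (- k) x)"
    by (simp add: fsum_def cnj_fc cnj_expi)
  also have "\<dots> = fsum ?F {- int N..int N} x"
    unfolding fsum_def
    by (rule sum.reindex_bij_witness[of _ uminus uminus]) auto
  finally show ?thesis by (simp add: complex_eq_iff)
qed

text \<open>
  With \<open>s\<close> and \<open>d\<close> the truncations of \<open>f\<close> and \<open>h\<close> and \<open>r = f - s\<close>, the sum is \<open>- \<integral> f\<^sup>2 d\<close>. The part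
  \<open>\<integral> s\<^sup>2 d\<close> vanishes since \<open>d\<close> is the derivative of \<open>s\<close>. In the rest, the loss in the Bernstein bounds
  on the supremum of \<open>d\<close> is compensated by the decay of \<open>r\<close> in \<open>N\<close>.
\<close>

lemma cubic_fourier_bound:
  fixes f h :: "real \<Rightarrow> real" and N :: nat
  assumes f: "integrable uint f" and h: "h \<in> borel_measurable uint" "integrable uint (\<lambda>x. (h x)\<^sup>2)"
    and eq: "\<And>k. fc (\<lambda>x. of_real (h x)) k = 2 * pi * of_int k * \<i> * fc (\<lambda>x. of_real (f x)) k"
  defines "E \<equiv> \<Sum>k=- int N..int N. (norm (fc (\<lambda>x. of_real (f x)) k))\<^sup>2"
  shows "norm (\<Sum>k=- int N..int N. cnj (fc (\<lambda>x. of_real (f x)) k) *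
      (2 * pi * of_int k * \<i> * fc (\<lambda>x. of_real ((f x)\<^sup>2)) k)) \<le> 2 * (LINT x|uint. (h x)\<^sup>2) * sqrt E"
proof -
  define K where "K = {- int N..int N}"
  define F where "F x = complex_of_real (f x)" for x
  define G where "G x = complex_of_real (h x)" for x
  define H where "H = (LINT x|uint. (h x)\<^sup>2)"
  have K: "finite K" by (simp add: K_def)
  have eq: "fc G k = 2 * pi * of_int k * \<i> * fc F k" for k using eq by (simp add: F_def[abs_def] G_def[abs_def])
  have E: "E = (\<Sum>k\<in>K. (norm (fc F k))\<^sup>2)" by (simp add: E_def K_def F_def[abs_def])
  have iF: "integrable uint F" using f by (simp add: F_def[abs_def])
  have mG: "G \<in> borel_measurable uint" using h by (simp add: G_def[abs_def])
  have G2: "integrable uint (\<lambda>x. (norm (G x))\<^sup>2)" "(LINT x|uint. (norm (G x))\<^sup>2) = H"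
    using h by (simp_all add: G_def[abs_def] H_def)
  have iG: "integrable uint G" by (rule square_integrable_imp_integrable_uint[OF mG G2(1)])
  have F2: "integrable uint (\<lambda>x. (norm (F x))\<^sup>2)" by (rule H1_square_integrable[OF iF iG eq])
  then have f2: "integrable uint (\<lambda>x. (f x)\<^sup>2)" by (simp add: F_def)
  define s where "s x = Re (fsum F K x)" for x
  define d where "d x = Re (fsum G K x)" for x
  have S: "fsum F K x = of_real (s x)" for x unfolding s_def K_def F_def[abs_def] by (rule fsum_real)
  have D: "fsum G K x = of_real (d x)" for x unfolding d_def K_def G_def[abs_def] by (rule fsum_real)
  have [measurable]: "s \<in> borel_measurable borel" "d \<in> borel_measurable borel"
    unfolding s_def d_def by measurable
  note [measurable] = borel_measurable_integrable[OF f]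
  define C where "C = (\<Sum>k\<in>K. norm (fc G k))"
  have dC: "\<bar>d x\<bar> \<le> C" for x
    using norm_fsum_le[of G K x] by (simp add: D C_def)
  have C0: "0 \<le> C" by (simp add: C_def sum_nonneg)
  define r where "r x = f x - s x" for x
  have r2: "integrable uint (\<lambda>x. (r x)\<^sup>2)" and rH: "(LINT x|uint. (r x)\<^sup>2) \<le> H / (2 * pi * (real N + 1))\<^sup>2"
  proof -
    have e: "(norm (F x - fsum F K x))\<^sup>2 = (r x)\<^sup>2" for x
      unfolding S F_def r_def by (simp flip: of_real_diff)
    show "integrable uint (\<lambda>x. (r x)\<^sup>2)"
      using bessel_eq(1)[OF borel_measurable_integrable[OF iF] F2 K] by (simp add: e)
    show "(LINT x|uint. (r x)\<^sup>2) \<le> H / (2 * pi * (real N + 1))\<^sup>2"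
      using H1_fourier_tail[OF iF mG G2(1) eq, of N] by (simp add: e G2(2) flip: K_def)
  qed
  have [measurable]: "r \<in> borel_measurable uint" unfolding r_def by measurable
  have s2: "integrable uint (\<lambda>x. (s x)\<^sup>2)" and sE: "(LINT x|uint. (s x)\<^sup>2) = E"
  proof -
    show "integrable uint (\<lambda>x. (s x)\<^sup>2)"
    proof (rule integrable_uint_bounded)
      show "norm ((s x)\<^sup>2) \<le> (\<Sum>k\<in>K. norm (fc F k))\<^sup>2" for x
        using norm_fsum_le[of F K x] power_mono[of "\<bar>s x\<bar>" _ 2] by (simp add: S)
    qed measurable
    show "(LINT x|uint. (s x)\<^sup>2) = E"
      using integral_norm_fsum[OF K, of F] by (simp add: S E)
  qed
  have [simp]: "0 \<le> E" by (simp add: E sum_nonneg)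
  have [simp]: "0 \<le> H" by (simp add: H_def)
  have deriv: "(s has_vector_derivative d x) (at x)" for x
  proof -
    have "(fsum F K has_vector_derivative (\<Sum>k\<in>K. fc F k * ((2 * pi * of_int k * \<i>) * expi k x))) (at x)"
      unfolding fsum_def[abs_def]
      by (intro has_vector_derivative_sum has_vector_derivative_mult_right expi_deriv)
    also have "(\<Sum>k\<in>K. fc F k * ((2 * pi * of_int k * \<i>) * expi k x)) = fsum G K x"
      unfolding fsum_def eq by (simp add: mult_ac)
    finally show ?thesis unfolding s_def d_def by (rule bounded_linear.has_vector_derivative[OF bounded_linear_Re])
  qed
  have ssd: "(LINT x|uint. (s x)\<^sup>2 * d x) = 0"
  proof -
    have "(LINT x|uint. (s x)\<^sup>2 * d x) = (s 1) ^ 3 / 3 - (s 0) ^ 3 / 3"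
    proof (rule integral_uint_FTC)
      fix x
      have "(s has_real_derivative d x) (at x)"
        using deriv by (simp add: has_real_derivative_iff_has_vector_derivative)
      then have "((\<lambda>x. s x ^ 3 / 3) has_real_derivative (s x)\<^sup>2 * d x) (at x)"
        by (auto intro!: derivative_eq_intros)
      then show "((\<lambda>x. s x ^ 3 / 3) has_vector_derivative (s x)\<^sup>2 * d x) (at x)"
        by (simp add: has_real_derivative_iff_has_vector_derivative)
    next
      have "continuous_on UNIV (fsum g K)" for g unfolding fsum_def[abs_def] by (intro continuous_intros)
      then show "continuous_on UNIV (\<lambda>x. (s x)\<^sup>2 * d x)" unfolding s_def d_def by (intro continuous_intros)
    qed
    also have "s 1 = s 0" by (simp add: s_def fsum_def)
    finally show ?thesis by simp
  qed
  have bd: "integrable uint (\<lambda>x. g x * d x)" "\<bar>LINT x|uint. g x * d x\<bar> \<le> C * (LINT x|uint. \<bar>g x\<bar>)"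
    if g: "integrable uint g" for g :: "real \<Rightarrow> real"
  proof -
    show i: "integrable uint (\<lambda>x. g x * d x)"
      by (rule integrable_uint_mult_bounded[where B = C, OF g]) (auto simp: dC)
    have "\<bar>LINT x|uint. g x * d x\<bar> \<le> (LINT x|uint. \<bar>g x * d x\<bar>)" by (rule integral_abs_bound)
    also have "\<dots> \<le> (LINT x|uint. C * \<bar>g x\<bar>)"
      by (intro integral_mono integrable_abs integrable_mult_right g i)
        (simp add: abs_mult mult.commute[of C] mult_left_mono dC)
    finally show "\<bar>LINT x|uint. g x * d x\<bar> \<le> C * (LINT x|uint. \<bar>g x\<bar>)" by simp
  qed
  define R where "R = sqrt (LINT x|uint. (r x)\<^sup>2)"
  have R2: "R\<^sup>2 = (LINT x|uint. (r x)\<^sup>2)" by (simp add: R_def)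
  have R0: "0 \<le> R" by (simp add: R_def)
  have RH: "R \<le> sqrt H / (2 * pi * (real N + 1))"
    using real_sqrt_le_mono[OF rH] by (simp add: R_def real_sqrt_divide abs_of_nonneg)
  have CS: "integrable uint (\<lambda>x. s x * r x)" "(LINT x|uint. \<bar>s x * r x\<bar>) \<le> sqrt E * R"
    using Cauchy_Schwarz_integral[of s uint r] s2 r2 by (auto simp: sE R_def)
  have "(LINT x|uint. (f x)\<^sup>2 * d x) = (LINT x|uint. (s x)\<^sup>2 * d x + (2 * ((s x * r x) * d x) + (r x)\<^sup>2 * d x))"
    by (rule Bochner_Integration.integral_cong) (auto simp: r_def power2_eq_square algebra_simps)
  also have "\<dots> = 2 * (LINT x|uint. (s x * r x) * d x) + (LINT x|uint. (r x)\<^sup>2 * d x)"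
    using bd(1)[OF s2] bd(1)[OF CS(1)] bd(1)[OF r2] ssd by simp
  finally have "\<bar>LINT x|uint. (f x)\<^sup>2 * d x\<bar> \<le> 2 * (C * (LINT x|uint. \<bar>s x * r x\<bar>)) + C * (LINT x|uint. \<bar>(r x)\<^sup>2\<bar>)"
    using bd(2)[OF CS(1)] bd(2)[OF r2] by linarith
  also have "\<dots> \<le> 2 * (C * (sqrt E * R)) + C * R\<^sup>2"
    using CS(2) C0 by (intro add_mono mult_left_mono) (auto simp: R2)
  also have "\<dots> \<le> 2 * H * sqrt E"
  proof -
    define n where "n = real N + 1"
    have n: "1 \<le> n" by (simp add: n_def)
    \<comment> \<open>2 N + 1 <= (N + 1)^2 is crude, but being a square it makes the factor from
      Cauchy-Schwarz equal to n, the power by which \<open>R\<close> decays.\<close>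
    have card: "real (card K) \<le> n\<^sup>2" by (simp add: K_def n_def power2_eq_square algebra_simps)
    have CSsum: "(\<Sum>k\<in>K. a k)\<^sup>2 \<le> (\<Sum>k\<in>K. (a k)\<^sup>2) * n\<^sup>2" for a :: "int \<Rightarrow> real"
    proof -
      have "(\<Sum>k\<in>K. a k)\<^sup>2 \<le> (\<Sum>k\<in>K. (a k)\<^sup>2) * real (card K)"
        by (rule sum_squared_le_sum_of_squares)
      also have "\<dots> \<le> (\<Sum>k\<in>K. (a k)\<^sup>2) * n\<^sup>2" by (intro mult_left_mono card sum_nonneg) auto
      finally show ?thesis .
    qed
    \<comment> \<open>Two bounds on the supremum of \<open>d\<close>. Through the coefficients of
      \<open>h\<close> it costs n and suits the cross term, which has one factor \<open>R\<close>
      and a factor sqrt E of its own. Through those of \<open>f\<close> it costs n^2 and suits the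
      term with R^2, to which it supplies the factor sqrt E.\<close>
    have C1: "C \<le> sqrt H * n"
    proof (rule power2_le_imp_le)
      have "C\<^sup>2 \<le> (\<Sum>k\<in>K. (norm (fc G k))\<^sup>2) * n\<^sup>2" unfolding C_def by (rule CSsum)
      also have "\<dots> \<le> H * n\<^sup>2"
        using bessel_le[OF mG G2(1) K] by (intro mult_right_mono) (auto simp: G2(2))
      finally show "C\<^sup>2 \<le> (sqrt H * n)\<^sup>2" by (simp add: power_mult_distrib)
    qed (use n in auto)
    have C2: "C \<le> 2 * pi * n * (sqrt E * n)"
    proof -
      have "C \<le> (\<Sum>k\<in>K. 2 * pi * n * norm (fc F k))"
        unfolding C_def
        by (intro sum_mono) (auto simp: eq norm_mult K_def n_def intro!: mult_right_mono)
      also have "\<dots> = 2 * pi * n * (\<Sum>k\<in>K. norm (fc F k))" by (simp add: sum_distrib_left)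
      also have "(\<Sum>k\<in>K. norm (fc F k)) \<le> sqrt E * n"
      proof (rule power2_le_imp_le)
        show "(\<Sum>k\<in>K. norm (fc F k))\<^sup>2 \<le> (sqrt E * n)\<^sup>2"
          using CSsum[of "\<lambda>k. norm (fc F k)"] by (simp add: E[symmetric] power_mult_distrib)
      qed (use n in auto)
      finally show ?thesis using n by (simp add: mult_left_mono)
    qed
    have pi: "1 \<le> pi" using pi_ge_two by linarith
    have "C * R \<le> (sqrt H * n) * (sqrt H / (2 * pi * n))"
      by (intro mult_mono C1) (use RH R0 n in \<open>auto simp: n_def\<close>)
    also have "\<dots> = H / (2 * pi)" using n by (simp add: field_simps)
    also have "\<dots> \<le> H / 2" using pi by (intro divide_left_mono) auto
    finally have 1: "C * R \<le> H / 2" .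
    have "R\<^sup>2 \<le> H / (2 * pi * n)\<^sup>2" using rH by (simp add: R2 n_def)
    then have "C * R\<^sup>2 \<le> (2 * pi * n * (sqrt E * n)) * (H / (2 * pi * n)\<^sup>2)"
      by (intro mult_mono C2) (use n in auto)
    also have "\<dots> = sqrt E * H / (2 * pi)" using n by (simp add: field_simps power2_eq_square)
    also have "\<dots> \<le> sqrt E * H" using pi by (simp add: divide_le_eq mult_le_cancel_left1 not_less)
    finally have 2: "C * R\<^sup>2 \<le> H * sqrt E" by (simp add: mult.commute)
    have "2 * (C * (sqrt E * R)) = 2 * sqrt E * (C * R)" by simp
    also have "\<dots> \<le> 2 * sqrt E * (H / 2)" by (intro mult_left_mono 1) auto
    finally show ?thesis using 2 by (simp add: algebra_simps)
  qed
  finally have main: "\<bar>LINT x|uint. (f x)\<^sup>2 * d x\<bar> \<le> 2 * H * sqrt E" .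
  have "(\<Sum>k\<in>K. cnj (fc F k) * (2 * pi * of_int k * \<i> * fc (\<lambda>x. of_real ((f x)\<^sup>2)) k)) =
      - (\<Sum>k\<in>K. cnj (fc G k) * fc (\<lambda>x. of_real ((f x)\<^sup>2)) k)"
    unfolding eq sum_negf[symmetric] by (rule sum.cong) (auto simp: mult_ac)
  also have "(\<Sum>k\<in>K. cnj (fc G k) * fc (\<lambda>x. of_real ((f x)\<^sup>2)) k) =
      (LINT x|uint. of_real ((f x)\<^sup>2) * cnj (fsum G K x))"
    by (rule fsum_inner[symmetric]) (use f2 K in \<open>auto simp del: of_real_power\<close>)
  also have "\<dots> = of_real (LINT x|uint. (f x)\<^sup>2 * d x)"
    by (simp add: D flip: integral_complex_of_real)
  finally show ?thesis using main by (simp add: F_def[abs_def] K_def H_def)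
qed

subsection \<open>Partial Fourier coefficients on the square\<close>

interpretation usq: pair_sigma_finite uint uint ..

abbreviation "usq \<equiv> uint \<Otimes>\<^sub>M uint"

interpretation usq_finite: finite_measure usq
  by (rule finite_measure_pair_measure) (rule uint.finite_measure_axioms)+

lemma measurable_slice:
  assumes "f \<in> borel_measurable usq" "y \<in> space uint"
  shows "(\<lambda>x. f (x, y)) \<in> borel_measurable uint"
  using assms by measurable

definition slice_fc :: "(real \<times> real \<Rightarrow> real) \<Rightarrow> int \<Rightarrow> real \<Rightarrow> complex" where
  "slice_fc f k y = fc (\<lambda>x. complex_of_real (f (x, y))) k"

definition fc2 :: "(real \<times> real \<Rightarrow> real) \<Rightarrow> int \<Rightarrow> int \<Rightarrow> complex" where
  "fc2 f k m = (LINT z|usq. complex_of_real (f z) * (expi (- k) (fst z) * expi (- m) (snd z)))"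

lemma integrable_fc2:
  assumes "integrable usq f"
  shows "integrable usq (\<lambda>z. complex_of_real (f z) * (expi k (fst z) * expi m (snd z)))"
proof (rule Bochner_Integration.integrable_bound)
  show "integrable usq f" by fact
  have [measurable]: "f \<in> borel_measurable usq" using assms by auto
  show "(\<lambda>z. complex_of_real (f z) * (expi k (fst z) * expi m (snd z))) \<in> borel_measurable usq"
    by measurable
qed (simp add: norm_mult)

lemma
  assumes f: "integrable usq f"
  shows integrable_slice_fc: "integrable uint (slice_fc f k)"
    and fc_slice_fc: "fc (slice_fc f k) m = fc2 f k m"
proof -
  from usq.integrable_snd[of "\<lambda>x y. complex_of_real (f (x, y)) * (expi (- k) x * expi 0 y)"]
    integrable_fc2[OF f, of "- k" 0]
  show i: "integrable uint (slice_fc f k)"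
    by (simp add: case_prod_unfold slice_fc_def[abs_def] fc_def)
  have "fc2 f k m = (LINT y|uint. LINT x|uint. complex_of_real (f (x, y)) * (expi (- k) x * expi (- m) y))"
    using usq.integral_snd[of "\<lambda>x y. complex_of_real (f (x, y)) * (expi (- k) x * expi (- m) y)"]
      integrable_fc2[OF f, of "- k" "- m"] by (simp add: case_prod_unfold fc2_def)
  also have "\<dots> = (LINT y|uint. (LINT x|uint. complex_of_real (f (x, y)) * expi (- k) x) * expi (- m) y)"
    unfolding mult.assoc[symmetric] by simp
  also have "\<dots> = fc (slice_fc f k) m" by (simp add: slice_fc_def fc_def)
  finally show "fc (slice_fc f k) m = fc2 f k m" by simp
qed

lemma integrable_square_imp:
  fixes f :: "real \<times> real \<Rightarrow> real"
  assumes "f \<in> borel_measurable usq" "integrable usq (\<lambda>z. (f z)\<^sup>2)"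
  shows "integrable usq f"
  using usq_finite.square_integrable_imp_integrable[OF assms] .

lemma
  fixes f :: "real \<times> real \<Rightarrow> real"
  assumes "integrable usq f"
  shows AE_integrable_slice: "AE y in uint. integrable uint (\<lambda>x. f (x, y))"
    and integrable_slice: "integrable uint (\<lambda>y. LINT x|uint. f (x, y))"
    and integral_slice: "(LINT y|uint. LINT x|uint. f (x, y)) = (LINT z|usq. f z)"
  using usq.AE_integrable_snd[of "\<lambda>x y. f (x, y)"] usq.integrable_snd[of "\<lambda>x y. f (x, y)"]
    usq.integral_snd[of "\<lambda>x y. f (x, y)"] assms by (simp_all add: case_prod_unfold)

text \<open>The relation between \<open>w\<close> and its derivative in the first variable, tested
  on exponentials only: this is all that the passage to slices reads off from the distributional
  identity.\<close>

definition weak_d1 :: "(real \<times> real \<Rightarrow> real) \<Rightarrow> (real \<times> real \<Rightarrow> real) \<Rightarrow> bool" where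
  "weak_d1 w h \<longleftrightarrow> w \<in> borel_measurable usq \<and> integrable usq (\<lambda>z. (w z)\<^sup>2) \<and>
     h \<in> borel_measurable usq \<and> integrable usq (\<lambda>z. (h z)\<^sup>2) \<and>
     (\<forall>k m. fc2 h k m = 2 * pi * of_int k * \<i> * fc2 w k m)"

definition slice_d1 :: "(real \<times> real \<Rightarrow> real) \<Rightarrow> (real \<times> real \<Rightarrow> real) \<Rightarrow> real \<Rightarrow> bool" where
  "slice_d1 w h y \<longleftrightarrow> integrable uint (\<lambda>x. w (x, y)) \<and>
     (\<lambda>x. h (x, y)) \<in> borel_measurable uint \<and> integrable uint (\<lambda>x. (h (x, y))\<^sup>2) \<and>
     (\<forall>k. slice_fc h k y = 2 * pi * of_int k * \<i> * slice_fc w k y)"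

lemma weak_d1_integrable:
  assumes "weak_d1 w h" shows "integrable usq w" "integrable usq h"
  using assms by (auto simp: weak_d1_def intro: integrable_square_imp)

text \<open>For fixed k both sides are integrable functions of \<open>y\<close> with the same
  Fourier coefficients in \<open>y\<close>, hence equal almost everywhere; as the frequencies are
  countable, one null set serves all of them.\<close>

lemma AE_slice_d1:
  assumes "weak_d1 w h"
  shows "AE y in uint. slice_d1 w h y"
proof -
  note i = weak_d1_integrable[OF assms]
  have "AE y in uint. slice_fc h k y = 2 * pi * of_int k * \<i> * slice_fc w k y" for k
    by (rule fourier_unique)
      (use assms in \<open>auto simp: fc_cmult fc_slice_fc i weak_d1_def intro!: integrable_slice_fc i\<close>)
  then have "AE y in uint. \<forall>k. slice_fc h k y = 2 * pi * of_int k * \<i> * slice_fc w k y"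
    by (simp add: AE_all_countable)
  moreover have "AE y in uint. integrable uint (\<lambda>x. w (x, y))" by (rule AE_integrable_slice) (rule i)
  moreover have "AE y in uint. integrable uint (\<lambda>x. (h (x, y))\<^sup>2)"
    by (rule AE_integrable_slice[of "\<lambda>z. (h z)\<^sup>2"]) (use assms in \<open>auto simp: weak_d1_def\<close>)
  ultimately show ?thesis using AE_space[of uint]
  proof eventually_elim
    fix y
    assume *: "\<forall>k. slice_fc h k y = 2 * pi * of_int k * \<i> * slice_fc w k y"
      "integrable uint (\<lambda>x. w (x, y))" "integrable uint (\<lambda>x. (h (x, y))\<^sup>2)" "y \<in> space uint"
    then have "(\<lambda>x. h (x, y)) \<in> borel_measurable uint"
      using assms by (intro measurable_slice) (auto simp: weak_d1_def)
    with * show "slice_d1 w h y" by (auto simp: slice_d1_def)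
  qed
qed

lemma slice_d1_complex:
  assumes "slice_d1 w h y"
  shows "integrable uint (\<lambda>x. complex_of_real (w (x, y)))"
    "(\<lambda>x. complex_of_real (h (x, y))) \<in> borel_measurable uint"
    "integrable uint (\<lambda>x. (norm (complex_of_real (h (x, y))))\<^sup>2)"
    "\<And>k. fc (\<lambda>x. complex_of_real (h (x, y))) k = 2 * pi * of_int k * \<i> * fc (\<lambda>x. complex_of_real (w (x, y))) k"
    "integrable uint (\<lambda>x. (w (x, y))\<^sup>2)"
proof -
  show *: "integrable uint (\<lambda>x. complex_of_real (w (x, y)))"
    "(\<lambda>x. complex_of_real (h (x, y))) \<in> borel_measurable uint"
    "integrable uint (\<lambda>x. (norm (complex_of_real (h (x, y))))\<^sup>2)"
    "\<And>k. fc (\<lambda>x. complex_of_real (h (x, y))) k = 2 * pi * of_int k * \<i> * fc (\<lambda>x. complex_of_real (w (x, y))) k"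
    using assms by (auto simp: slice_d1_def slice_fc_def)
  have "integrable uint (\<lambda>x. (norm (complex_of_real (w (x, y))))\<^sup>2)"
    by (rule H1_square_integrable[OF *(1) square_integrable_imp_integrable_uint[OF *(2,3)] *(4)])
  then show "integrable uint (\<lambda>x. (w (x, y))\<^sup>2)" by simp
qed

lemma slice_tail:
  assumes "slice_d1 w h y"
  shows "(LINT x|uint. (w (x, y))\<^sup>2) \<le> (\<Sum>k=- int N..int N. (norm (slice_fc w k y))\<^sup>2)
    + (LINT x|uint. (h (x, y))\<^sup>2) / (2 * pi * (real N + 1))\<^sup>2"
proof -
  note s = slice_d1_complex[OF assms]
  have "(LINT x|uint. (norm (complex_of_real (w (x, y))))\<^sup>2) =
      (\<Sum>k=- int N..int N. (norm (fc (\<lambda>x. complex_of_real (w (x, y))) k))\<^sup>2) +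
      (LINT x|uint. (norm (complex_of_real (w (x, y)) - fsum (\<lambda>x. complex_of_real (w (x, y))) {- int N..int N} x))\<^sup>2)"
    by (rule bessel_eq(2)) (use s in auto)
  moreover have "(LINT x|uint. (norm (complex_of_real (w (x, y)) - fsum (\<lambda>x. complex_of_real (w (x, y))) {- int N..int N} x))\<^sup>2)
      \<le> (LINT x|uint. (norm (complex_of_real (h (x, y))))\<^sup>2) / (2 * pi * (real N + 1))\<^sup>2"
    by (rule H1_fourier_tail) (use s in auto)
  ultimately show ?thesis by (simp add: slice_fc_def)
qed

lemma norm_slice_fc_le:
  assumes "integrable uint (\<lambda>x. f (x, y))"
  shows "norm (slice_fc f k y) \<le> (LINT x|uint. \<bar>f (x, y)\<bar>)"
  using norm_fc_le[of "\<lambda>x. complex_of_real (f (x, y))" k] assms by (simp add: slice_fc_def)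

lemma slice_bessel:
  assumes "(\<lambda>x. f (x, y)) \<in> borel_measurable uint" "integrable uint (\<lambda>x. (f (x, y))\<^sup>2)" "finite K"
  shows "(\<Sum>k\<in>K. (norm (slice_fc f k y))\<^sup>2) \<le> (LINT x|uint. (f (x, y))\<^sup>2)"
  using bessel_le[of "\<lambda>x. complex_of_real (f (x, y))" K] assms by (simp add: slice_fc_def)

text \<open>All frequencies above N are paid for by \<open>h\<close> with a factor of order 1 / N^2.
  Applied to differences of members of a sequence, this reduces compactness to finitely many
  coefficients.\<close>

lemma L2_split:
  assumes "weak_d1 w h" and i: "\<And>k. integrable uint (\<lambda>y. (norm (slice_fc w k y))\<^sup>2)"
  shows "(LINT z|usq. (w z)\<^sup>2) \<le> (\<Sum>k=- int N..int N. LINT y|uint. (norm (slice_fc w k y))\<^sup>2)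
    + (LINT z|usq. (h z)\<^sup>2) / (2 * pi * (real N + 1))\<^sup>2"
proof -
  have w2: "integrable usq (\<lambda>z. (w z)\<^sup>2)" and h2: "integrable usq (\<lambda>z. (h z)\<^sup>2)"
    using assms by (auto simp: weak_d1_def)
  have "(LINT z|usq. (w z)\<^sup>2) = (LINT y|uint. LINT x|uint. (w (x, y))\<^sup>2)"
    by (rule integral_slice[OF w2, symmetric])
  also have "\<dots> \<le> (LINT y|uint. (\<Sum>k=- int N..int N. (norm (slice_fc w k y))\<^sup>2)
      + (LINT x|uint. (h (x, y))\<^sup>2) / (2 * pi * (real N + 1))\<^sup>2)"
    using AE_slice_d1[OF assms(1)]
    by (intro integral_mono_AE integrable_slice[OF w2] Bochner_Integration.integrable_add
      Bochner_Integration.integrable_sum i integrable_divide integrable_slice[OF h2])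
      (auto elim!: eventually_mono intro: slice_tail)
  also have "\<dots> = (\<Sum>k=- int N..int N. LINT y|uint. (norm (slice_fc w k y))\<^sup>2)
    + (LINT z|usq. (h z)\<^sup>2) / (2 * pi * (real N + 1))\<^sup>2"
    by (subst Bochner_Integration.integral_add)
      (auto intro!: i integrable_slice[OF h2] Bochner_Integration.integral_sum simp: integral_slice[OF h2])
  finally show ?thesis .
qed

subsection \<open>The energy estimate\<close>

text \<open>\<open>eqn\<close> is the Fourier transform of the equation for \<open>w\<close>, with
  |k| multiplied out so that it covers k = 0, where it agrees with \<open>mean\<close>; pi instead
  of 2 pi accounts for the 1/2 in front of the square.\<close>

locale burgers =
  fixes w h g :: "real \<times> real \<Rightarrow> real" and B :: real
  assumes wh: "weak_d1 w h" and hB: "(LINT z|usq. (h z)\<^sup>2) \<le> B"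
    and g: "g \<in> borel_measurable usq" "integrable usq (\<lambda>z. (g z)\<^sup>2)" "(LINT z|usq. (g z)\<^sup>2) \<le> B"
    and mean: "\<And>m. fc2 w 0 m = 0"
    and eqn: "\<And>k m. complex_of_real (2 * pi * \<bar>of_int k\<bar>) * fc2 g k m =
      2 * pi * of_int m * \<i> * fc2 w k m - pi * of_int k * \<i> * fc2 (\<lambda>z. (w z)\<^sup>2) k m"
begin

text \<open>By the equation, the derivative of \<open>slice_fc w k\<close> in the second variable.
  It is known to be integrable but not bounded, because of the coefficient of
  \<open>g\<close>.\<close>

definition flux :: "int \<Rightarrow> real \<Rightarrow> complex" where
  "flux k y = complex_of_real (2 * pi * \<bar>of_int k\<bar>) * slice_fc g k y +
     complex_of_real (pi * of_int k) * \<i> * slice_fc (\<lambda>z. (w z)\<^sup>2) k y"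

lemma w2: "integrable usq (\<lambda>z. (w z)\<^sup>2)" and h2: "integrable usq (\<lambda>z. (h z)\<^sup>2)"
  and w_meas [measurable]: "w \<in> borel_measurable usq" and h_meas [measurable]: "h \<in> borel_measurable usq"
  and w_int: "integrable usq w" and h_int: "integrable usq h"
  using wh weak_d1_integrable[OF wh] by (auto simp: weak_d1_def)

lemma g_int: "integrable usq g" by (rule integrable_square_imp[OF g(1,2)])

lemmas g_meas [measurable] = g(1)

lemma integrable_flux: "integrable uint (flux k)"
  unfolding flux_def
  by (intro Bochner_Integration.integrable_add integrable_mult_right integrable_slice_fc g_int w2)

lemma fc_flux: "fc (flux k) m = 2 * pi * of_int m * \<i> * fc (slice_fc w k) m"
proof -
  have "fc (flux k) m = complex_of_real (2 * pi * \<bar>of_int k\<bar>) * fc2 g k m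
      + complex_of_real (pi * of_int k) * \<i> * fc2 (\<lambda>z. (w z)\<^sup>2) k m"
    unfolding flux_def
    by (subst fc_add) (simp_all add: fc_cmult fc_slice_fc g_int w2 integrable_slice_fc)
  then show ?thesis unfolding eqn fc_slice_fc[OF w_int] by simp
qed

lemma primitive_exists: "\<exists>c. \<forall>k. AE y in uint. slice_fc w k y = c k + prim (flux k) y"
proof -
  have "\<exists>c. AE y in uint. slice_fc w k y = c + prim (flux k) y" for k
    using weak_derivative_imp_prim[OF integrable_slice_fc[OF w_int] integrable_flux fc_flux] by metis
  then show ?thesis by metis
qed

definition c0 :: "int \<Rightarrow> complex" where
  "c0 = (SOME c. \<forall>k. AE y in uint. slice_fc w k y = c k + prim (flux k) y)"

text \<open>The representative of \<^term>\<open>slice_fc w k\<close> that is continuous in \<open>x\<^sub>2\<close>.\<close>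

definition fcoeff :: "int \<Rightarrow> real \<Rightarrow> complex" where
  "fcoeff k y = c0 k + prim (flux k) y"

lemma AE_fcoeff: "AE y in uint. \<forall>k. slice_fc w k y = fcoeff k y"
  using someI_ex[OF primitive_exists] unfolding c0_def[symmetric] fcoeff_def
  by (simp add: AE_all_countable)

lemma continuous_fcoeff [continuous_intros]: "continuous_on S (fcoeff k)"
  unfolding fcoeff_def by (intro continuous_intros continuous_prim integrable_flux)

lemma measurable_fcoeff [measurable]: "fcoeff k \<in> borel_measurable borel"
  by (intro borel_measurable_continuous_onI continuous_fcoeff)

text \<open>Built from the continuous representatives, so it is continuous and meaningful at every
  \<open>y\<close>, whereas \<open>W\<close> is controlled on almost every slice only.\<close>

definition slice_energy :: "nat \<Rightarrow> real \<Rightarrow> real" where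
  "slice_energy N y = (\<Sum>k=- int N..int N. (norm (fcoeff k y))\<^sup>2)"

lemma continuous_slice_energy: "continuous_on S (slice_energy N)"
  unfolding slice_energy_def[abs_def] by (intro continuous_intros)

lemma slice_energy_nonneg: "0 \<le> slice_energy N y" by (simp add: slice_energy_def sum_nonneg)

definition W :: "real \<Rightarrow> real" where "W y = (LINT x|uint. (w (x, y))\<^sup>2)"
definition H :: "real \<Rightarrow> real" where "H y = (LINT x|uint. (h (x, y))\<^sup>2)"
definition G :: "real \<Rightarrow> real" where "G y = (LINT x|uint. (g (x, y))\<^sup>2)"

lemma integrable_WHG: "integrable uint W" "integrable uint H" "integrable uint G"
  unfolding W_def H_def G_def
  using integrable_slice[OF w2] integrable_slice[OF h2] integrable_slice[OF g(2)] by auto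

lemma integral_HG: "(LINT y|uint. H y) \<le> B" "(LINT y|uint. G y) \<le> B"
  unfolding H_def G_def using integral_slice[OF h2] integral_slice[OF g(2)] hB g(3) by auto

lemma nonneg_WHG [simp]: "0 \<le> W y" "0 \<le> H y" "0 \<le> G y"
  by (simp_all add: W_def H_def G_def)

lemma B_nonneg: "0 \<le> B"
  using integral_HG(1) by (meson Bochner_Integration.integral_nonneg nonneg_WHG(2) order_trans)

text \<open>Collects the almost everywhere statements in a single one, so that the estimates can be
  made slice by slice.\<close>

definition regular_slice :: "real \<Rightarrow> bool" where
  "regular_slice y \<longleftrightarrow> slice_d1 w h y \<and> (\<forall>k. slice_fc w k y = fcoeff k y) \<and> slice_fc w 0 y = 0 \<and>
     (\<lambda>x. g (x, y)) \<in> borel_measurable uint \<and> integrable uint (\<lambda>x. (g (x, y))\<^sup>2)"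

lemma AE_regular_slice: "AE y in uint. regular_slice y"
proof -
  have "AE y in uint. slice_fc w 0 y = 0"
    by (rule fourier_unique_0) (auto intro!: integrable_slice_fc w_int simp: fc_slice_fc w_int mean)
  moreover have "AE y in uint. integrable uint (\<lambda>x. (g (x, y))\<^sup>2)"
    by (rule AE_integrable_slice[OF g(2)])
  ultimately show ?thesis using AE_slice_d1[OF wh] AE_fcoeff AE_space[of uint]
    by eventually_elim (auto simp: regular_slice_def intro!: measurable_slice g(1))
qed

lemma regular_slice_bounds:
  assumes "regular_slice y"
  shows "slice_energy N y \<le> W y" "W y \<le> H y"
proof -
  have d: "slice_d1 w h y" and c: "\<And>k. slice_fc w k y = fcoeff k y" and z: "slice_fc w 0 y = 0"
    using assms by (auto simp: regular_slice_def)
  note s = slice_d1_complex[OF d]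
  show "slice_energy N y \<le> W y"
    using slice_bessel[of w y "{- int N..int N}"] s d by (auto simp: slice_energy_def W_def c slice_d1_def)
  show "W y \<le> H y"
    using H1_poincare[OF s(1-4)] z by (simp add: W_def H_def slice_fc_def)
qed

text \<open>The derivative of \<open>slice_energy N\<close> by the product rule. Its values are
  real, but it is kept complex to fit the product rule for complex primitives.\<close>

definition energy_rate :: "nat \<Rightarrow> real \<Rightarrow> complex" where
  "energy_rate N y = (\<Sum>k=- int N..int N. flux k y * cnj (fcoeff k y) + fcoeff k y * cnj (flux k y))"

lemma integrable_flux_fcoeff: "integrable uint (\<lambda>y. flux k y * cnj (fcoeff k y))"
proof (rule integrable_uint_mult_bounded[OF integrable_flux])
  show "norm (cnj (fcoeff k y)) \<le> norm (c0 k) + (LINT t|uint. norm (flux k t))" for y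
    unfolding fcoeff_def complex_mod_cnj
    by (rule norm_triangle_le) (simp add: prim_norm_le[OF integrable_flux])
qed measurable

lemma integrable_fcoeff_flux: "integrable uint (\<lambda>y. fcoeff k y * cnj (flux k y))"
  using integrable_cnj[OF integrable_flux_fcoeff[of k]] by (simp add: mult.commute)

lemma integrable_energy_rate: "integrable uint (energy_rate N)"
  unfolding energy_rate_def
  by (intro Bochner_Integration.integrable_sum Bochner_Integration.integrable_add
    integrable_flux_fcoeff integrable_fcoeff_flux)

lemma prim_cnj: "prim (\<lambda>t. cnj (u t)) y = cnj (prim u y)"
  unfolding prim_def by (simp flip: Bochner_Integration.integral_cnj add: scaleR_conv_of_real)

lemma prim_sum:
  fixes u :: "'i \<Rightarrow> real \<Rightarrow> complex"
  assumes "\<And>i. i \<in> I \<Longrightarrow> integrable uint (u i)"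
  shows "prim (\<lambda>t. \<Sum>i\<in>I. u i t) y = (\<Sum>i\<in>I. prim (u i) y)"
  unfolding prim_def scaleR_sum_right
  by (rule Bochner_Integration.integral_sum) (auto intro: integrable_uint_indicator assms)

lemma prim_cmult: "prim (\<lambda>t. c * u t) y = (c :: complex) * prim u y"
  unfolding prim_def by (subst integral_mult_right_zero[symmetric]) (simp add: scaleR_conv_of_real mult_ac)

text \<open>Each squared modulus is \<open>fcoeff\<close> times its conjugate. Splitting off the
  constant \<open>c0 k\<close> leaves a product of two primitives, for which integration by parts is
  available.\<close>

lemma slice_energy_prim: "complex_of_real (slice_energy N y) = of_real (slice_energy N 0) + prim (energy_rate N) y"
proof -
  have 1: "complex_of_real ((norm (fcoeff k y))\<^sup>2) = of_real ((norm (fcoeff k 0))\<^sup>2)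
      + prim (\<lambda>t. flux k t * cnj (fcoeff k t) + fcoeff k t * cnj (flux k t)) y" for k
  proof -
    have cf: "integrable uint (\<lambda>t. cnj (flux k t))" using integrable_flux by simp
    have fp: "integrable uint (\<lambda>t. flux k t * cnj (prim (flux k) t))"
      by (rule integrable_uint_mult_bounded[OF integrable_flux, where B = "LINT t|uint. norm (flux k t)"])
        (use measurable_prim[OF integrable_flux] in \<open>auto simp: prim_norm_le[OF integrable_flux]\<close>)
    have pf: "integrable uint (\<lambda>t. prim (flux k) t * cnj (flux k t))"
      using integrable_cnj[OF fp] by (simp add: mult.commute)
    have "prim (\<lambda>t. flux k t * cnj (fcoeff k t) + fcoeff k t * cnj (flux k t)) y =
        prim (\<lambda>t. (cnj (c0 k) * flux k t + c0 k * cnj (flux k t)) +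
          (flux k t * cnj (prim (flux k) t) + prim (flux k) t * cnj (flux k t))) y"
      unfolding fcoeff_def by (simp add: algebra_simps)
    also have "\<dots> = (cnj (c0 k) * prim (flux k) y + c0 k * cnj (prim (flux k) y)) +
        prim (\<lambda>t. flux k t * cnj (prim (flux k) t) + prim (flux k) t * cnj (flux k t)) y"
      using cf integrable_flux fp pf
      by (subst prim_add, simp, simp, subst prim_add) (simp_all add: prim_cmult prim_cnj)
    also have "prim (\<lambda>t. flux k t * cnj (prim (flux k) t) + prim (flux k) t * cnj (flux k t)) y =
        prim (flux k) y * cnj (prim (flux k) y)"
      using prim_mult_prim[OF integrable_flux cf, of k y] by (simp add: prim_cnj)
    finally show ?thesis
      unfolding complex_norm_square by (simp add: fcoeff_def algebra_simps)
  qed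
  have "complex_of_real (slice_energy N y) = (\<Sum>k=- int N..int N. complex_of_real ((norm (fcoeff k y))\<^sup>2))"
    by (simp add: slice_energy_def)
  also have "\<dots> = (\<Sum>k=- int N..int N. complex_of_real ((norm (fcoeff k 0))\<^sup>2))
      + prim (energy_rate N) y"
    unfolding 1 sum.distrib[of "\<lambda>k. complex_of_real ((norm (fcoeff k 0))\<^sup>2)"] energy_rate_def
    by (subst prim_sum) (auto intro!: Bochner_Integration.integrable_add integrable_flux_fcoeff integrable_fcoeff_flux)
  finally show ?thesis by (simp add: slice_energy_def)
qed

text \<open>The rate is twice a real part. In the part with \<open>g\<close>, the factor 2 pi |k| is
  moved onto the coefficient of \<open>w\<close>, where it produces that of \<open>h\<close>; then 2
  a b <= a^2 + b^2 and Bessel give H + G. The transport part is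
  \<open>cubic_fourier_bound\<close>.\<close>

lemma norm_energy_rate_le:
  assumes "regular_slice y"
  shows "norm (energy_rate N y) \<le> H y + G y + 2 * H y * sqrt (slice_energy N y)"
proof -
  have d: "slice_d1 w h y" and c: "\<And>k. slice_fc w k y = fcoeff k y"
    and gs: "(\<lambda>x. g (x, y)) \<in> borel_measurable uint" "integrable uint (\<lambda>x. (g (x, y))\<^sup>2)"
    using assms by (auto simp: regular_slice_def)
  define K where "K = {- int N..int N}"
  define S1 where "S1 = (\<Sum>k\<in>K. cnj (fcoeff k y) * (complex_of_real (2 * pi * \<bar>of_int k\<bar>) * slice_fc g k y))"
  define S2 where "S2 = (\<Sum>k\<in>K. cnj (fcoeff k y) * (2 * pi * of_int k * \<i> * slice_fc (\<lambda>z. (w z)\<^sup>2) k y))"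
  have "(\<Sum>k\<in>K. cnj (fcoeff k y) * flux k y) = S1 + S2 / 2"
    unfolding S1_def S2_def sum_divide_distrib sum.distrib[symmetric] flux_def
    by (rule sum.cong) (auto simp: algebra_simps)
  moreover have "energy_rate N y = (\<Sum>k\<in>K. cnj (fcoeff k y) * flux k y) + cnj (\<Sum>k\<in>K. cnj (fcoeff k y) * flux k y)"
    unfolding energy_rate_def K_def by (simp add: sum.distrib mult.commute)
  ultimately have "norm (energy_rate N y) \<le> norm (S1 + S2 / 2) + norm (cnj (S1 + S2 / 2))"
    by (simp only: norm_triangle_ineq)
  also have "\<dots> = 2 * norm (S1 + S2 / 2)" unfolding complex_mod_cnj by simp
  also have "\<dots> \<le> 2 * norm S1 + norm S2"
    using norm_triangle_ineq[of S1 "S2 / 2"] by (simp add: norm_divide)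
  also have "norm S2 \<le> 2 * H y * sqrt (slice_energy N y)"
  proof -
    have "integrable uint (\<lambda>x. w (x, y))" "(\<lambda>x. h (x, y)) \<in> borel_measurable uint"
      "integrable uint (\<lambda>x. (h (x, y))\<^sup>2)"
      "\<And>k. fc (\<lambda>x. of_real (h (x, y))) k = 2 * pi * of_int k * \<i> * fc (\<lambda>x. of_real (w (x, y))) k"
      using d by (auto simp: slice_d1_def slice_fc_def)
    from cubic_fourier_bound[OF this, where N = N] show ?thesis
      by (simp add: S2_def H_def slice_energy_def K_def slice_fc_def flip: c)
  qed
  also have "2 * norm S1 \<le> H y + G y"
  proof -
    have "2 * norm S1 \<le> 2 * (\<Sum>k\<in>K. norm (slice_fc h k y) * norm (slice_fc g k y))"
      unfolding S1_def using d
      by (intro mult_left_mono order_trans[OF norm_sum] sum_mono)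
        (auto simp: norm_mult slice_d1_def c abs_mult)
    also have "\<dots> \<le> (\<Sum>k\<in>K. (norm (slice_fc h k y))\<^sup>2 + (norm (slice_fc g k y))\<^sup>2)"
      unfolding sum_distrib_left by (intro sum_mono) (simp add: mult.assoc[symmetric] sum_squares_bound)
    also have "\<dots> \<le> H y + G y"
      unfolding sum.distrib H_def G_def K_def
      by (intro add_mono slice_bessel gs) (use d in \<open>auto simp: slice_d1_def\<close>)
    finally show ?thesis .
  qed
  finally show ?thesis by simp
qed

text \<open>With M the maximum over [0, 1], a start value of at most B + 1 and the integrated rate 2
  B + 2 B sqrt M give M <= 3 B + 1 + 2 B sqrt M. Absorbing the last term by M / 2 + 2 B^2 and
  doubling produces the constant, which is independent of N.\<close>

lemma slice_energy_bound:
  assumes y: "0 \<le> y" "y \<le> 1"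
  shows "slice_energy N y \<le> 6 * B + 2 + 4 * B\<^sup>2"
proof -
  obtain ym where ym: "ym \<in> {0..1}" and max: "\<And>y. y \<in> {0..1} \<Longrightarrow> slice_energy N y \<le> slice_energy N ym"
    using continuous_attains_sup[of "{0..1}" "slice_energy N"] continuous_slice_energy by auto
  define M where "M = slice_energy N ym"
  \<comment> \<open>Otherwise B + 1 < \<open>slice_energy\<close> <= \<open>W\<close> <=
    \<open>H\<close> on almost every slice, the last inequality by Poincare, although the integral
    of \<open>H\<close> is at most B.\<close>
  have "\<exists>y0\<in>{0..<1}. slice_energy N y0 \<le> B + 1"
  proof (rule ccontr)
    assume "\<not> ?thesis"
    then have a: "B + 1 < slice_energy N y" if "0 \<le> y" "y < 1" for y using that by force
    have "(LINT y|uint. B + 1) \<le> (LINT y|uint. H y)"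
    proof (intro integral_mono_AE)
      show "AE y in uint. B + 1 \<le> H y"
        using AE_regular_slice AE_space[of uint]
      proof eventually_elim
        fix y assume "regular_slice y" "y \<in> space uint"
        then show "B + 1 \<le> H y" using regular_slice_bounds(1)[of y N] regular_slice_bounds(2)[of y] a[of y] by simp
      qed
    qed (auto intro: integrable_WHG)
    then show False using integral_HG(1) by simp
  qed
  then obtain y0 where y0: "y0 \<in> {0..<1}" "slice_energy N y0 \<le> B + 1" by blast
  \<comment> \<open>The energy under the root is replaced by its maximum, so that the majorant is a
    fixed combination of \<open>H\<close> and \<open>G\<close>, whose integrals are known.\<close>
  define q where "q t = H t + G t + 2 * sqrt M * H t" for t
  have iq: "integrable uint q" unfolding q_def using integrable_WHG by simp
  have q0: "0 \<le> q t" for t unfolding q_def M_def by (simp add: slice_energy_nonneg)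
  have AEq: "AE t in uint. norm (energy_rate N t) \<le> q t"
    using AE_regular_slice AE_space[of uint]
  proof eventually_elim
    fix t assume t: "regular_slice t" "t \<in> space uint"
    have "2 * H t * sqrt (slice_energy N t) \<le> 2 * H t * sqrt M"
      unfolding M_def using max[of t] t(2) by (intro mult_left_mono) auto
    then show "norm (energy_rate N t) \<le> q t" using norm_energy_rate_le[OF t(1), of N] by (simp add: q_def mult_ac)
  qed
  have q_int: "(LINT t|uint. q t) \<le> 2 * B + 2 * sqrt M * B"
  proof -
    have "(LINT t|uint. q t) = (LINT t|uint. H t) + (LINT t|uint. G t) + 2 * sqrt M * (LINT t|uint. H t)"
      unfolding q_def using integrable_WHG by simp
    also have "\<dots> \<le> B + B + 2 * sqrt M * B"
      using integral_HG by (intro add_mono mult_left_mono) (auto simp: M_def slice_energy_nonneg)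
    finally show ?thesis by simp
  qed
  have le: "norm (prim (energy_rate N) b - prim (energy_rate N) a) \<le> (LINT t|uint. q t)" if "a \<le> b" for a b
  proof -
    have "norm (prim (energy_rate N) b - prim (energy_rate N) a) \<le> prim q b - prim q a"
      by (rule prim_diff_le[OF integrable_energy_rate iq AEq that])
    also have "\<dots> = (LINT t|uint. indicator {a..<b} t *\<^sub>R q t)" by (rule prim_diff_eq[OF iq that])
    also have "\<dots> \<le> (LINT t|uint. q t)"
      by (intro integral_mono integrable_uint_indicator iq) (auto simp: indicator_def q0)
    finally show ?thesis .
  qed
  have "M - slice_energy N y0 \<le> norm (complex_of_real (M - slice_energy N y0))"
    by (simp only: norm_of_real abs_ge_self)
  also have "complex_of_real (M - slice_energy N y0) = prim (energy_rate N) ym - prim (energy_rate N) y0"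
    using slice_energy_prim[of N ym] slice_energy_prim[of N y0] by (simp add: M_def)
  also have "norm \<dots> \<le> (LINT t|uint. q t)"
    using le[of y0 ym] le[of ym y0] by (cases "y0 \<le> ym") (auto simp: norm_minus_commute)
  finally have "M \<le> 3 * B + 1 + 2 * sqrt M * B" using q_int y0(2) by linarith
  moreover have "2 * sqrt M * B \<le> M / 2 + 2 * B\<^sup>2"
  proof -
    have "0 \<le> (sqrt M - 2 * B)\<^sup>2" by simp
    also have "\<dots> = M - 4 * sqrt M * B + 4 * B\<^sup>2"
      using slice_energy_nonneg[of N ym] by (simp add: power2_diff M_def power_mult_distrib)
    finally show ?thesis by simp
  qed
  ultimately have "M \<le> 6 * B + 2 + 4 * B\<^sup>2" by linarith
  then show ?thesis using max[of y] y by (simp add: M_def)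
qed

end

subsection \<open>Consequences of the energy estimate\<close>

lemma prim_const: "prim (\<lambda>t. c :: real) y = c * y" if "0 \<le> y" "y \<le> 1"
proof -
  have "prim (\<lambda>t. c) y = (LINT t|lborel. indicator {0..<1} t *\<^sub>R (indicator {..<y} t *\<^sub>R c))"
    unfolding prim_def uint_def by (subst integral_restrict_space) auto
  also have "\<dots> = (LINT t|lborel. indicator {0..<y} t *\<^sub>R c)"
    by (rule Bochner_Integration.integral_cong) (use that in \<open>auto simp: indicator_def\<close>)
  also have "\<dots> = c * y" using that by simp
  finally show ?thesis .
qed

context burgers
begin

definition energy_bound :: real where "energy_bound = 6 * B + 2 + 4 * B\<^sup>2"

lemma norm_fcoeff_le:
  assumes "0 \<le> y" "y \<le> 1"
  shows "(norm (fcoeff k y))\<^sup>2 \<le> energy_bound"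
proof -
  have "(norm (fcoeff k y))\<^sup>2 \<le> slice_energy (nat \<bar>k\<bar>) y"
    unfolding slice_energy_def by (rule member_le_sum) auto
  also have "\<dots> \<le> energy_bound" unfolding energy_bound_def by (rule slice_energy_bound[OF assms])
  finally show ?thesis .
qed

lemma energy_bound_nonneg: "0 \<le> energy_bound" using B_nonneg by (simp add: energy_bound_def)

text \<open>The bound for the truncations is uniform in N, and on a fixed slice the tail is a
  multiple of \<open>H y\<close> that tends to 0.\<close>

lemma W_le_energy_bound:
  assumes y: "regular_slice y" "0 \<le> y" "y \<le> 1"
  shows "W y \<le> energy_bound"
proof -
  have "W y \<le> energy_bound + H y * inverse (real (Suc N))" for N
  proof -
    have "W y \<le> slice_energy N y + H y / (2 * pi * (real N + 1))\<^sup>2"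
      using slice_tail[of w h y N] y(1) by (simp add: regular_slice_def slice_energy_def W_def H_def)
    moreover have "H y / (2 * pi * (real N + 1))\<^sup>2 \<le> H y / real (Suc N)"
    proof (rule divide_left_mono)
      have "1 * real (Suc N) \<le> (2 * pi)\<^sup>2 * (real N + 1)\<^sup>2"
        using pi_ge_two self_le_power[of "real N + 1" 2] by (intro mult_mono one_le_power) auto
      then show "real (Suc N) \<le> (2 * pi * (real N + 1))\<^sup>2" by (simp only: power_mult_distrib mult_1)
    qed auto
    ultimately show ?thesis
      using slice_energy_bound[OF y(2,3), of N] by (simp add: energy_bound_def divide_inverse)
  qed
  moreover have "(\<lambda>N. energy_bound + H y * inverse (real (Suc N))) \<longlonglongrightarrow> energy_bound + H y * 0"
    by (intro tendsto_intros LIMSEQ_inverse_real_of_nat)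
  ultimately show ?thesis
    by (intro tendsto_lowerbound[where a = "W y" and x = energy_bound]) auto
qed

text \<open>On a slice w^6 is w^4 times w^2, and the supremum bound gives w^4 <= 9 W H. Integrating
  in the first variable leaves 9 W^2 H, where \<open>W\<close> is bounded and only \<open>H\<close>
  remains to be integrated. Nonnegative integrals are used because integrability of w^6 is part of
  the claim.\<close>

lemma L6_bound:
  shows "integrable usq (\<lambda>z. (w z) ^ 6)" "(LINT z|usq. (w z) ^ 6) \<le> 9 * energy_bound\<^sup>2 * B"
proof -
  have "(\<integral>\<^sup>+z. ennreal ((w z) ^ 6) \<partial>usq) = (\<integral>\<^sup>+y. \<integral>\<^sup>+x. ennreal ((w (x, y)) ^ 6) \<partial>uint \<partial>uint)"
    by (rule usq.nn_integral_snd[symmetric]) measurable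
  also have "\<dots> \<le> (\<integral>\<^sup>+y. ennreal (9 * energy_bound\<^sup>2 * H y) \<partial>uint)"
  proof (rule nn_integral_mono_AE)
    show "AE y in uint. (\<integral>\<^sup>+x. ennreal ((w (x, y)) ^ 6) \<partial>uint) \<le> ennreal (9 * energy_bound\<^sup>2 * H y)"
      using AE_regular_slice AE_space[of uint]
    proof eventually_elim
      fix y assume y: "regular_slice y" "y \<in> space uint"
      then have d: "slice_d1 w h y" and z: "slice_fc w 0 y = 0" by (auto simp: regular_slice_def)
      note s = slice_d1_complex[OF d]
      have Wb: "W y \<le> energy_bound" using W_le_energy_bound[OF y(1)] y(2) by simp
      have "AE x in uint. (norm (complex_of_real (w (x, y))))\<^sup>2 \<le> 3 *
        (sqrt (LINT x|uint. (norm (complex_of_real (w (x, y))))\<^sup>2) * sqrt (LINT x|uint. (norm (complex_of_real (h (x, y))))\<^sup>2))"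
        by (rule H1_sup_bound) (use s z in \<open>auto simp: slice_fc_def\<close>)
      then have "AE x in uint. (w (x, y))\<^sup>2 \<le> 3 * (sqrt (W y) * sqrt (H y))"
        by (simp add: W_def H_def)
      then have "AE x in uint. ennreal ((w (x, y)) ^ 6) \<le> ennreal (9 * W y * H y * (w (x, y))\<^sup>2)"
      proof eventually_elim
        fix x assume a: "(w (x, y))\<^sup>2 \<le> 3 * (sqrt (W y) * sqrt (H y))"
        have "(w (x, y)) ^ 6 = ((w (x, y))\<^sup>2)\<^sup>2 * (w (x, y))\<^sup>2" by (simp flip: power_mult power_add)
        also have "\<dots> \<le> (3 * (sqrt (W y) * sqrt (H y)))\<^sup>2 * (w (x, y))\<^sup>2"
          by (intro mult_right_mono power_mono a) auto
        also have "\<dots> = 9 * W y * H y * (w (x, y))\<^sup>2" by (simp add: power_mult_distrib)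
        finally show "ennreal ((w (x, y)) ^ 6) \<le> ennreal (9 * W y * H y * (w (x, y))\<^sup>2)" by (rule ennreal_leI)
      qed
      then have "(\<integral>\<^sup>+x. ennreal ((w (x, y)) ^ 6) \<partial>uint) \<le> (\<integral>\<^sup>+x. ennreal (9 * W y * H y * (w (x, y))\<^sup>2) \<partial>uint)"
        by (rule nn_integral_mono_AE)
      also have "\<dots> = ennreal (9 * W y * H y * W y)"
        using s(5) by (subst nn_integral_eq_integral) (auto simp: W_def)
      also have "\<dots> \<le> ennreal (9 * energy_bound\<^sup>2 * H y)"
      proof (rule ennreal_leI)
        have "W y * W y \<le> energy_bound * energy_bound" using Wb by (intro mult_mono) (auto simp: energy_bound_nonneg)
        then have "9 * H y * (W y * W y) \<le> 9 * H y * (energy_bound * energy_bound)" by (intro mult_left_mono) auto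
        then show "9 * W y * H y * W y \<le> 9 * energy_bound\<^sup>2 * H y" by (simp add: power2_eq_square mult_ac)
      qed
      finally show "(\<integral>\<^sup>+x. ennreal ((w (x, y)) ^ 6) \<partial>uint) \<le> ennreal (9 * energy_bound\<^sup>2 * H y)" .
    qed
  qed
  also have "\<dots> = ennreal (9 * energy_bound\<^sup>2 * (LINT y|uint. H y))"
    using integrable_WHG by (subst nn_integral_eq_integral) auto
  also have "\<dots> \<le> ennreal (9 * energy_bound\<^sup>2 * B)"
    by (intro ennreal_leI mult_left_mono integral_HG) auto
  finally have le: "(\<integral>\<^sup>+z. ennreal ((w z) ^ 6) \<partial>usq) \<le> ennreal (9 * energy_bound\<^sup>2 * B)" .
  show i: "integrable usq (\<lambda>z. (w z) ^ 6)"
  proof (rule integrableI_bounded)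
    show "(\<integral>\<^sup>+z. ennreal (norm ((w z) ^ 6)) \<partial>usq) < \<infinity>"
      using le by (simp add: le_less_trans)
  qed measurable
  show "(LINT z|usq. (w z) ^ 6) \<le> 9 * energy_bound\<^sup>2 * B"
    using le by (subst (asm) nn_integral_eq_integral[OF i]) (auto simp: B_nonneg)
qed

text \<open>\<open>G\<close> is integrable in \<open>y\<close> without a pointwise bound. Young's
  inequality 2 sqrt G <= \<delta> G + 1 / \<delta> splits the increment into a part \<delta> B that
  does not shrink with y - z and a Lipschitz part; choosing \<delta> small first gives a modulus of
  continuity depending on B and k only.\<close>

lemma fcoeff_equicontinuous:
  assumes d: "0 < \<delta>" and z: "0 \<le> z" "z \<le> y" "y \<le> 1"
  shows "norm (fcoeff k y - fcoeff k z) \<le> pi * \<bar>of_int k\<bar> * (\<delta> * B + (1 / \<delta> + energy_bound) * (y - z))"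
proof -
  define C where "C = pi * \<bar>real_of_int k\<bar>"
  have C: "0 \<le> C" by (simp add: C_def)
  define q where "q t = C * \<delta> * G t + C * (1 / \<delta> + energy_bound)" for t
  have iq: "integrable uint q" unfolding q_def using integrable_WHG by simp
  have AEq: "AE t in uint. norm (flux k t) \<le> q t"
    using AE_regular_slice AE_space[of uint]
  proof eventually_elim
    fix t assume t: "regular_slice t" "t \<in> space uint"
    then have ds: "slice_d1 w h t"
      and gs: "(\<lambda>x. g (x, t)) \<in> borel_measurable uint" "integrable uint (\<lambda>x. (g (x, t))\<^sup>2)"
      by (auto simp: regular_slice_def)
    have "(norm (slice_fc g k t))\<^sup>2 \<le> G t"
      using slice_bessel[OF gs, of "{k}"] by (simp add: G_def)
    then have "norm (slice_fc g k t) \<le> sqrt (G t)" by (rule real_le_rsqrt)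
    moreover have "2 * sqrt (G t) \<le> \<delta> * G t + 1 / \<delta>"
    proof -
      have "2 * (sqrt (\<delta> * G t) * sqrt (1 / \<delta>)) \<le> (sqrt (\<delta> * G t))\<^sup>2 + (sqrt (1 / \<delta>))\<^sup>2"
        using sum_squares_bound[of "sqrt (\<delta> * G t)" "sqrt (1 / \<delta>)"] by simp
      then show ?thesis using d by (simp add: real_sqrt_mult real_sqrt_divide power_mult_distrib power_divide)
    qed
    ultimately have 1: "2 * norm (slice_fc g k t) \<le> \<delta> * G t + 1 / \<delta>" by linarith
    have "norm (slice_fc (\<lambda>z. (w z)\<^sup>2) k t) \<le> (LINT x|uint. \<bar>(w (x, t))\<^sup>2\<bar>)"
      using slice_d1_complex(5)[OF ds] by (intro norm_slice_fc_le)
    then have 2: "norm (slice_fc (\<lambda>z. (w z)\<^sup>2) k t) \<le> energy_bound"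
      using W_le_energy_bound[OF t(1)] t(2) by (simp add: W_def)
    have "norm (flux k t) \<le> C * (2 * norm (slice_fc g k t)) + C * norm (slice_fc (\<lambda>z. (w z)\<^sup>2) k t)"
      unfolding flux_def C_def
      by (rule order_trans[OF norm_triangle_ineq]) (simp add: norm_mult abs_mult mult_ac)
    also have "\<dots> \<le> C * (\<delta> * G t + 1 / \<delta>) + C * energy_bound"
      by (intro add_mono mult_left_mono 1 2 C)
    finally show "norm (flux k t) \<le> q t" by (simp add: q_def algebra_simps)
  qed
  have "norm (fcoeff k y - fcoeff k z) \<le> prim q y - prim q z"
    using prim_diff_le[OF integrable_flux iq AEq z(2)] by (simp add: fcoeff_def)
  also have "\<dots> = (prim (\<lambda>t. C * \<delta> * G t) y - prim (\<lambda>t. C * \<delta> * G t) z) + C * (1 / \<delta> + energy_bound) * (y - z)"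
    unfolding q_def using z integrable_WHG
    by (subst (1 2) prim_add) (auto simp: prim_const algebra_simps diff_divide_distrib)
  also have "prim (\<lambda>t. C * \<delta> * G t) y - prim (\<lambda>t. C * \<delta> * G t) z =
      (LINT t|uint. indicator {z..<y} t *\<^sub>R (C * \<delta> * G t))"
    by (rule prim_diff_eq) (use z integrable_WHG in auto)
  also have "\<dots> \<le> (LINT t|uint. C * \<delta> * G t)"
    by (intro integral_mono integrable_uint_indicator) (use integrable_WHG C d in \<open>auto simp: indicator_def\<close>)
  also have "\<dots> \<le> C * \<delta> * B" using integral_HG(2) C d by (simp add: mult_left_mono)
  finally show ?thesis by (simp add: C_def algebra_simps)
qed

end

subsection \<open>Compactness of sequences\<close>

lemma measure_usq [simp]: "measure usq (space usq) = 1"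
proof -
  have "emeasure usq (space uint \<times> space uint) = emeasure uint (space uint) * emeasure uint (space uint)"
    by (rule uint.emeasure_pair_measure_Times[OF sets.top sets.top])
  then show ?thesis by (simp add: measure_def space_pair_measure emeasure_space_uint)
qed

lemma weak_d1_diff:
  assumes "weak_d1 w h" "weak_d1 w' h'"
  shows "weak_d1 (\<lambda>z. w z - w' z) (\<lambda>z. h z - h' z)"
proof -
  have sq: "integrable usq (\<lambda>z. (f z - g z)\<^sup>2)"
    if "f \<in> borel_measurable usq" "g \<in> borel_measurable usq"
      "integrable usq (\<lambda>z. (f z)\<^sup>2)" "integrable usq (\<lambda>z. (g z)\<^sup>2)" for f g :: "real \<times> real \<Rightarrow> real"
    using that Cauchy_Schwarz_integral(1)[OF that] by (simp add: power2_diff mult.assoc)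
  have "fc2 (\<lambda>z. f z - g z) k m = fc2 f k m - fc2 g k m" if "integrable usq f" "integrable usq g" for f g k m
    using integrable_fc2[OF that(1)] integrable_fc2[OF that(2)] by (simp add: fc2_def left_diff_distrib)
  then show ?thesis
    using assms weak_d1_integrable[OF assms(1)] weak_d1_integrable[OF assms(2)]
    by (auto simp: weak_d1_def right_diff_distrib intro!: sq)
qed

lemma AE_slice_fc_diff:
  assumes "integrable usq f" "integrable usq g"
  shows "AE y in uint. slice_fc (\<lambda>z. f z - g z) k y = slice_fc f k y - slice_fc g k y"
  using AE_integrable_slice[OF assms(1)] AE_integrable_slice[OF assms(2)]
  by eventually_elim (simp add: slice_fc_def fc_diff)

lemma square_diff_le: "(norm (a - b :: 'a :: real_normed_vector))\<^sup>2 \<le> 2 * (norm (a - c))\<^sup>2 + 2 * (norm (b - c))\<^sup>2"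
proof -
  have "norm (a - b) \<le> norm (a - c) + norm (b - c)"
    using norm_triangle_ineq4[of "a - c" "b - c"] by simp
  then have "(norm (a - b))\<^sup>2 \<le> (norm (a - c) + norm (b - c))\<^sup>2" by (rule power_mono) simp
  also have "\<dots> \<le> 2 * (norm (a - c))\<^sup>2 + 2 * (norm (b - c))\<^sup>2"
    using sum_squares_bound[of "norm (a - c)" "norm (b - c)"] by (simp add: power2_sum)
  finally show ?thesis .
qed

locale burgers_seq =
  fixes w h g :: "nat \<Rightarrow> real \<times> real \<Rightarrow> real" and B :: real
  assumes seq: "\<And>n. burgers (w n) (h n) (g n) B"
begin

sublocale b: burgers "w n" "h n" "g n" B for n by (rule seq)

definition M :: real where "M = 6 * B + 2 + 4 * B\<^sup>2"

lemma energy_bound_eq: "burgers.energy_bound B = M"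
  using b.energy_bound_def by (simp add: M_def)

lemma M_nonneg: "0 \<le> M" using b.energy_bound_nonneg by (simp add: energy_bound_eq)

lemma coeff_bound: "0 \<le> y \<Longrightarrow> y \<le> 1 \<Longrightarrow> norm (b.fcoeff n k y) \<le> sqrt M"
  using b.norm_fcoeff_le[of y n k] by (simp add: energy_bound_eq real_le_rsqrt)

text \<open>The common modulus of continuity carries convergence from the rational points, which are
  dense, to every point.\<close>

lemma coeff_Cauchy:
  assumes conv: "\<And>q. q \<in> \<rat> \<Longrightarrow> 0 \<le> q \<Longrightarrow> q \<le> 1 \<Longrightarrow> convergent (\<lambda>n. b.fcoeff (s n) k q)"
    and y: "0 \<le> y" "y < 1"
  shows "convergent (\<lambda>n. b.fcoeff (s n) k y)"
proof (rule Cauchy_convergent, rule metric_CauchyI)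
  fix e :: real assume e: "e > 0"
  define C where "C = pi * \<bar>real_of_int k\<bar>"
  have C: "0 \<le> C" by (simp add: C_def)
  have B: "0 \<le> B" using b.B_nonneg by auto
  define D where "D = C * B + 1"
  have D: "D > 0" unfolding D_def using C B by (simp add: add_nonneg_pos)
  \<comment> \<open>Fixed first, to make the part independent of q - y at most e / 6; the summand 1
    in \<open>D\<close> keeps the denominator positive.\<close>
  define \<delta> where "\<delta> = e / (6 * D)"
  have \<delta>: "\<delta> > 0" unfolding \<delta>_def using e D by simp
  have "C * B * \<delta> \<le> D * \<delta>" using \<delta> by (intro mult_right_mono) (auto simp: D_def)
  also have "D * \<delta> = e / 6" using D by (simp add: \<delta>_def)
  finally have 1: "C * (\<delta> * B) \<le> e / 6" by (simp add: mult_ac)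
  define L where "L = C * (1 / \<delta> + M)"
  have L: "0 \<le> L" unfolding L_def using C \<delta> M_nonneg by (intro mult_nonneg_nonneg add_nonneg_nonneg) auto
  \<comment> \<open>Then q is taken so close to y that the Lipschitz part is at most e / 6 too; the
    minimum with 1 - y keeps q in [0, 1].\<close>
  define \<eta> where "\<eta> = min (1 - y) (e / (6 * (L + 1)))"
  have \<eta>: "\<eta> > 0" unfolding \<eta>_def using y e L by simp
  obtain q where q: "q \<in> \<rat>" "y < q" "q < y + \<eta>" using Rats_dense_in_real[of y "y + \<eta>"] \<eta> by auto
  have q1: "0 \<le> q" "q \<le> 1" using q y by (auto simp: \<eta>_def)
  have 2: "L * (q - y) \<le> e / 6"
  proof -
    have "L * (q - y) \<le> (L + 1) * (e / (6 * (L + 1)))"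
      using q L by (intro mult_mono) (auto simp: \<eta>_def)
    also have "\<dots> = e / 6" using L by (simp add: field_simps)
    finally show ?thesis .
  qed
  have close: "dist (b.fcoeff n k q) (b.fcoeff n k y) \<le> e / 3" for n
  proof -
    have "norm (b.fcoeff n k q - b.fcoeff n k y) \<le> C * (\<delta> * B + (1 / \<delta> + M) * (q - y))"
      using b.fcoeff_equicontinuous[OF \<delta>, of y q n k] y q q1 by (simp add: C_def energy_bound_eq)
    also have "\<dots> = C * (\<delta> * B) + L * (q - y)" by (simp add: L_def algebra_simps)
    also have "\<dots> \<le> e / 3" using 1 2 by linarith
    finally show ?thesis by (simp add: dist_norm)
  qed
  have "Cauchy (\<lambda>n. b.fcoeff (s n) k q)" using conv[OF q(1) q1] by (rule convergent_Cauchy)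
  then obtain N where N: "\<And>m n. m \<ge> N \<Longrightarrow> n \<ge> N \<Longrightarrow> dist (b.fcoeff (s m) k q) (b.fcoeff (s n) k q) < e / 3"
    using metric_CauchyD[of _ "e / 3"] e by fastforce
  show "\<exists>N. \<forall>m\<ge>N. \<forall>n\<ge>N. dist (b.fcoeff (s m) k y) (b.fcoeff (s n) k y) < e"
  proof (intro exI allI impI)
    fix m n assume "m \<ge> N" "n \<ge> N"
    from N[OF this] close[of "s m"] close[of "s n"]
    show "dist (b.fcoeff (s m) k y) (b.fcoeff (s n) k y) < e"
      using dist_triangle[of "b.fcoeff (s m) k y" "b.fcoeff (s n) k y" "b.fcoeff (s m) k q"]
        dist_triangle[of "b.fcoeff (s m) k q" "b.fcoeff (s n) k y" "b.fcoeff (s n) k q"]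
      by (simp add: dist_commute)
  qed
qed

text \<open>A diagonal subsequence over the countable set of pairs of a frequency and a rational
  point, extended to all points by equicontinuity.\<close>

lemma coeff_subseq:
  obtains s :: "nat \<Rightarrow> nat" where "strict_mono s"
    "\<And>k y. 0 \<le> y \<Longrightarrow> y < 1 \<Longrightarrow> convergent (\<lambda>n. b.fcoeff (s n) k y)"
proof -
  define S where "S = (UNIV :: int set) \<times> (\<rat> \<inter> {0..1 :: real})"
  have "countable S" unfolding S_def by (intro countable_SIGMA countable_Int1 countable_rat) auto
  moreover have "norm (b.fcoeff n (fst z) (snd z)) \<le> sqrt M" if "z \<in> S" for n z
    using that by (auto simp: S_def intro!: coeff_bound)
  ultimately have "\<exists>s. strict_mono (s :: nat \<Rightarrow> nat) \<and>
      (\<forall>z\<in>S. \<exists>l. (\<lambda>n. b.fcoeff (s n) (fst z) (snd z)) \<longlonglongrightarrow> l)"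
    by (rule function_convergent_subsequence[of S "\<lambda>n z. b.fcoeff n (fst z) (snd z)" "sqrt M"]) blast+
  then obtain s where s: "strict_mono (s :: nat \<Rightarrow> nat)"
    "\<And>z. z \<in> S \<Longrightarrow> \<exists>l. (\<lambda>n. b.fcoeff (s n) (fst z) (snd z)) \<longlonglongrightarrow> l"
    by blast
  show thesis
  proof (rule that[OF s(1)])
    fix k and y :: real assume y: "0 \<le> y" "y < 1"
    show "convergent (\<lambda>n. b.fcoeff (s n) k y)"
    proof (rule coeff_Cauchy[OF _ y])
      fix q :: real assume "q \<in> \<rat>" "0 \<le> q" "q \<le> 1"
      then show "convergent (\<lambda>n. b.fcoeff (s n) k q)" using s(2)[of "(k, q)"] by (auto simp: S_def convergent_def)
    qed
  qed
qed

lemma AE_coeff_diff: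
  "AE y in uint. slice_fc (\<lambda>z. w i z - w j z) k y = b.fcoeff i k y - b.fcoeff j k y"
  using AE_slice_fc_diff[OF b.w_int b.w_int, of i j k] b.AE_fcoeff[of i] b.AE_fcoeff[of j]
  by eventually_elim simp

lemma integrable_slice_diff_square:
  "integrable uint (\<lambda>y. (norm (slice_fc (\<lambda>z. w i z - w j z) k y))\<^sup>2)"
proof (rule uint.integrable_const_bound)
  have "slice_fc (\<lambda>z. w i z - w j z) k \<in> borel_measurable uint"
    by (intro borel_measurable_integrable integrable_slice_fc) (auto intro: b.w_int)
  then show "(\<lambda>y. (norm (slice_fc (\<lambda>z. w i z - w j z) k y))\<^sup>2) \<in> borel_measurable uint" by measurable
  show "AE y in uint. norm ((norm (slice_fc (\<lambda>z. w i z - w j z) k y))\<^sup>2) \<le> (2 * sqrt M)\<^sup>2"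
    using AE_coeff_diff[of i j k] AE_space[of uint]
  proof eventually_elim
    fix y assume y: "slice_fc (\<lambda>z. w i z - w j z) k y = b.fcoeff i k y - b.fcoeff j k y" "y \<in> space uint"
    then have "norm (slice_fc (\<lambda>z. w i z - w j z) k y) \<le> 2 * sqrt M"
      using norm_triangle_ineq4[of "b.fcoeff i k y" "b.fcoeff j k y"] coeff_bound[of y i k] coeff_bound[of y j k]
      by simp
    from power_mono[OF this norm_ge_zero, of 2]
    show "norm ((norm (slice_fc (\<lambda>z. w i z - w j z) k y))\<^sup>2) \<le> (2 * sqrt M)\<^sup>2" by simp
  qed
qed

lemma L2_Cauchy_subseq:
  obtains s :: "nat \<Rightarrow> nat" where "strict_mono s"
    "\<And>e. e > 0 \<Longrightarrow> \<exists>N. \<forall>i\<ge>N. \<forall>j\<ge>N. (LINT z|usq. (w (s i) z - w (s j) z)\<^sup>2) < e"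
proof -
  obtain s :: "nat \<Rightarrow> nat" where s: "strict_mono s"
    "\<And>k y. 0 \<le> y \<Longrightarrow> y < 1 \<Longrightarrow> convergent (\<lambda>n. b.fcoeff (s n) k y)"
    by (rule coeff_subseq, rule that, assumption, simp)
  \<comment> \<open>The limits serve coefficient by coefficient, as common reference points for the
    Cauchy estimate; no function with these coefficients is formed.\<close>
  define l where "l k y = lim (\<lambda>n. b.fcoeff (s n) k y)" for k y
  have l: "(\<lambda>n. b.fcoeff (s n) k y) \<longlonglongrightarrow> l k y" if "0 \<le> y" "y < 1" for k y
    unfolding l_def using s(2)[OF that] by (simp add: convergent_LIMSEQ_iff)
  have lm [measurable]: "l k \<in> borel_measurable uint" for k
    by (rule borel_measurable_LIMSEQ_metric[of "\<lambda>n. b.fcoeff (s n) k"]) (auto intro: l)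
  have lb: "norm (l k y) \<le> sqrt M" if "0 \<le> y" "y < 1" for k y
    by (rule tendsto_upperbound[OF tendsto_norm[OF l[OF that]]]) (use that in \<open>auto intro!: always_eventually coeff_bound\<close>)
  define D where "D k i = (LINT y|uint. (norm (b.fcoeff (s i) k y - l k y))\<^sup>2)" for k i
  have db: "norm ((norm (b.fcoeff (s i) k y - l k y))\<^sup>2) \<le> (2 * sqrt M)\<^sup>2" if "0 \<le> y" "y < 1" for i k y
  proof -
    have "norm (b.fcoeff (s i) k y - l k y) \<le> 2 * sqrt M"
      using norm_triangle_ineq4[of "b.fcoeff (s i) k y" "l k y"] coeff_bound[of y "s i" k] lb[OF that, of k] that by simp
    from power_mono[OF this norm_ge_zero, of 2] show ?thesis by simp
  qed
  have iD: "integrable uint (\<lambda>y. (norm (b.fcoeff (s i) k y - l k y))\<^sup>2)" for i k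
    by (rule integrable_uint_bounded[OF _ db]) measurable
  have D0: "(\<lambda>i. D k i) \<longlonglongrightarrow> 0" for k
  proof -
    have "(\<lambda>i. D k i) \<longlonglongrightarrow> (LINT y|uint. 0)"
      unfolding D_def
    proof (rule integral_dominated_convergence[where w = "\<lambda>_. (2 * sqrt M)\<^sup>2"])
      show "AE y in uint. (\<lambda>i. (norm (b.fcoeff (s i) k y - l k y))\<^sup>2) \<longlonglongrightarrow> 0"
      proof (rule AE_I2)
        fix y assume "y \<in> space uint"
        then have "(\<lambda>i. (norm (b.fcoeff (s i) k y - l k y))\<^sup>2) \<longlonglongrightarrow> (norm (l k y - l k y))\<^sup>2"
          by (intro tendsto_intros l) auto
        then show "(\<lambda>i. (norm (b.fcoeff (s i) k y - l k y))\<^sup>2) \<longlonglongrightarrow> 0" by simp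
      qed
      show "AE y in uint. norm ((norm (b.fcoeff (s i) k y - l k y))\<^sup>2) \<le> (2 * sqrt M)\<^sup>2" for i
        by (rule AE_I2) (rule db; simp)
    qed simp_all
    then show ?thesis by simp
  qed
  show thesis
  proof (rule that[OF s(1)])
    fix e :: real assume e: "e > 0"
    have B0: "0 \<le> B" using b.B_nonneg by auto
    \<comment> \<open>Chosen to make the frequencies above N0 contribute less than e / 2:
      differences of the \<open>h\<close> have squared norm at most 4 B, and the divisor c is at
      least N0.\<close>
    obtain N0 :: nat where N0: "8 * B / e < real N0" using reals_Archimedean2 by blast
    define c where "c = (2 * pi * (real N0 + 1))\<^sup>2"
    have "1 * real N0 \<le> (2 * pi)\<^sup>2 * (real N0 + 1)\<^sup>2"
      using pi_ge_two self_le_power[of "real N0 + 1" 2] by (intro mult_mono one_le_power) auto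
    then have cN: "real N0 \<le> c" unfolding c_def by (simp only: power_mult_distrib mult_1)
    have c0: "0 < c" using N0 cN e B0 by (smt (verit) divide_nonneg_pos)
    have tail: "4 * B / c < e / 2"
    proof -
      have "8 * B < c * e" using N0 cN e by (smt (verit) mult_right_mono pos_divide_less_eq)
      then show ?thesis using c0 by (simp add: field_simps)
    qed
    have "(\<lambda>i. \<Sum>k=- int N0..int N0. D k i) \<longlonglongrightarrow> (\<Sum>k=- int N0..int N0. 0)"
      by (intro tendsto_sum D0)
    \<comment> \<open>The comparison with \<open>l\<close> enters with factor 2 for each of the two
      indices, so e / 8 leaves e / 2 for the low frequencies.\<close>
    then have "\<forall>\<^sub>F i in sequentially. (\<Sum>k=- int N0..int N0. D k i) < e / 8"
      using e by (intro order_tendstoD(2)) auto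
    then obtain N where N: "\<And>i. i \<ge> N \<Longrightarrow> (\<Sum>k=- int N0..int N0. D k i) < e / 8"
      by (auto simp: eventually_sequentially)
    show "\<exists>N. \<forall>i\<ge>N. \<forall>j\<ge>N. (LINT z|usq. (w (s i) z - w (s j) z)\<^sup>2) < e"
    proof (intro exI allI impI)
      fix i j assume ij: "i \<ge> N" "j \<ge> N"
      have wd: "weak_d1 (\<lambda>z. w (s i) z - w (s j) z) (\<lambda>z. h (s i) z - h (s j) z)"
        by (intro weak_d1_diff b.wh)
      have hd: "(LINT z|usq. (h (s i) z - h (s j) z)\<^sup>2) \<le> 4 * B"
      proof -
        have "(LINT z|usq. (h (s i) z - h (s j) z)\<^sup>2) \<le> (LINT z|usq. 2 * (h (s i) z)\<^sup>2 + 2 * (h (s j) z)\<^sup>2)"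
          using wd b.h2 square_diff_le[of "h (s i) z" "h (s j) z" 0 for z]
          by (intro integral_mono) (auto simp: weak_d1_def)
        also have "\<dots> = 2 * (LINT z|usq. (h (s i) z)\<^sup>2) + 2 * (LINT z|usq. (h (s j) z)\<^sup>2)"
          using b.h2 by simp
        also have "\<dots> \<le> 4 * B" using b.hB[of "s i"] b.hB[of "s j"] by simp
        finally show ?thesis .
      qed
      have coeff: "(LINT y|uint. (norm (slice_fc (\<lambda>z. w (s i) z - w (s j) z) k y))\<^sup>2) \<le> 2 * D k i + 2 * D k j" for k
      proof -
        have "(LINT y|uint. (norm (slice_fc (\<lambda>z. w (s i) z - w (s j) z) k y))\<^sup>2) \<le>
            (LINT y|uint. 2 * (norm (b.fcoeff (s i) k y - l k y))\<^sup>2 + 2 * (norm (b.fcoeff (s j) k y - l k y))\<^sup>2)"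
          using AE_coeff_diff[of "s i" "s j" k] iD
          by (intro integral_mono_AE integrable_slice_diff_square) (auto elim!: eventually_mono simp: square_diff_le)
        also have "\<dots> = 2 * D k i + 2 * D k j" unfolding D_def using iD by simp
        finally show ?thesis .
      qed
      have "(LINT z|usq. (w (s i) z - w (s j) z)\<^sup>2) \<le>
          (\<Sum>k=- int N0..int N0. LINT y|uint. (norm (slice_fc (\<lambda>z. w (s i) z - w (s j) z) k y))\<^sup>2) +
          (LINT z|usq. (h (s i) z - h (s j) z)\<^sup>2) / c"
        unfolding c_def by (rule L2_split[OF wd integrable_slice_diff_square])
      also have "\<dots> \<le> (\<Sum>k=- int N0..int N0. 2 * D k i + 2 * D k j) + 4 * B / c"
        using c0 by (intro add_mono sum_mono coeff divide_right_mono hd) auto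
      also have "(\<Sum>k=- int N0..int N0. 2 * D k i + 2 * D k j) =
          2 * (\<Sum>k=- int N0..int N0. D k i) + 2 * (\<Sum>k=- int N0..int N0. D k j)"
        by (simp add: sum.distrib sum_distrib_left)
      finally show "(LINT z|usq. (w (s i) z - w (s j) z)\<^sup>2) < e"
        using N[OF ij(1)] N[OF ij(2)] tail by linarith
    qed
  qed
qed

text \<open>As the square has measure one, Cauchy in L2 implies Cauchy in L1, and a further
  subsequence is then Cauchy almost everywhere. Pointwise convergence is what is combined with the
  L6 bound below.\<close>

lemma AE_convergent_subseq:
  obtains s :: "nat \<Rightarrow> nat" and v where "strict_mono s" "v \<in> borel_measurable usq"
    "AE z in usq. (\<lambda>j. w (s j) z) \<longlonglongrightarrow> v z"
proof -
  obtain s :: "nat \<Rightarrow> nat" where s: "strict_mono s"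
    "\<And>e. e > 0 \<Longrightarrow> \<exists>N. \<forall>i\<ge>N. \<forall>j\<ge>N. (LINT z|usq. (w (s i) z - w (s j) z)\<^sup>2) < e"
    by (rule L2_Cauchy_subseq, rule that, assumption, simp)
  have L1: "(LINT z|usq. norm (w i z - w j z)) \<le> sqrt (LINT z|usq. (w i z - w j z)\<^sup>2)" for i j
  proof -
    have "weak_d1 (\<lambda>z. w i z - w j z) (\<lambda>z. h i z - h j z)" by (intro weak_d1_diff b.wh)
    then show ?thesis
      using Cauchy_Schwarz_integral(2)[of "\<lambda>z. w i z - w j z" usq "\<lambda>_. 1"]
      by (simp add: weak_d1_def)
  qed
  have cau: "\<exists>N. \<forall>i\<ge>N. \<forall>j\<ge>N. (LINT z|usq. norm (w (s i) z - w (s j) z)) < e" if "e > 0" for e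
  proof -
    from s(2)[of "e\<^sup>2"] that obtain N where N: "\<And>i j. i \<ge> N \<Longrightarrow> j \<ge> N \<Longrightarrow> (LINT z|usq. (w (s i) z - w (s j) z)\<^sup>2) < e\<^sup>2"
      by auto
    have "(LINT z|usq. norm (w (s i) z - w (s j) z)) < e" if "i \<ge> N" "j \<ge> N" for i j
      using L1[of "s i" "s j"] real_sqrt_less_mono[OF N[OF that]] \<open>e > 0\<close> by (simp del: real_norm_def)
    then show ?thesis by blast
  qed
  obtain r where r: "strict_mono (r :: nat \<Rightarrow> nat)" "AE z in usq. Cauchy (\<lambda>i. w (s (r i)) z)"
    by (rule cauchy_L1_AE_cauchy_subseq[of usq "\<lambda>i. w (s i)", OF b.w_int cau], simp, rule that)
  define v where "v z = lim (\<lambda>i. w (s (r i)) z)" for z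
  show thesis
  proof (rule that[of "s \<circ> r" v])
    show "strict_mono (s \<circ> r)" using s(1) r(1) by (rule strict_mono_o)
    show "v \<in> borel_measurable usq"
      unfolding v_def by (rule borel_measurable_lim_metric) (rule b.w_meas)
    show "AE z in usq. (\<lambda>j. w ((s \<circ> r) j) z) \<longlonglongrightarrow> v z"
      using r(2) by eventually_elim (simp add: v_def Cauchy_convergent_iff convergent_LIMSEQ_iff)
  qed
qed

end

subsection \<open>Convergence almost everywhere and in Lp\<close>

text \<open>A Vitali argument: Fatou passes the bound on sixth powers to \<open>v\<close>. As p < 6,
  the large values of the difference contribute little uniformly in j, and the truncated rest tends
  to 0 by dominated convergence.\<close>

lemma tendsto_Lp_of_AE:
  fixes f :: "nat \<Rightarrow> 'a \<Rightarrow> real"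
  assumes fin: "finite_measure N" and [measurable]: "\<And>j. f j \<in> borel_measurable N" "v \<in> borel_measurable N"
    and lim: "AE x in N. (\<lambda>j. f j x) \<longlonglongrightarrow> v x"
    and i6: "\<And>j. integrable N (\<lambda>x. (f j x) ^ 6)" and b6: "\<And>j. (LINT x|N. (f j x) ^ 6) \<le> A"
    and p: "1 \<le> p" "p < 6"
  shows "integrable N (\<lambda>x. \<bar>v x\<bar> powr p)" "\<And>j. integrable N (\<lambda>x. \<bar>f j x\<bar> powr p)"
    "(\<lambda>j. LINT x|N. \<bar>f j x - v x\<bar> powr p) \<longlonglongrightarrow> 0"
proof -
  interpret N: finite_measure N by fact
  have powr_le: "\<bar>u\<bar> powr p \<le> 1 + u ^ 6" for u :: real
  proof (cases "\<bar>u\<bar> \<le> 1")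
    case True
    then have "\<bar>u\<bar> powr p \<le> 1 powr p" using p by (intro powr_mono2) auto
    then show ?thesis by (simp add: add_increasing2)
  next
    case False
    then have "\<bar>u\<bar> powr p \<le> \<bar>u\<bar> powr 6" using p by (intro powr_mono) auto
    also have "\<dots> = u ^ 6" using False powr_realpow[of "\<bar>u\<bar>" 6] by (simp add: power_even_abs)
    finally show ?thesis by simp
  qed
  have ip: "integrable N (\<lambda>x. \<bar>u x\<bar> powr p)" if [measurable]: "u \<in> borel_measurable N" and "integrable N (\<lambda>x. (u x) ^ 6)" for u :: "'a \<Rightarrow> real"
  proof (rule Bochner_Integration.integrable_bound)
    show "integrable N (\<lambda>x. 1 + (u x) ^ 6)" using that by simp
    show "AE x in N. norm (\<bar>u x\<bar> powr p) \<le> norm (1 + (u x) ^ 6)"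
      using powr_le by (auto intro!: AE_I2 simp: add_nonneg_nonneg)
  qed measurable
  have v6: "(\<integral>\<^sup>+x. ennreal ((v x) ^ 6) \<partial>N) \<le> ennreal A"
  proof -
    have "(\<integral>\<^sup>+x. ennreal ((v x) ^ 6) \<partial>N) = (\<integral>\<^sup>+x. liminf (\<lambda>j. ennreal ((f j x) ^ 6)) \<partial>N)"
    proof (rule nn_integral_cong_AE)
      show "AE x in N. ennreal ((v x) ^ 6) = liminf (\<lambda>j. ennreal ((f j x) ^ 6))"
        using lim
      proof eventually_elim
        fix x assume "(\<lambda>j. f j x) \<longlonglongrightarrow> v x"
        then have "(\<lambda>j. ennreal ((f j x) ^ 6)) \<longlonglongrightarrow> ennreal ((v x) ^ 6)" by (intro tendsto_ennrealI tendsto_power)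
        then show "ennreal ((v x) ^ 6) = liminf (\<lambda>j. ennreal ((f j x) ^ 6))"
          by (intro lim_imp_Liminf[symmetric]) auto
      qed
    qed
    also have "\<dots> \<le> liminf (\<lambda>j. \<integral>\<^sup>+x. ennreal ((f j x) ^ 6) \<partial>N)"
      by (rule nn_integral_liminf) measurable
    also have "\<dots> \<le> liminf (\<lambda>j. ennreal A)"
      using b6 by (intro Liminf_mono always_eventually allI) (subst nn_integral_eq_integral[OF i6], auto intro!: ennreal_leI)
    finally show ?thesis by (simp add: Liminf_const)
  qed
  have vi6: "integrable N (\<lambda>x. (v x) ^ 6)"
    by (rule integrableI_bounded) (use v6 in \<open>auto simp: power_even_abs intro: le_less_trans\<close>)
  have A0: "0 \<le> A" using b6[of 0] by (rule order_trans[rotated]) (simp add: zero_le_even_power)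
  have vA: "(LINT x|N. (v x) ^ 6) \<le> A"
    using v6 by (subst (asm) nn_integral_eq_integral[OF vi6]) (auto simp: A0)
  show "integrable N (\<lambda>x. \<bar>v x\<bar> powr p)" by (rule ip[OF _ vi6]) measurable
  show "integrable N (\<lambda>x. \<bar>f j x\<bar> powr p)" for j by (rule ip[OF _ i6]) measurable
  define u where "u j x = f j x - v x" for j x
  have [measurable]: "u j \<in> borel_measurable N" for j unfolding u_def by measurable
  have six: "(a - b) ^ 6 \<le> 64 * a ^ 6 + 64 * b ^ 6" for a b :: real
  proof -
    define m where "m = max \<bar>a\<bar> \<bar>b\<bar>"
    have "\<bar>a - b\<bar> \<le> 2 * m" by (auto simp: m_def)
    then have "\<bar>a - b\<bar> ^ 6 \<le> (2 * m) ^ 6" by (rule power_mono) simp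
    also have "\<dots> = 64 * m ^ 6" by (simp add: power_mult_distrib)
    also have "m ^ 6 \<le> a ^ 6 + b ^ 6"
      by (auto simp: m_def max_def power_even_abs zero_le_even_power)
    finally show ?thesis by (simp add: power_even_abs)
  qed
  have ui6: "integrable N (\<lambda>x. (u j x) ^ 6)" for j
  proof (rule Bochner_Integration.integrable_bound)
    show "integrable N (\<lambda>x. 64 * (f j x) ^ 6 + 64 * (v x) ^ 6)" using i6 vi6 by simp
    show "AE x in N. norm ((u j x) ^ 6) \<le> norm (64 * (f j x) ^ 6 + 64 * (v x) ^ 6)"
      using six by (auto intro!: AE_I2 simp: u_def zero_le_even_power)
  qed measurable
  have ub6: "(LINT x|N. (u j x) ^ 6) \<le> 128 * A" for j
  proof -
    have "(LINT x|N. (u j x) ^ 6) \<le> (LINT x|N. 64 * (f j x) ^ 6 + 64 * (v x) ^ 6)"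
      using ui6 i6 vi6 by (intro integral_mono) (auto simp: u_def six)
    also have "\<dots> \<le> 128 * A" using i6 vi6 b6[of j] vA by simp
    finally show ?thesis .
  qed
  show "(\<lambda>j. LINT x|N. \<bar>f j x - v x\<bar> powr p) \<longlonglongrightarrow> 0"
  proof (rule LIMSEQ_I)
    fix e :: real assume e: "e > 0"
    define D where "D = 128 * A + 1"
    have D: "D > 0" using A0 by (simp add: D_def)
    define \<delta> where "\<delta> = e / (2 * D)"
    have \<delta>: "\<delta> > 0" using e D by (simp add: \<delta>_def)
    have "\<delta> * (128 * A) < \<delta> * D" using \<delta> by (simp add: D_def)
    also have "\<dots> = e / 2" using D by (simp add: \<delta>_def)
    finally have \<delta>A: "\<delta> * (128 * A) < e / 2" .
    \<comment> \<open>The threshold at which |a|^(6 - p) reaches 1 / \<delta>: beyond it |a|^p <=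
      \<delta> a^6, and up to it |a|^p <= K.\<close>
    define T where "T = (1 / \<delta>) powr (1 / (6 - p))"
    have T: "T > 0" using \<delta> by (simp add: T_def)
    define K where "K = T powr p"
    have split: "\<bar>a\<bar> powr p \<le> \<delta> * a ^ 6 + min (\<bar>a\<bar> powr p) K" for a :: real
    proof (cases "\<bar>a\<bar> \<le> T")
      case True
      then have "\<bar>a\<bar> powr p \<le> K" unfolding K_def using p by (intro powr_mono2) auto
      then show ?thesis using \<delta> by (simp add: zero_le_even_power)
    next
      case False
      then have a: "T < \<bar>a\<bar>" "0 < \<bar>a\<bar>" using T by auto
      have "1 / \<delta> = T powr (6 - p)" using p \<delta> by (simp add: T_def powr_powr)
      also have "\<dots> \<le> \<bar>a\<bar> powr (6 - p)" using a p T by (intro powr_mono2) auto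
      finally have "1 \<le> \<delta> * \<bar>a\<bar> powr (6 - p)" using \<delta> by (simp add: field_simps)
      then have "1 * \<bar>a\<bar> powr p \<le> (\<delta> * \<bar>a\<bar> powr (6 - p)) * \<bar>a\<bar> powr p"
        by (intro mult_right_mono) auto
      also have "\<dots> = \<delta> * \<bar>a\<bar> powr 6" by (simp add: mult.assoc flip: powr_add)
      also have "\<bar>a\<bar> powr 6 = a ^ 6" using a powr_realpow[of "\<bar>a\<bar>" 6] by (simp add: power_even_abs)
      finally show ?thesis by (simp add: K_def add_increasing2)
    qed
    have imin: "integrable N (\<lambda>x. min (\<bar>u j x\<bar> powr p) K)" for j
      by (rule N.integrable_const_bound[where B = K]) (auto intro!: AE_I2 simp: K_def min_def)
    have "(\<lambda>j. LINT x|N. min (\<bar>u j x\<bar> powr p) K) \<longlonglongrightarrow> (LINT x|N. 0)"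
    proof (rule integral_dominated_convergence[where w = "\<lambda>_. K"])
      show "AE x in N. (\<lambda>j. min (\<bar>u j x\<bar> powr p) K) \<longlonglongrightarrow> 0"
        using lim
      proof eventually_elim
        fix x assume "(\<lambda>j. f j x) \<longlonglongrightarrow> v x"
        then have "(\<lambda>j. \<bar>u j x\<bar>) \<longlonglongrightarrow> 0" unfolding u_def by (intro tendsto_rabs_zero) (simp add: LIM_zero_iff)
        then have "(\<lambda>j. \<bar>u j x\<bar> powr p) \<longlonglongrightarrow> 0" by (rule tendsto_zero_powrI[OF _ tendsto_const]) (use p in auto)
        then have "(\<lambda>j. min (\<bar>u j x\<bar> powr p) K) \<longlonglongrightarrow> min 0 K" by (intro tendsto_intros)
        then show "(\<lambda>j. min (\<bar>u j x\<bar> powr p) K) \<longlonglongrightarrow> 0" by (simp add: K_def min_def)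
      qed
      show "AE x in N. norm (min (\<bar>u j x\<bar> powr p) K) \<le> K" for j
        by (auto intro!: AE_I2 simp: K_def min_def)
    qed auto
    then have "\<forall>\<^sub>F j in sequentially. (LINT x|N. min (\<bar>u j x\<bar> powr p) K) < e / 2"
      using e by (intro order_tendstoD(2)) auto
    then obtain n0 where n0: "\<And>j. j \<ge> n0 \<Longrightarrow> (LINT x|N. min (\<bar>u j x\<bar> powr p) K) < e / 2"
      by (auto simp: eventually_sequentially)
    show "\<exists>n0. \<forall>j\<ge>n0. norm ((LINT x|N. \<bar>f j x - v x\<bar> powr p) - 0) < e"
    proof (intro exI allI impI)
      fix j assume j: "j \<ge> n0"
      have "(LINT x|N. \<bar>u j x\<bar> powr p) \<le> (LINT x|N. \<delta> * (u j x) ^ 6 + min (\<bar>u j x\<bar> powr p) K)"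
        using ui6 imin ip[OF _ ui6] split by (intro integral_mono) auto
      also have "\<dots> = \<delta> * (LINT x|N. (u j x) ^ 6) + (LINT x|N. min (\<bar>u j x\<bar> powr p) K)"
        using ui6 imin by simp
      also have "\<dots> < \<delta> * (128 * A) + e / 2"
        using ub6[of j] \<delta> n0[OF j] by (intro add_le_less_mono mult_left_mono) auto
      finally have "(LINT x|N. \<bar>u j x\<bar> powr p) < e" using \<delta>A by linarith
      moreover have "0 \<le> (LINT x|N. \<bar>u j x\<bar> powr p)" by simp
      ultimately show "norm ((LINT x|N. \<bar>f j x - v x\<bar> powr p) - 0) < e" by (simp add: u_def)
    qed
  qed
qed

section \<open>The torus as completion of the product measure\<close>

abbreviation "unit_square \<equiv> {0..<1::real} \<times> {0..<1::real}"

lemma unit_square_borel [simp, measurable]: "unit_square \<in> sets borel"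
  by (intro borel_Times) auto

lemma usq_eq: "usq = restrict_space lborel unit_square"
proof (rule pair_measure_eqI)
  show "sigma_finite_measure uint" "sigma_finite_measure uint" by unfold_locales
  show "sets usq = sets (restrict_space lborel unit_square)"
  proof (intro set_eqI iffI)
    fix A assume A: "A \<in> sets usq"
    have "f \<in> restrict_space lborel unit_square \<rightarrow>\<^sub>M uint"
      if "continuous_on UNIV f" "\<And>z. z \<in> unit_square \<Longrightarrow> f z \<in> {0..<1}" for f :: "real \<times> real \<Rightarrow> real"
      unfolding uint_def
    proof (rule measurable_restrict_space2)
      show "f \<in> space (restrict_space lborel unit_square) \<rightarrow> {0..<1}"
        using that(2) by (simp add: space_restrict_space)
      show "f \<in> restrict_space lborel unit_square \<rightarrow>\<^sub>M lborel"
        using borel_measurable_continuous_onI[OF that(1)] by (simp add: measurable_restrict_space1)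
    qed
    from this[of fst] this[of snd]
    have "fst \<in> restrict_space lborel unit_square \<rightarrow>\<^sub>M uint" "snd \<in> restrict_space lborel unit_square \<rightarrow>\<^sub>M uint"
      by (auto simp: continuous_on_fst continuous_on_snd)
    then have "(\<lambda>z. (fst z, snd z)) \<in> restrict_space lborel unit_square \<rightarrow>\<^sub>M usq" by (rule measurable_Pair)
    from measurable_sets[OF this A] show "A \<in> sets (restrict_space lborel unit_square)"
      using sets.sets_into_space[OF A] by (simp add: space_restrict_space space_pair_measure Int_absorb2)
  next
    fix A assume "A \<in> sets (restrict_space lborel unit_square)"
    then obtain A' where A': "A = unit_square \<inter> A'" "A' \<in> sets borel" by (auto simp: sets_restrict_space)
    have "(\<lambda>z. (fst z, snd z)) \<in> usq \<rightarrow>\<^sub>M borel \<Otimes>\<^sub>M borel" by measurable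
    moreover have "A' \<in> sets (borel \<Otimes>\<^sub>M borel)" using A'(2) by (simp only: borel_prod)
    ultimately have "(\<lambda>z. (fst z, snd z)) -` A' \<inter> space usq \<in> sets usq" by (rule measurable_sets)
    then show "A \<in> sets usq" using A'(1) by (simp add: space_pair_measure Int_commute)
  qed
  fix A B assume "A \<in> sets uint" "B \<in> sets uint"
  then have A: "A \<in> sets borel" "A \<subseteq> {0..<1}" and B: "B \<in> sets borel" "B \<subseteq> {0..<1}"
    by (auto simp: sets_uint sets_restrict_space)
  have "emeasure (restrict_space lborel unit_square) (A \<times> B) = emeasure (lborel \<Otimes>\<^sub>M lborel) (A \<times> B)"
    using A B by (subst emeasure_restrict_space) (auto simp: lborel_prod)
  also have "\<dots> = emeasure lborel A * emeasure lborel B"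
    by (rule lborel.emeasure_pair_measure_Times) (use A B in auto)
  also have "\<dots> = emeasure uint A * emeasure uint B"
    using A B by (simp add: uint_def emeasure_restrict_space)
  finally show "emeasure uint A * emeasure uint B = emeasure (restrict_space lborel unit_square) (A \<times> B)" by simp
qed

lemma torus_eq: "torus = restrict_space (completion lborel) unit_square"
  by (simp add: torus_def)

lemma space_torus [simp]: "space torus = unit_square"
  by (simp add: torus_eq space_restrict_space)

lemma finite_measure_torus: "finite_measure torus"
proof
  have "emeasure torus (space torus) = emeasure usq (space usq)"
    unfolding torus_eq usq_eq by (simp add: emeasure_restrict_space space_restrict_space emeasure_completion)
  then show "emeasure torus (space torus) \<noteq> \<infinity>" using usq_finite.emeasure_finite by simp
qed

lemma measurable_usq_of_borel: "f \<in> borel_measurable borel \<Longrightarrow> f \<in> borel_measurable usq"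
  unfolding usq_eq by (rule measurable_restrict_space1) simp

lemma measurable_torus_of_borel:
  fixes f :: "real \<times> real \<Rightarrow> 'a::topological_space"
  shows "f \<in> borel_measurable borel \<Longrightarrow> f \<in> borel_measurable torus"
  unfolding torus_eq by (intro measurable_restrict_space1 measurable_completion) simp

lemma measurable_torus_of_usq: "f \<in> borel_measurable usq \<Longrightarrow> f \<in> borel_measurable torus"
proof -
  assume f: "f \<in> borel_measurable usq"
  have "sets usq \<subseteq> sets torus"
    unfolding usq_eq torus_eq sets_restrict_space by (intro image_mono subsetI) auto
  moreover have "space usq = space torus" by (simp add: usq_eq space_restrict_space)
  ultimately show ?thesis using f unfolding measurable_def by auto
qed

lemma AE_torus: "(AE z in usq. P z) \<Longrightarrow> AE z in torus. P z"
  unfolding usq_eq torus_eq by (subst (asm) AE_restrict_space_iff, simp, subst AE_restrict_space_iff) (auto intro: AE_completion)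

lemma integral_torus:
  fixes f :: "real \<times> real \<Rightarrow> 'a::{banach, second_countable_topology}"
  assumes [measurable]: "f \<in> borel_measurable borel"
  shows "(LINT z|torus. f z) = (LINT z|usq. f z)"
  unfolding usq_eq torus_eq by (subst (1 2) integral_restrict_space) (auto intro!: integral_completion)

lemma integrable_torus:
  fixes f :: "real \<times> real \<Rightarrow> 'a::{banach, second_countable_topology}"
  assumes [measurable]: "f \<in> borel_measurable borel"
  shows "integrable torus f \<longleftrightarrow> integrable usq f"
  unfolding usq_eq torus_eq by (subst (1 2) integrable_restrict_space) (auto intro!: integrable_completion)

text \<open>Elements of \<open>Lp\<close> are only Lebesgue measurable, whereas Fubini is used on
  the Borel product; the analysis therefore runs on Borel representatives.\<close>

lemma torus_borel_version:
  fixes f :: "real \<times> real \<Rightarrow> real"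
  assumes "f \<in> borel_measurable torus"
  obtains f' where "f' \<in> borel_measurable borel" "AE z in torus. f z = f' z"
proof -
  have "(\<lambda>z. indicator unit_square z *\<^sub>R f z) \<in> borel_measurable (completion lborel)"
    using assms unfolding torus_eq by (subst (asm) borel_measurable_restrict_space_iff) auto
  then obtain f' where f': "f' \<in> borel_measurable lborel"
    "AE z in lborel. indicator unit_square z *\<^sub>R f z = f' z"
    using completion_ex_borel_measurable_real by blast
  show thesis
  proof (rule that)
    show "f' \<in> borel_measurable borel" using f'(1) by simp
    show "AE z in torus. f z = f' z"
      unfolding torus_eq using AE_completion[OF f'(2)] by (subst AE_restrict_space_iff) auto
  qed
qed

subsection \<open>Test functions and distributional Fourier coefficients\<close>

lemma expo_has_derivative:
  "((\<lambda>x. c * expo k x) has_derivative (\<lambda>h. c * (\<i> * complex_of_real (k \<bullet> h)) * expo k x)) (at x)"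
proof -
  have "((\<lambda>x. exp ((k \<bullet> x) *\<^sub>R \<i>)) has_derivative
      (\<lambda>h. (k \<bullet> h) *\<^sub>R (exp ((k \<bullet> x) *\<^sub>R \<i>) * \<i>))) (at x)"
  proof (rule has_derivative_compose[of "\<lambda>x. k \<bullet> x" "\<lambda>h. k \<bullet> h"])
    show "((\<lambda>x. k \<bullet> x) has_derivative (\<lambda>h. k \<bullet> h)) (at x)" by (auto intro!: derivative_eq_intros)
    show "((\<lambda>t. exp (t *\<^sub>R \<i>)) has_derivative (\<lambda>h. h *\<^sub>R (exp ((k \<bullet> x) *\<^sub>R \<i>) * \<i>))) (at (k \<bullet> x))"
      using exp_scaleR_has_vector_derivative_right[of \<i> "k \<bullet> x" UNIV] by (simp add: has_vector_derivative_def)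
  qed
  from has_derivative_mult_right[OF this, of c] show ?thesis
    by (simp add: expo_def[abs_def] cis_conv_exp scaleR_conv_of_real mult_ac)
qed

lemma partial_deriv_expo:
  "partial_deriv e (\<lambda>x. c * expo k x) = (\<lambda>x. (c * \<i> * complex_of_real (k \<bullet> e)) * expo k x)"
proof
  fix x
  show "partial_deriv e (\<lambda>x. c * expo k x) x = (c * \<i> * complex_of_real (k \<bullet> e)) * expo k x"
    using frechet_derivative_at[OF expo_has_derivative[of c k x], symmetric]
    by (simp add: partial_deriv_def mult.assoc)
qed

text \<open>Coinduction asks for a class closed under both partial derivatives. The multiples of one
  exponential form such a class, which is the reason for the factor \<open>c\<close>.\<close>

lemma smooth_expo: "smooth (\<lambda>x. c * expo k x)"
proof -
  have "\<exists>c. \<phi> = (\<lambda>x. c * expo k x) \<Longrightarrow> smooth \<phi>" for \<phi>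
  proof (coinduction arbitrary: \<phi> rule: smooth.coinduct)
    case smooth
    then obtain c where c: "\<phi> = (\<lambda>x. c * expo k x)" by blast
    have "\<exists>c'. partial_deriv e (\<lambda>x. c * expo k x) = (\<lambda>x. c' * expo k x)" for e
      unfolding partial_deriv_expo by (rule exI, rule refl)
    then obtain c1 c2 where "partial_deriv (1, 0) (\<lambda>x. c * expo k x) = (\<lambda>x. c1 * expo k x)"
      "partial_deriv (0, 1) (\<lambda>x. c * expo k x) = (\<lambda>x. c2 * expo k x)" by blast
    moreover have "\<forall>x. (\<lambda>x. c * expo k x) differentiable at x"
      using expo_has_derivative[of c k] unfolding differentiable_def by blast
    ultimately show ?case unfolding c by auto
  qed
  then show ?thesis by blast
qed

definition freq :: "int \<Rightarrow> int \<Rightarrow> real \<times> real" where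
  "freq m n = (2 * pi * of_int m, 2 * pi * of_int n)"

lemma freqs_eq: "freqs = range (\<lambda>(m, n). freq m n)"
  by (auto simp: freqs_def freq_def)

lemma freq_in_freqs [simp]: "freq m n \<in> freqs"
  by (auto simp: freqs_eq)

lemma freq_eq_iff [simp]: "freq m n = freq m' n' \<longleftrightarrow> m = m' \<and> n = n'"
  by (simp add: freq_def)

lemma minus_freq: "- freq m n = freq (- m) (- n)"
  by (simp add: freq_def)

lemma expo_freq: "expo (freq m n) z = expi m (fst z) * expi n (snd z)"
  by (simp add: expo_def freq_def expi_def cis_mult inner_prod_def)

lemma test_fun_expo: "test_fun (expo (freq m n))"
proof -
  have "smooth (expo (freq m n))" using smooth_expo[of 1 "freq m n"] by simp
  moreover have "expi k (x + 1) = expi k x" for k x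
    using expi_int(1)[of k] by (simp add: expi_def distrib_left flip: cis_mult)
  then have "periodic (expo (freq m n))" by (simp add: periodic_def expo_freq)
  ultimately show ?thesis by (simp add: test_fun_def)
qed

lemma measurable_expo [measurable]: "expo k \<in> borel_measurable borel"
  unfolding expo_def[abs_def] cis_conv_exp by (intro borel_measurable_continuous_onI continuous_intros)

lemma integral_expo_freq: "(LINT z|torus. expo (freq m n) z) = (if m = 0 \<and> n = 0 then 1 else 0)"
proof -
  have "(LINT z|torus. expo (freq m n) z) = fc2 (\<lambda>_. 1) (- m) (- n)"
    unfolding integral_torus[OF measurable_expo] fc2_def
    by (rule Bochner_Integration.integral_cong) (auto simp: expo_freq)
  also have "\<dots> = fc (slice_fc (\<lambda>_. 1) (- m)) (- n)" by (rule fc_slice_fc[symmetric]) simp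
  also have "slice_fc (\<lambda>_. 1) (- m) = (\<lambda>_. if m = 0 then 1 else 0)"
    using fc_const[of 1 "- m"] by (simp add: slice_fc_def[abs_def])
  finally show ?thesis by (simp add: fc_const)
qed

text \<open>By orthogonality only the term of the given frequency survives when the series is tested
  on an exponential, so the infinite sum collapses for arbitrary \<open>c\<close>.\<close>

lemma fourier_distr_of_coeffs: "fourier (distr_of_coeffs c) (freq m n) = c (freq m n)"
proof -
  have eq: "(LINT x|torus. expo (freq m' n') x * expo (- freq m n) x) = (if m' = m \<and> n' = n then 1 else 0)" for m' n'
  proof -
    have "expo (freq m' n') x * expo (- freq m n) x = expo (freq (m' - m) (n' - n)) x" for x
      using expi_add[of m' "- m" "fst x"] expi_add[of n' "- n" "snd x"]
      by (simp add: minus_freq expo_freq mult_ac)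
    then show ?thesis by (simp add: integral_expo_freq)
  qed
  have "fourier (distr_of_coeffs c) (freq m n) =
      (\<Sum>\<^sub>\<infinity>k\<in>freqs. c k * (LINT x|torus. expo k x * expo (- freq m n) x))"
    by (simp add: fourier_def distr_of_coeffs_def)
  also have "\<dots> = (\<Sum>\<^sub>\<infinity>k\<in>{freq m n}. c k * (LINT x|torus. expo k x * expo (- freq m n) x))"
    by (rule infsum_cong_neutral) (auto simp: freqs_eq eq)
  also have "\<dots> = c (freq m n)" by (simp add: eq)
  finally show ?thesis .
qed

lemma regular_cmult: "regular f (\<lambda>x. c * \<phi> x) = c * regular f \<phi>"
  unfolding regular_def by (simp add: mult.left_commute)

lemma fourier_d1: "fourier (d1 (regular f)) (freq m n) = 2 * pi * of_int m * \<i> * fourier (regular f) (freq m n)"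
  and fourier_d2: "fourier (d2 (regular f)) (freq m n) = 2 * pi * of_int n * \<i> * fourier (regular f) (freq m n)"
proof -
  have pd: "partial_deriv e (expo k) = (\<lambda>x. (\<i> * complex_of_real (k \<bullet> e)) * expo k x)" for e k
    using partial_deriv_expo[of e 1 k] by simp
  show "fourier (d1 (regular f)) (freq m n) = 2 * pi * of_int m * \<i> * fourier (regular f) (freq m n)"
    "fourier (d2 (regular f)) (freq m n) = 2 * pi * of_int n * \<i> * fourier (regular f) (freq m n)"
    unfolding fourier_def d1_def d2_def pd regular_cmult by (simp_all add: freq_def)
qed

lemma fourier_eta:
  "fourier (eta w) (freq m n) = 2 * pi * of_int n * \<i> * fourier (regular w) (freq m n)
    - pi * of_int m * \<i> * fourier (regular (\<lambda>x. (w x)\<^sup>2)) (freq m n)"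
proof -
  have A: "fourier (regular (\<lambda>x. (w x)\<^sup>2 / 2)) k = fourier (regular (\<lambda>x. (w x)\<^sup>2)) k / 2" for k
    by (simp add: fourier_def regular_def)
  have E: "fourier (eta w) (freq m n) = fourier (d2 (regular w)) (freq m n)
      - fourier (d1 (regular (\<lambda>x. (w x)\<^sup>2 / 2))) (freq m n)"
    by (simp add: fourier_def eta_def)
  show ?thesis unfolding E A fourier_d1 fourier_d2 by simp
qed

text \<open>Multiplied out instead of divided, in the shape that \<open>eqn\<close> requires at
  every frequency.\<close>

lemma fourier_inv_abs_d1:
  "complex_of_real (2 * pi * \<bar>of_int m\<bar>) * fourier (inv_abs_d1 T) (freq m n) = (if m = 0 then 0 else fourier T (freq m n))"
proof -
  have "fst (freq m n) = 2 * pi * of_int m" by (simp add: freq_def)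
  then show ?thesis unfolding inv_abs_d1_def fourier_distr_of_coeffs by (simp add: abs_mult)
qed

text \<open>A finite infimum is not taken over the empty set. A representative is picked whose
  integral lies strictly below A + 1, which leaves room above the infimum.\<close>

lemma sq_integral_le_imp:
  assumes "sq_integral T \<le> ennreal A" "0 \<le> A"
  obtains g where "g \<in> Lp 2" "\<And>\<phi>. test_fun \<phi> \<Longrightarrow> T \<phi> = regular g \<phi>"
    "(\<integral>\<^sup>+x. ennreal ((g x)\<^sup>2) \<partial>torus) \<le> ennreal (A + 1)"
proof -
  have "sq_integral T < ennreal (A + 1)"
    using assms by (auto intro: le_less_trans ennreal_lessI)
  then obtain g where "g \<in> Lp 2" "\<forall>\<phi>. test_fun \<phi> \<longrightarrow> T \<phi> = regular g \<phi>"
    "(\<integral>\<^sup>+x. ennreal ((g x)\<^sup>2) \<partial>torus) < ennreal (A + 1)"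
    unfolding sq_integral_def INF_less_iff by auto
  then show thesis by (intro that) (auto intro: less_imp_le)
qed

subsection \<open>The main theorem\<close>

lemma fourier_regular_eq_fc2:
  assumes "f \<in> borel_measurable torus" and f' [measurable]: "f' \<in> borel_measurable borel"
    and "AE z in torus. f z = f' z"
  shows "fourier (regular f) (freq m n) = fc2 f' m n"
proof -
  have "fourier (regular f) (freq m n) = (LINT z|torus. complex_of_real (f' z) * expo (freq (- m) (- n)) z)"
    unfolding fourier_def regular_def minus_freq
  proof (rule integral_cong_AE)
    show "(\<lambda>z. complex_of_real (f z) * expo (freq (- m) (- n)) z) \<in> borel_measurable torus"
      using assms(1) measurable_torus_of_borel[OF measurable_expo] by measurable
    show "(\<lambda>z. complex_of_real (f' z) * expo (freq (- m) (- n)) z) \<in> borel_measurable torus"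
      by (rule measurable_torus_of_borel) measurable
  qed (use assms(3) in \<open>auto elim: eventually_mono\<close>)
  also have "\<dots> = (LINT z|usq. complex_of_real (f' z) * expo (freq (- m) (- n)) z)"
    by (rule integral_torus) measurable
  also have "\<dots> = fc2 f' m n"
    unfolding fc2_def by (rule Bochner_Integration.integral_cong) (auto simp: expo_freq)
  finally show ?thesis .
qed

lemma Lp2_borel_version:
  assumes "f \<in> Lp 2"
  obtains f' where "f' \<in> borel_measurable borel" "AE z in torus. f z = f' z" "integrable usq (\<lambda>z. (f' z)\<^sup>2)"
    "\<And>A. 0 \<le> A \<Longrightarrow> (\<integral>\<^sup>+z. ennreal ((f z)\<^sup>2) \<partial>torus) \<le> ennreal A \<Longrightarrow> (LINT z|usq. (f' z)\<^sup>2) \<le> A"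
proof -
  have f: "f \<in> borel_measurable torus" "integrable torus (\<lambda>z. \<bar>f z\<bar> powr 2)" using assms by (auto simp: Lp_def)
  then obtain f' where f' [measurable]: "f' \<in> borel_measurable borel" and AE: "AE z in torus. f z = f' z"
    using torus_borel_version by blast
  have AE2: "AE z in torus. \<bar>f z\<bar> powr 2 = (f' z)\<^sup>2" using AE by eventually_elim (simp add: powr_numeral)
  have i: "integrable torus (\<lambda>z. (f' z)\<^sup>2)"
    by (rule integrable_cong_AE_imp[OF f(2)])
      (use AE2 in \<open>auto elim: eventually_mono intro!: measurable_torus_of_borel\<close>)
  have m: "(\<lambda>z. (f' z)\<^sup>2) \<in> borel_measurable borel" by measurable
  show thesis
  proof (rule that[OF f' AE])
    show "integrable usq (\<lambda>z. (f' z)\<^sup>2)" using i integrable_torus[OF m] by simp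
    fix A :: real assume A: "0 \<le> A" and le: "(\<integral>\<^sup>+z. ennreal ((f z)\<^sup>2) \<partial>torus) \<le> ennreal A"
    have "(\<integral>\<^sup>+z. ennreal ((f z)\<^sup>2) \<partial>torus) = (\<integral>\<^sup>+z. ennreal ((f' z)\<^sup>2) \<partial>torus)"
      by (rule nn_integral_cong_AE) (use AE in \<open>auto elim: eventually_mono\<close>)
    also have "\<dots> = ennreal (LINT z|usq. (f' z)\<^sup>2)"
      unfolding integral_torus[OF m, symmetric] by (rule nn_integral_eq_integral[OF i]) simp
    finally show "(LINT z|usq. (f' z)\<^sup>2) \<le> A" using le A by simp
  qed
qed

lemma burgers_of_sq_integral_bounds:
  assumes w: "w \<in> Lp 2" and vm: "vanishing_mean_x1 (regular w)" and A: "0 \<le> A"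
    and a: "sq_integral (inv_abs_d1 (eta w)) \<le> ennreal A" and b: "sq_integral (d1 (regular w)) \<le> ennreal A"
  shows "\<exists>w' h g. w' \<in> borel_measurable borel \<and> (AE z in torus. w z = w' z) \<and> burgers w' h g (A + 1)"
proof -
  obtain w' where w': "w' \<in> borel_measurable borel" "AE z in torus. w z = w' z" "integrable usq (\<lambda>z. (w' z)\<^sup>2)"
    using Lp2_borel_version[OF w] by metis
  obtain h where h: "h \<in> Lp 2" "\<And>\<phi>. test_fun \<phi> \<Longrightarrow> d1 (regular w) \<phi> = regular h \<phi>"
    "(\<integral>\<^sup>+x. ennreal ((h x)\<^sup>2) \<partial>torus) \<le> ennreal (A + 1)"
    using sq_integral_le_imp[OF b A] by blast
  obtain g where g: "g \<in> Lp 2" "\<And>\<phi>. test_fun \<phi> \<Longrightarrow> inv_abs_d1 (eta w) \<phi> = regular g \<phi>"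
    "(\<integral>\<^sup>+x. ennreal ((g x)\<^sup>2) \<partial>torus) \<le> ennreal (A + 1)"
    using sq_integral_le_imp[OF a A] by blast
  obtain h' where h': "h' \<in> borel_measurable borel" "AE z in torus. h z = h' z" "integrable usq (\<lambda>z. (h' z)\<^sup>2)"
    "(LINT z|usq. (h' z)\<^sup>2) \<le> A + 1"
    by (rule Lp2_borel_version[OF h(1)]) (use h(3) A in auto)
  obtain g' where g': "g' \<in> borel_measurable borel" "AE z in torus. g z = g' z" "integrable usq (\<lambda>z. (g' z)\<^sup>2)"
    "(LINT z|usq. (g' z)\<^sup>2) \<le> A + 1"
    by (rule Lp2_borel_version[OF g(1)]) (use g(3) A in auto)
  have fw: "fourier (regular w) (freq m n) = fc2 w' m n" for m n
    by (rule fourier_regular_eq_fc2) (use w w' in \<open>auto simp: Lp_def\<close>)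
  have fw2: "fourier (regular (\<lambda>x. (w x)\<^sup>2)) (freq m n) = fc2 (\<lambda>z. (w' z)\<^sup>2) m n" for m n
    by (rule fourier_regular_eq_fc2) (use w w' in \<open>auto simp: Lp_def elim: eventually_mono\<close>)
  have fh: "fc2 h' m n = fourier (d1 (regular w)) (freq m n)" for m n
    using fourier_regular_eq_fc2[of h h' m n] h(1,2) h' test_fun_expo
    by (auto simp: Lp_def fourier_def minus_freq)
  have fg: "fc2 g' m n = fourier (inv_abs_d1 (eta w)) (freq m n)" for m n
    using fourier_regular_eq_fc2[of g g' m n] g(1,2) g' test_fun_expo
    by (auto simp: Lp_def fourier_def minus_freq)
  have mean: "fc2 w' 0 m = 0" for m
  proof -
    have "fst (freq 0 m) = 0" by (simp add: freq_def)
    then show ?thesis using vm freq_in_freqs[of 0 m] unfolding vanishing_mean_x1_def fw[symmetric] by blast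
  qed
  have "burgers w' h' g' (A + 1)"
  proof
    show "weak_d1 w' h'"
      unfolding weak_d1_def using w' h' by (auto intro: measurable_usq_of_borel simp: fh fourier_d1 fw)
    \<comment> \<open>For k = 0 the left side vanishes, and the right side does because of
      \<open>mean\<close>; for the other k this is the Fourier multiplier of the inverse of |d1|,
      multiplied out.\<close>
    show "complex_of_real (2 * pi * \<bar>of_int k\<bar>) * fc2 g' k m =
        2 * pi * of_int m * \<i> * fc2 w' k m - pi * of_int k * \<i> * fc2 (\<lambda>z. (w' z)\<^sup>2) k m" for k m
      unfolding fg fourier_inv_abs_d1 by (simp add: fourier_eta fw fw2 mean)
  qed (use h' g' mean in \<open>auto intro: measurable_usq_of_borel\<close>)
  then show ?thesis using w' by blast
qed

text \<open>Either integral may be infinite a priori, so the constants are cancelled inside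
  \<open>ennreal\<close>; both terms of the energy are nonnegative, and dropping one bounds the
  other. The two bounds are added to have one constant for both.\<close>

lemma energy_eps_le_imp:
  assumes \<epsilon>: "\<epsilon> > 0" and C: "C < \<infinity>" and le: "energy_eps \<epsilon> w \<le> C"
  shows "sq_integral (inv_abs_d1 (eta w)) \<le> ennreal (2 * \<epsilon> * enn2real C + 2 / \<epsilon> * enn2real C)"
    and "sq_integral (d1 (regular w)) \<le> ennreal (2 * \<epsilon> * enn2real C + 2 / \<epsilon> * enn2real C)"
proof -
  define a where "a = sq_integral (inv_abs_d1 (eta w))"
  define b where "b = sq_integral (d1 (regular w))"
  have E: "ennreal (1 / 2) * (ennreal (1 / \<epsilon>) * a + ennreal \<epsilon> * b) \<le> C"
    using le by (simp add: energy_eps_def a_def b_def)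
  have c: "C = ennreal (enn2real C)" using C by (simp add: less_top)
  have c0: "0 \<le> enn2real C" by simp
  have cancel: "ennreal x * (ennreal (1 / 2) * (ennreal y * t)) = t" if "0 < y" "x = 2 / y" for x y t
  proof -
    have "ennreal x * (ennreal (1 / 2) * ennreal y) = ennreal (x * (1 / 2 * y))"
    proof -
      have "ennreal (1 / 2) * ennreal y = ennreal (1 / 2 * y)" using that by (intro ennreal_mult[symmetric]) auto
      then show ?thesis using that by (simp only:) (intro ennreal_mult[symmetric]; simp)
    qed
    also have "\<dots> = 1" using that by simp
    finally show ?thesis by (metis mult.assoc mult_1)
  qed
  have "a = ennreal (2 * \<epsilon>) * (ennreal (1 / 2) * (ennreal (1 / \<epsilon>) * a))"
    using \<epsilon> by (intro cancel[symmetric]) auto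
  also have "\<dots> \<le> ennreal (2 * \<epsilon>) * C"
    by (intro mult_left_mono order_trans[OF _ E]) auto
  also have "\<dots> = ennreal (2 * \<epsilon> * enn2real C)" using \<epsilon> by (subst c) (simp add: ennreal_mult)
  also have "\<dots> \<le> ennreal (2 * \<epsilon> * enn2real C + 2 / \<epsilon> * enn2real C)" using \<epsilon> by (intro ennreal_leI) simp
  finally show "sq_integral (inv_abs_d1 (eta w)) \<le> ennreal (2 * \<epsilon> * enn2real C + 2 / \<epsilon> * enn2real C)"
    by (simp add: a_def)
  have "b = ennreal (2 / \<epsilon>) * (ennreal (1 / 2) * (ennreal \<epsilon> * b))"
    using \<epsilon> by (intro cancel[symmetric]) auto
  also have "\<dots> \<le> ennreal (2 / \<epsilon>) * C"
    by (intro mult_left_mono order_trans[OF _ E]) auto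
  also have "\<dots> = ennreal (2 / \<epsilon> * enn2real C)" using \<epsilon> by (subst c) (intro ennreal_mult[symmetric]; simp)
  also have "\<dots> \<le> ennreal (2 * \<epsilon> * enn2real C + 2 / \<epsilon> * enn2real C)" using \<epsilon> by (intro ennreal_leI) simp
  finally show "sq_integral (d1 (regular w)) \<le> ennreal (2 * \<epsilon> * enn2real C + 2 / \<epsilon> * enn2real C)"
    by (simp add: b_def)
qed

text \<open>The limit is found on the unit square only, while members of \<open>Lp\<close> are
  periodic functions on the whole plane.\<close>

definition periodize :: "(real \<times> real \<Rightarrow> 'a) \<Rightarrow> real \<times> real \<Rightarrow> 'a" where
  "periodize v z = v (frac (fst z), frac (snd z))"

lemma periodic_periodize: "periodic (periodize v)"
  by (simp add: periodic_def periodize_def frac_1_eq)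

lemma periodize_eq: "z \<in> unit_square \<Longrightarrow> periodize v z = v z"
  by (auto simp: periodize_def frac_eq)

lemma measurable_periodize:
  assumes "v \<in> borel_measurable usq" shows "periodize v \<in> borel_measurable torus"
  by (rule measurable_cong[THEN iffD2, OF _ measurable_torus_of_usq[OF assms]]) (simp add: periodize_eq)

theorem corollary2p11:
  fixes \<epsilon> p :: real and C :: ennreal and w :: "nat \<Rightarrow> real \<times> real \<Rightarrow> real"
  assumes "\<epsilon> > 0" and "C < \<infinity>"
    and "\<And>n. w n \<in> admissible"
    and "\<And>n. energy_eps \<epsilon> (w n) \<le> C"
    and "1 \<le> p" and "p < 6"
  shows "Lp_precompact p w"
proof -
  define A where "A = 2 * \<epsilon> * enn2real C + 2 / \<epsilon> * enn2real C"
  have A: "0 \<le> A" using assms(1) by (simp add: A_def)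
  have wL: "w n \<in> Lp 2" and vm: "vanishing_mean_x1 (regular (w n))" for n
    using assms(3)[of n] by (auto simp: admissible_def)
  have "\<exists>w' h g. w' \<in> borel_measurable borel \<and> (AE z in torus. w n z = w' z) \<and> burgers w' h g (A + 1)" for n
    by (rule burgers_of_sq_integral_bounds[OF wL vm A]) (use energy_eps_le_imp[OF assms(1,2,4)] in \<open>auto simp: A_def\<close>)
  then obtain w' h g where w': "\<And>n. w' n \<in> borel_measurable borel" "\<And>n. AE z in torus. w n z = w' n z"
    and bw: "\<And>n. burgers (w' n) (h n) (g n) (A + 1)"
    by metis
  have wm: "w n \<in> borel_measurable torus" and wper: "periodic (w n)" for n
    using wL[of n] by (auto simp: Lp_def)
  define D where "D = 9 * (burgers.energy_bound (A + 1))\<^sup>2 * (A + 1)"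
  have m6: "(\<lambda>z. (w' n z) ^ 6) \<in> borel_measurable borel" for n using w'(1) by measurable
  have AE6: "AE z in torus. (w' n z) ^ 6 = (w n z) ^ 6" for n
    using w'(2)[of n] by (auto elim: eventually_mono)
  have i6: "integrable torus (\<lambda>z. (w n z) ^ 6)" and b6: "(LINT z|torus. (w n z) ^ 6) \<le> D" for n
  proof -
    have i: "integrable torus (\<lambda>z. (w' n z) ^ 6)"
      using burgers.L6_bound(1)[OF bw] integrable_torus[OF m6] by simp
    show "integrable torus (\<lambda>z. (w n z) ^ 6)"
      by (rule integrable_cong_AE_imp[OF i]) (use AE6 wm in \<open>auto elim: eventually_mono\<close>)
    have "(LINT z|torus. (w n z) ^ 6) = (LINT z|torus. (w' n z) ^ 6)"
      by (rule integral_cong_AE) (use AE6 wm measurable_torus_of_borel[OF w'(1)] in \<open>auto simp: eq_commute\<close>)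
    then show "(LINT z|torus. (w n z) ^ 6) \<le> D"
      using burgers.L6_bound(2)[OF bw[of n]] by (simp add: D_def integral_torus[OF m6])
  qed
  show ?thesis
    unfolding Lp_precompact_def
  proof (intro conjI allI impI)
    fix n
    \<comment> \<open>The convergence lemma for a constant sequence contains the integrability of |w
      n|^p.\<close>
    have "integrable torus (\<lambda>z. \<bar>w n z\<bar> powr p)"
      by (rule tendsto_Lp_of_AE(2)[OF finite_measure_torus, of "\<lambda>_. w n" "w n" D p])
        (use wm i6 b6 assms(5,6) in auto)
    then show "w n \<in> Lp p" using wm wper by (simp add: Lp_def)
  next
    fix r :: "nat \<Rightarrow> nat" assume "strict_mono r"
    \<comment> \<open>The compactness argument is run on the given subsequence itself, so the
      selection \<open>s\<close> refines \<open>r\<close>.\<close>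
    interpret burgers_seq "\<lambda>n. w' (r n)" "\<lambda>n. h (r n)" "\<lambda>n. g (r n)" "A + 1"
      by (rule burgers_seq.intro) (rule bw)
    obtain s :: "nat \<Rightarrow> nat" and v where s: "strict_mono s" and v: "v \<in> borel_measurable usq"
      and lim: "AE z in usq. (\<lambda>j. w' (r (s j)) z) \<longlonglongrightarrow> v z"
      by (rule AE_convergent_subseq)
    have vm: "periodize v \<in> borel_measurable torus" by (rule measurable_periodize[OF v])
    \<comment> \<open>Countably many functions are exchanged for their Borel representatives outside
      one common null set.\<close>
    have "AE z in torus. \<forall>n. w n z = w' n z" using w'(2) by (simp add: AE_all_countable)
    then have lim': "AE z in torus. (\<lambda>j. w (r (s j)) z) \<longlonglongrightarrow> periodize v z"
      using AE_torus[OF lim] AE_space[of torus]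
      by eventually_elim (simp add: periodize_eq)
    note conv = tendsto_Lp_of_AE[OF finite_measure_torus wm vm lim' i6 b6 assms(5,6)]
    have "periodize v \<in> Lp p"
      using conv(1) vm by (simp add: Lp_def periodic_periodize)
    moreover have "(\<lambda>j. Lp_norm p (\<lambda>x. w (r (s j)) x - periodize v x)) \<longlonglongrightarrow> 0"
      unfolding Lp_norm_def
      by (rule tendsto_zero_powrI[OF conv(3) tendsto_const]) (use assms(5) in auto)
    ultimately show "\<exists>s v. strict_mono s \<and> v \<in> Lp p \<and>
        (\<lambda>j. Lp_norm p (\<lambda>x. w (r (s j)) x - v x)) \<longlonglongrightarrow> 0"
      using s by blast
  qed
qed

end
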